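(* (1) Let $\mathcal{Q}=(N,g_N,\mathcal{I},\theta)$ be a $\mathfrak{Q}$-structure and let $t\in\mathbb{R}$. Then $g_{t,\mathcal{Q}}$ is non-degenerate if and only if $g_N(\theta,\theta)\ne1$. In this setting, $\mathcal{M}_{t,\mathcal{Q}}$ is homothety homogeneous with non-trivial homothety character $\lambda$ and the short exact sequence defined by $\lambda$ splits. (2) Let $\mathcal{M}$ be a homothety homogeneous Riemannian manifold with non-trivial homothety character $\lambda$ which is not VSI. If the short exact sequence defined by $\lambda$ splits and if $\xi$ is spacelike, where $\xi$ is the central homothety vector field giving rise to the splitting, then $\mathcal{M}=\mathcal{M}_{t,\mathcal{Q}}$ for some $\mathfrak{Q}$-structure $\mathcal{Q}=(N,g_N,\mathcal{I},\theta)$ and for some $t$, where $g_N(\theta,\theta)\ne1$.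
   Context: A quadruple $\mathcal{Q}=(N,g_N,\mathcal{I},\theta)$ is a $\mathfrak{Q}$-structure if $\mathcal{I}$ is a connected Lie group which acts transitively and effectively by isometries on a connected pseudo-Riemannian manifold $(N,g_N)$, and if $\theta$ is a smooth $1$-form on $N$ invariant under the action of $\mathcal{I}$. For $t\in\mathbb{R}$ set $$\mathcal{M}_{t,\mathcal{Q}}:=(\mathbb{R}\times N,g_{t,\mathcal{Q}}),\qquad g_{t,\mathcal{Q}}:=e^{tx}(dx^2+dx\circ\theta+ds^2_N),$$ where $x$ is the coordinate on $\mathbb{R}$, $ds_N^2=g_N$, and $dx\circ\theta$ denotes the symmetric product normalized so that $g_{t,\mathcal{Q}}(\partial_x,\eta)=e^{tx}\theta(\eta)$ for $\eta\in TN$. $g_N(\theta,\theta)$ is the (constant) squared norm of $\theta$ in the dual metric. A connected pseudo-Riemannian manifold $(M,g)$ is homothety homogeneous with homothety character $\lambda$ if there is a connected Lie group $\mathcal{H}$ of homotheties acting transitively on $M$, where $\Phi^*g=\lambda(\Phi)^2g$ with $\lambda(\Phi)>0$ constant for $\Phi\in\mathcal{H}$; the character is non-trivial if $\lambda\not\equiv1$. The short exact sequence defined by $\lambda$ is $1\to\ker(\lambda)\to\mathcal{H}\xrightarrow{\lambda}\mathbb{R}^+\to1$; it splits if $\mathcal{H}$ is isomorphic as a Lie group to $\mathbb{R}^+\oplus\ker(\lambda)$ in such a way that $\lambda$ becomes projection on the first factor. In that case there is a homothety vector field $\xi\ne0$ in the Lie algebra of $\mathcal{H}$ which commutes with the whole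 Lie algebra and which generates a $1$-parameter subgroup $\Phi_s$, $s\in\mathbb{R}^+$, central in $\mathcal{H}$ with $\lambda(\Phi_s)=s$; this is the $\xi$ giving rise to the splitting. A manifold is VSI if all scalar Weyl invariants (scalars built from covariant derivatives of the curvature tensor by contracting indices in pairs) vanish identically.
   Formalization: In (1), the non-trivial homothety character and the splitting are claimed only for t ≠ 0; for t = 0 they fail, e.g. for N = S¹ with rotations and θ = 0, where M is a flat cylinder whose homotheties are all isometries. *)

theory Defs
  imports "HOL-Analysis.Analysis" "HOL-Algebra.Algebra"
begin

section \<open>Smooth manifolds\<close>

text \<open>
  Points of the library space \<^term>\<open>Euclidean_space n\<close> are functions on \<^typ>\<open>nat\<close> vanishing from
  index n on. Smoothness on an open subset means that all iterated partial derivatives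
  exist and are continuous.
\<close>

definition pd :: "nat \<Rightarrow> ((nat \<Rightarrow> real) \<Rightarrow> real) \<Rightarrow> (nat \<Rightarrow> real) \<Rightarrow> real" where
  "pd i f x = deriv (\<lambda>s. f (x(i := s))) (x i)"

fun ipd :: "nat list \<Rightarrow> ((nat \<Rightarrow> real) \<Rightarrow> real) \<Rightarrow> (nat \<Rightarrow> real) \<Rightarrow> real" where
  "ipd [] f = f"
| "ipd (i # is) f = pd i (ipd is f)"

definition smooth_fn :: "nat \<Rightarrow> (nat \<Rightarrow> real) set \<Rightarrow> ((nat \<Rightarrow> real) \<Rightarrow> real) \<Rightarrow> bool" where
  "smooth_fn n U f \<longleftrightarrow>
     (\<forall>is. set is \<subseteq> {..<n} \<longrightarrow>
        continuous_on U (ipd is f) \<and>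
        (\<forall>x\<in>U. \<forall>i<n. (\<lambda>s. ipd is f (x(i := s))) differentiable (at (x i))))"

text \<open>The atlas need not be maximal; a chart is a pair of its domain and its coordinate map.\<close>

type_synonym 'a chart = "'a set \<times> ('a \<Rightarrow> nat \<Rightarrow> real)"

record 'a mfd =
  mtop :: "'a topology"
  mdim :: nat
  atlas :: "'a chart set"

abbreviation points :: "'a mfd \<Rightarrow> 'a set" where
  "points M \<equiv> topspace (mtop M)"

definition smooth_manifold :: "'a mfd \<Rightarrow> bool" where
  "smooth_manifold M \<longleftrightarrow>
     Hausdorff_space (mtop M) \<and> second_countable (mtop M) \<and>
     (\<Union>(U, \<phi>)\<in>atlas M. U) = points M \<and>
     (\<forall>(U, \<phi>)\<in>atlas M.
        openin (mtop M) U \<and> openin (Euclidean_space (mdim M)) (\<phi> ` U) \<and>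
        homeomorphic_map (subtopology (mtop M) U)
          (subtopology (Euclidean_space (mdim M)) (\<phi> ` U)) \<phi>) \<and>
     (\<forall>(U, \<phi>)\<in>atlas M. \<forall>(V, \<psi>)\<in>atlas M. \<forall>k<mdim M.
        smooth_fn (mdim M) (\<phi> ` (U \<inter> V)) (\<lambda>x. \<psi> (inv_into U \<phi> x) k))"

definition connected_manifold :: "'a mfd \<Rightarrow> bool" where
  "connected_manifold M \<longleftrightarrow> smooth_manifold M \<and> points M \<noteq> {} \<and> connected_space (mtop M)"

definition smooth_map :: "'a mfd \<Rightarrow> 'b mfd \<Rightarrow> ('a \<Rightarrow> 'b) \<Rightarrow> bool" where
  "smooth_map M N F \<longleftrightarrow>
     continuous_map (mtop M) (mtop N) F \<and>
     (\<forall>(U, \<phi>)\<in>atlas M. \<forall>(V, \<psi>)\<in>atlas N. \<forall>k<mdim N.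
        smooth_fn (mdim M) (\<phi> ` {p \<in> U. F p \<in> V}) (\<lambda>x. \<psi> (F (inv_into U \<phi> x)) k))"

definition diffeomorphism :: "'a mfd \<Rightarrow> 'b mfd \<Rightarrow> ('a \<Rightarrow> 'b) \<Rightarrow> bool" where
  "diffeomorphism M N F \<longleftrightarrow>
     bij_betw F (points M) (points N) \<and> smooth_map M N F \<and>
     smooth_map N M (inv_into (points M) F)"

definition real_mfd :: "real set \<Rightarrow> real mfd" where
  "real_mfd S = \<lparr>mtop = top_of_set S, mdim = 1, atlas = {(S, \<lambda>x i. if i = 0 then x else 0)}\<rparr>"

definition prod_mfd :: "'a mfd \<Rightarrow> 'b mfd \<Rightarrow> ('a \<times> 'b) mfd" where
  "prod_mfd M N =
     \<lparr>mtop = prod_topology (mtop M) (mtop N), mdim = mdim M + mdim N,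
      atlas = {(U \<times> V, \<lambda>(p, q) i. if i < mdim M then \<phi> p i else \<psi> q (i - mdim M)) | U \<phi> V \<psi>.
                 (U, \<phi>) \<in> atlas M \<and> (V, \<psi>) \<in> atlas N}\<rparr>"


section \<open>Tangent vectors\<close>

text \<open>
  A tangent vector at p is a directional derivative, acting on the functions which are smooth
  near p; it is fixed to be 0 on all other functions, so that equality of tangent vectors is
  equality of operators.
\<close>

type_synonym 'a tvec = "('a \<Rightarrow> real) \<Rightarrow> real"

definition smooth_near :: "'a mfd \<Rightarrow> 'a \<Rightarrow> ('a \<Rightarrow> real) \<Rightarrow> bool" where
  "smooth_near M p f \<longleftrightarrow>
     (\<exists>W. openin (mtop M) W \<and> p \<in> W \<and>
        (\<forall>(U, \<phi>)\<in>atlas M. smooth_fn (mdim M) (\<phi> ` (U \<inter> W)) (\<lambda>x. f (inv_into U \<phi> x))))"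

definition coord_vec :: "'a mfd \<Rightarrow> 'a chart \<Rightarrow> 'a \<Rightarrow> nat \<Rightarrow> 'a tvec" where
  "coord_vec M c p i =
     (\<lambda>f. if smooth_near M p f then pd i (\<lambda>x. f (inv_into (fst c) (snd c) x)) (snd c p) else 0)"

definition tangent_space :: "'a mfd \<Rightarrow> 'a \<Rightarrow> 'a tvec set" where
  "tangent_space M p =
     {v. \<exists>c\<in>atlas M. p \<in> fst c \<and>
           (\<exists>a. v = (\<lambda>f. \<Sum>i<mdim M. a i * coord_vec M c p i f))}"

text \<open>The differential of F : M \<open>\<rightarrow>\<close> N at p; only the structure of the target N is needed.\<close>

definition pushforward :: "'b mfd \<Rightarrow> ('a \<Rightarrow> 'b) \<Rightarrow> 'a \<Rightarrow> 'a tvec \<Rightarrow> 'b tvec" where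
  "pushforward N F p v = (\<lambda>f. if smooth_near N (F p) f then v (\<lambda>q. f (F q)) else 0)"

definition embedded_submanifold :: "'a mfd \<Rightarrow> 'a mfd \<Rightarrow> bool" where
  "embedded_submanifold S M \<longleftrightarrow>
     smooth_manifold S \<and> points S \<subseteq> points M \<and> mtop S = subtopology (mtop M) (points S) \<and>
     smooth_map S M (\<lambda>p. p) \<and>
     (\<forall>p\<in>points S. inj_on (pushforward M (\<lambda>p. p) p) (tangent_space S p))"


section \<open>1-forms and metrics\<close>

type_synonym 'a one_form = "'a \<Rightarrow> 'a tvec \<Rightarrow> real"
type_synonym 'a metric_tensor = "'a \<Rightarrow> 'a tvec \<Rightarrow> 'a tvec \<Rightarrow> real"

definition linear_form :: "'a tvec set \<Rightarrow> ('a tvec \<Rightarrow> real) \<Rightarrow> bool" where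
  "linear_form T \<omega> \<longleftrightarrow>
     (\<forall>u\<in>T. \<forall>v\<in>T. \<forall>a b. \<omega> (\<lambda>f. a * u f + b * v f) = a * \<omega> u + b * \<omega> v)"

definition smooth_one_form :: "'a mfd \<Rightarrow> 'a one_form \<Rightarrow> bool" where
  "smooth_one_form M \<theta> \<longleftrightarrow>
     (\<forall>p\<in>points M. linear_form (tangent_space M p) (\<theta> p)) \<and>
     (\<forall>c\<in>atlas M. \<forall>i<mdim M.
        smooth_fn (mdim M) (snd c ` fst c)
          (\<lambda>x. let p = inv_into (fst c) (snd c) x in \<theta> p (coord_vec M c p i)))"

definition metric_coeff ::
  "'a mfd \<Rightarrow> 'a metric_tensor \<Rightarrow> 'a chart \<Rightarrow> (nat \<Rightarrow> real) \<Rightarrow> nat \<Rightarrow> nat \<Rightarrow> real" where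
  "metric_coeff M g c x i j =
     (let p = inv_into (fst c) (snd c) x in g p (coord_vec M c p i) (coord_vec M c p j))"

definition smooth_symmetric_form :: "'a mfd \<Rightarrow> 'a metric_tensor \<Rightarrow> bool" where
  "smooth_symmetric_form M g \<longleftrightarrow>
     (\<forall>p\<in>points M. \<forall>u\<in>tangent_space M p.
        linear_form (tangent_space M p) (g p u) \<and> (\<forall>v\<in>tangent_space M p. g p u v = g p v u)) \<and>
     (\<forall>c\<in>atlas M. \<forall>i<mdim M. \<forall>j<mdim M.
        smooth_fn (mdim M) (snd c ` fst c) (\<lambda>x. metric_coeff M g c x i j))"

definition nondegenerate :: "'a mfd \<Rightarrow> 'a metric_tensor \<Rightarrow> bool" where
  "nondegenerate M g \<longleftrightarrow>
     (\<forall>p\<in>points M. \<forall>u\<in>tangent_space M p.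
        (\<forall>v\<in>tangent_space M p. g p u v = 0) \<longrightarrow> u = (\<lambda>f. 0))"

definition pseudo_riemannian :: "'a mfd \<Rightarrow> 'a metric_tensor \<Rightarrow> bool" where
  "pseudo_riemannian M g \<longleftrightarrow>
     connected_manifold M \<and> smooth_symmetric_form M g \<and> nondegenerate M g"

definition riemannian :: "'a mfd \<Rightarrow> 'a metric_tensor \<Rightarrow> bool" where
  "riemannian M g \<longleftrightarrow>
     pseudo_riemannian M g \<and>
     (\<forall>p\<in>points M. \<forall>u\<in>tangent_space M p. u \<noteq> (\<lambda>f. 0) \<longrightarrow> g p u u > 0)"

text \<open>The squared norm of a 1-form in the dual metric, i.e. that of its metric dual vector.\<close>

definition dual_vector :: "'a mfd \<Rightarrow> 'a metric_tensor \<Rightarrow> 'a one_form \<Rightarrow> 'a \<Rightarrow> 'a tvec" where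
  "dual_vector M g \<theta> p =
     (THE u. u \<in> tangent_space M p \<and> (\<forall>v\<in>tangent_space M p. g p u v = \<theta> p v))"

definition form_norm2 :: "'a mfd \<Rightarrow> 'a metric_tensor \<Rightarrow> 'a one_form \<Rightarrow> 'a \<Rightarrow> real" where
  "form_norm2 M g \<theta> p = g p (dual_vector M g \<theta> p) (dual_vector M g \<theta> p)"

definition scales_metric ::
  "'a mfd \<Rightarrow> 'a metric_tensor \<Rightarrow> 'b mfd \<Rightarrow> 'b metric_tensor \<Rightarrow> ('a \<Rightarrow> 'b) \<Rightarrow> real \<Rightarrow> bool" where
  "scales_metric M g M' g' F a \<longleftrightarrow>
     (\<forall>p\<in>points M. \<forall>u\<in>tangent_space M p. \<forall>v\<in>tangent_space M p.
        g' (F p) (pushforward M' F p u) (pushforward M' F p v) = a\<^sup>2 * g p u v)"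

definition isometric ::
  "'a mfd \<Rightarrow> 'a metric_tensor \<Rightarrow> 'b mfd \<Rightarrow> 'b metric_tensor \<Rightarrow> bool" where
  "isometric M g M' g' \<longleftrightarrow> (\<exists>F. diffeomorphism M M' F \<and> scales_metric M g M' g' F 1)"


section \<open>Lie groups and their actions\<close>

definition lie_group :: "'g monoid \<Rightarrow> 'g mfd \<Rightarrow> bool" where
  "lie_group G L \<longleftrightarrow>
     group G \<and> smooth_manifold L \<and> points L = carrier G \<and>
     smooth_map (prod_mfd L L) L (\<lambda>(a, b). a \<otimes>\<^bsub>G\<^esub> b) \<and>
     smooth_map L L (\<lambda>a. inv\<^bsub>G\<^esub> a)"

definition connected_lie_group :: "'g monoid \<Rightarrow> 'g mfd \<Rightarrow> bool" where
  "connected_lie_group G L \<longleftrightarrow> lie_group G L \<and> connected_space (mtop L)"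

definition lie_isomorphism ::
  "'g monoid \<Rightarrow> 'g mfd \<Rightarrow> 'h monoid \<Rightarrow> 'h mfd \<Rightarrow> ('g \<Rightarrow> 'h) \<Rightarrow> bool" where
  "lie_isomorphism G L G' L' F \<longleftrightarrow> F \<in> iso G G' \<and> diffeomorphism L L' F"

definition transitive_effective_action ::
  "'g monoid \<Rightarrow> 'g mfd \<Rightarrow> 'a mfd \<Rightarrow> ('g \<Rightarrow> 'a \<Rightarrow> 'a) \<Rightarrow> bool" where
  "transitive_effective_action G L M \<Phi> \<longleftrightarrow>
     transitive_action G (points M) \<Phi> \<and> faithful_action G (points M) \<Phi> \<and>
     smooth_map (prod_mfd L M) M (\<lambda>(h, p). \<Phi> h p)"

definition positive_reals :: "real monoid" where
  "positive_reals = \<lparr>carrier = {0<..}, mult = (*), one = 1\<rparr>"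


section \<open>\<open>\<QQ>\<close>-structures\<close>

definition Q_structure ::
  "'a mfd \<Rightarrow> 'a metric_tensor \<Rightarrow> 'g monoid \<Rightarrow> 'g mfd \<Rightarrow> ('g \<Rightarrow> 'a \<Rightarrow> 'a) \<Rightarrow> 'a one_form \<Rightarrow> bool"
where
  "Q_structure N gN I L \<Phi> \<theta> \<longleftrightarrow>
     pseudo_riemannian N gN \<and>
     connected_lie_group I L \<and> transitive_effective_action I L N \<Phi> \<and>
     (\<forall>h\<in>carrier I. scales_metric N gN N gN (\<Phi> h) 1) \<and>
     smooth_one_form N \<theta> \<and>
     (\<forall>h\<in>carrier I. \<forall>p\<in>points N. \<forall>u\<in>tangent_space N p.
        \<theta> (\<Phi> h p) (pushforward N (\<Phi> h) p u) = \<theta> p u)"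

abbreviation MQ :: "'a mfd \<Rightarrow> (real \<times> 'a) mfd" where
  "MQ N \<equiv> prod_mfd (real_mfd UNIV) N"

text \<open>
  Here \<open>u fst\<close> is \<open>dx(u)\<close>, since fst is the coordinate x. The symmetric product \<open>dx \<circ> \<theta>\<close> is
  \<open>dx \<otimes> \<theta> + \<theta> \<otimes> dx\<close>, without a factor 1/2.
\<close>

definition gQ :: "real \<Rightarrow> 'a mfd \<Rightarrow> 'a metric_tensor \<Rightarrow> 'a one_form \<Rightarrow> (real \<times> 'a) metric_tensor"
where
  "gQ t N gN \<theta> = (\<lambda>(x, p) u v.
     let u' = pushforward N snd (x, p) u; v' = pushforward N snd (x, p) v in
     exp (t * x) * (u fst * v fst + (u fst * \<theta> p v' + v fst * \<theta> p u') + gN p u' v'))"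


section \<open>Homothety homogeneity\<close>

text \<open>
  The group \<open>\<H>\<close> of homotheties is given as a Lie group acting effectively, i.e. whose elements
  are identified with the diffeomorphisms they induce.
\<close>

definition homothety_homogeneous ::
  "'a mfd \<Rightarrow> 'a metric_tensor \<Rightarrow> 'h monoid \<Rightarrow> 'h mfd \<Rightarrow> ('h \<Rightarrow> 'a \<Rightarrow> 'a) \<Rightarrow> ('h \<Rightarrow> real) \<Rightarrow> bool"
where
  "homothety_homogeneous M g H L \<Phi> \<mu> \<longleftrightarrow>
     pseudo_riemannian M g \<and>
     connected_lie_group H L \<and> transitive_effective_action H L M \<Phi> \<and>
     (\<forall>h\<in>carrier H. \<mu> h > 0 \<and> scales_metric M g M g (\<Phi> h) (\<mu> h))"

definition nontrivial_character :: "'h monoid \<Rightarrow> ('h \<Rightarrow> real) \<Rightarrow> bool" where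
  "nontrivial_character H \<mu> \<longleftrightarrow> (\<exists>h\<in>carrier H. \<mu> h \<noteq> 1)"

definition character_splits :: "'h monoid \<Rightarrow> 'h mfd \<Rightarrow> ('h \<Rightarrow> real) \<Rightarrow> bool" where
  "character_splits H L \<mu> \<longleftrightarrow>
     (let K = H\<lparr>carrier := kernel H positive_reals \<mu>\<rparr> in
      \<exists>LK \<Psi>. lie_group K LK \<and> embedded_submanifold LK L \<and>
        lie_isomorphism (positive_reals \<times>\<times> K) (prod_mfd (real_mfd {0<..}) LK) H L \<Psi> \<and>
        (\<forall>s>0. \<forall>k\<in>carrier K. \<mu> (\<Psi> (s, k)) = s))"

text \<open>
  The vector field \<open>\<xi>\<close> on M generated by a central 1-parameter subgroup \<open>\<sigma>\<close> with \<open>\<mu> \<circ> \<sigma> = id\<close>.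
  The parameter group is the multiplicative group of positive reals, so the generator is the
  derivative at s = 1. That \<open>\<xi> \<noteq> 0\<close> and that \<open>\<xi>\<close> commutes with the Lie algebra are
  consequences of \<open>\<mu> (\<sigma> s) = s\<close> and of the centrality of \<open>\<sigma>\<close>.
\<close>

definition splitting_field ::
  "'a mfd \<Rightarrow> 'h monoid \<Rightarrow> 'h mfd \<Rightarrow> ('h \<Rightarrow> 'a \<Rightarrow> 'a) \<Rightarrow> ('h \<Rightarrow> real) \<Rightarrow> ('a \<Rightarrow> 'a tvec) \<Rightarrow> bool"
where
  "splitting_field M H L \<Phi> \<mu> \<xi> \<longleftrightarrow>
     (\<exists>\<sigma>. \<sigma> \<in> hom positive_reals H \<and> smooth_map (real_mfd {0<..}) L \<sigma> \<and>
        (\<forall>s>0. \<mu> (\<sigma> s) = s \<and> (\<forall>h\<in>carrier H. \<sigma> s \<otimes>\<^bsub>H\<^esub> h = h \<otimes>\<^bsub>H\<^esub> \<sigma> s)) \<and>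
        (\<forall>p\<in>points M.
           \<xi> p = (\<lambda>f. if smooth_near M p f then deriv (\<lambda>s. f (\<Phi> (\<sigma> s) p)) 1 else 0)))"

definition spacelike :: "'a mfd \<Rightarrow> 'a metric_tensor \<Rightarrow> ('a \<Rightarrow> 'a tvec) \<Rightarrow> bool" where
  "spacelike M g \<xi> \<longleftrightarrow> (\<forall>p\<in>points M. g p (\<xi> p) (\<xi> p) > 0)"


section \<open>Scalar Weyl invariants\<close>

text \<open>
  Classical tensor calculus in a chart of dimension n. The argument G is the matrix of metric
  coefficients as a function of the coordinates; covariant tensor fields are functions of the
  coordinates and of a list of indices.
\<close>

type_synonym coeffs = "(nat \<Rightarrow> real) \<Rightarrow> nat \<Rightarrow> nat \<Rightarrow> real"
type_synonym tensor = "(nat \<Rightarrow> real) \<Rightarrow> nat list \<Rightarrow> real"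

definition inv_metric :: "nat \<Rightarrow> coeffs \<Rightarrow> coeffs" where
  "inv_metric n G x =
     (THE h. (\<forall>i<n. \<forall>j<n. (\<Sum>k<n. h i k * G x k j) = (if i = j then 1 else 0)) \<and>
             (\<forall>i j. i \<ge> n \<or> j \<ge> n \<longrightarrow> h i j = 0))"

text \<open>\<open>christoffel n G l i j x\<close> is \<open>\<Gamma>\<^sup>l\<^sub>i\<^sub>j\<close>.\<close>

definition christoffel :: "nat \<Rightarrow> coeffs \<Rightarrow> nat \<Rightarrow> nat \<Rightarrow> nat \<Rightarrow> (nat \<Rightarrow> real) \<Rightarrow> real" where
  "christoffel n G l i j x =
     (\<Sum>m<n. inv_metric n G x l m *
        (pd i (\<lambda>y. G y j m) x + pd j (\<lambda>y. G y i m) x - pd m (\<lambda>y. G y i j) x)) / 2"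

text \<open>\<open>R\<^sub>i\<^sub>j\<^sub>k\<^sub>l = g(R(\<partial>\<^sub>i,\<partial>\<^sub>j)\<partial>\<^sub>k, \<partial>\<^sub>l)\<close> with \<open>R(X,Y) = [\<nabla>\<^sub>X,\<nabla>\<^sub>Y] - \<nabla>\<^bsub>[X,Y]\<^esub>\<close>.\<close>

definition riemann :: "nat \<Rightarrow> coeffs \<Rightarrow> tensor" where
  "riemann n G x is =
     (let i = is ! 0; j = is ! 1; k = is ! 2; l = is ! 3; \<Gamma> = christoffel n G in
      \<Sum>m<n. G x l m *
        (pd i (\<Gamma> m j k) x - pd j (\<Gamma> m i k) x +
         (\<Sum>r<n. \<Gamma> m i r x * \<Gamma> r j k x - \<Gamma> m j r x * \<Gamma> r i k x)))"

text \<open>The covariant derivative; the new index is the first one.\<close>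

fun covd :: "nat \<Rightarrow> coeffs \<Rightarrow> tensor \<Rightarrow> tensor" where
  "covd n G T x [] = 0"
| "covd n G T x (k # is) =
     pd k (\<lambda>y. T y is) x -
     (\<Sum>a<length is. \<Sum>l<n. christoffel n G l k (is ! a) x * T x (is[a := l]))"

definition curv :: "nat \<Rightarrow> coeffs \<Rightarrow> nat \<Rightarrow> tensor" where
  "curv n G k = (covd n G ^^ k) (riemann n G)"

text \<open>\<open>\<nabla>\<^bsup>k\<^sub>1\<^esup>R \<otimes> \<dots> \<otimes> \<nabla>\<^bsup>k\<^sub>m\<^esup>R\<close> for a list of orders \<open>k\<^sub>1, \<dots>, k\<^sub>m\<close>.\<close>

fun curv_prod :: "nat \<Rightarrow> coeffs \<Rightarrow> nat list \<Rightarrow> tensor" where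
  "curv_prod n G [] x is = 1"
| "curv_prod n G (k # ks) x is =
     curv n G k x (take (k + 4) is) * curv_prod n G ks x (drop (k + 4) is)"

text \<open>
  The complete contraction of \<^const>\<open>curv_prod\<close> in which the index positions \<open>\<pi> (2a)\<close> and
  \<open>\<pi> (2a + 1)\<close> are paired.
\<close>

definition weyl_monomial ::
  "nat \<Rightarrow> coeffs \<Rightarrow> nat list \<Rightarrow> (nat \<Rightarrow> nat) \<Rightarrow> (nat \<Rightarrow> real) \<Rightarrow> real" where
  "weyl_monomial n G ks \<pi> x =
     (let r = (\<Sum>k\<leftarrow>ks. k + 4) in
      \<Sum>is\<in>{is. length is = r \<and> set is \<subseteq> {..<n}}.
        (\<Prod>a<r div 2. inv_metric n G x (is ! \<pi> (2 * a)) (is ! \<pi> (2 * a + 1))) *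
        curv_prod n G ks x is)"

text \<open>
  The scalar Weyl invariants are the linear combinations of these complete contractions, so it
  is enough that the latter vanish.
\<close>

definition VSI :: "'a mfd \<Rightarrow> 'a metric_tensor \<Rightarrow> bool" where
  "VSI M g \<longleftrightarrow>
     (\<forall>c\<in>atlas M. \<forall>x\<in>snd c ` fst c. \<forall>ks \<pi>.
        ks \<noteq> [] \<and> even (\<Sum>k\<leftarrow>ks. k + 4) \<and>
        bij_betw \<pi> {..<(\<Sum>k\<leftarrow>ks. k + 4)} {..<(\<Sum>k\<leftarrow>ks. k + 4)} \<longrightarrow>
        weyl_monomial (mdim M) (metric_coeff M g c) ks \<pi> x = 0)"

end

theory Submission
  imports Defs
begin

text \<open>
  (1) For u in the tangent space of \<open>\<real> \<times> N\<close> write \<open>u = a \<partial>\<^sub>x + w\<close> with w tangent to N. Then u is in the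
  radical of \<open>g\<^bsub>t,\<Q>\<^esub>\<close> iff \<open>w = - a \<theta>\<^sup>#\<close> and \<open>a (1 - g\<^sub>N(\<theta>,\<theta>)) = 0\<close>. The group \<open>\<real> \<times> \<I>\<close> acts by
  \<open>(s, h) (x, p) = (x + s, h p)\<close> and scales the metric by \<open>e\<^bsup>ts\<^esup>\<close>.

  (2) As \<open>\<xi>\<close> is central it is invariant under \<open>\<H>\<close>, so \<open>F = g(\<xi>,\<xi>) > 0\<close> satisfies
  \<open>F(h p) = \<lambda>(h)\<^sup>2 F(p)\<close>. Take \<open>N = {F = 1}\<close>, which is a regular level set because \<open>\<xi>(F) = 2 F\<close>, with the
  induced metric, \<open>\<theta> = g(\<xi>, \<cdot>)\<close> and \<open>\<I> = ker \<lambda>\<close>. The flow of \<open>\<xi>\<close> identifies \<open>\<real> \<times> N\<close> with M, and the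
  metric becomes \<open>g\<^bsub>t,\<Q>\<^esub>\<close> with \<open>t = 2\<close>.
\<close>

text \<open>The value t = 2 and the unit coefficient of dx^2 are normalizations: the central
  subgroup has character s at the parameter s, so with s = e^x its flow scales the metric by e^{2x},
  and F = 1 says that \<xi> has unit length on N. Taking N as a subset of M, rather than as the
  orbit space of the flow, makes its metric and its form plain restrictions, at the price of an
  implicit function theorem. Positive definiteness enters part (2) twice: it keeps the restricted
  metric non-degenerate, and it excludes norm 1 for \<theta>, as \<xi> minus the dual vector of
  \<theta> would then be null. The splitting provides the Lie structure of the kernel of the
  character and its connectedness, the kernel being a factor of a connected group. The kernel acts
  effectively on N because it commutes with the flow, all of whose orbits meet N. In part (1) the
  character is e^{ts/2}, because a homothety scales the metric by the square of its character. Since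
  tangent vectors are operators on functions, identities between differentials are checked on the
  coordinates of one chart.\<close>

section \<open>Topology of Euclidean space and locality of partial derivatives\<close>

lemma openin_Euclidean_space_box:
  "openin (Euclidean_space n) U \<longleftrightarrow> U \<subseteq> topspace (Euclidean_space n) \<and>
     (\<forall>x\<in>U. \<exists>e>0. \<forall>y\<in>topspace (Euclidean_space n). (\<forall>i<n. \<bar>y i - x i\<bar> < e) \<longrightarrow> y \<in> U)"
    (is "?L \<longleftrightarrow> ?R")
proof
  assume L: ?L
  have "\<exists>e>0. \<forall>y\<in>topspace (Euclidean_space n). (\<forall>i<n. \<bar>y i - x i\<bar> < e) \<longrightarrow> y \<in> U" if x: "x \<in> U" for x
  proof -
    obtain T where T: "openin (powertop_real UNIV) T" "U = T \<inter> topspace (Euclidean_space n)"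
      using L by (auto simp: Euclidean_space_def openin_subtopology)
    then have "x \<in> T" using x by auto
    with T(1) obtain Z where Z0: "x \<in> PiE UNIV Z" "\<forall>i. openin euclideanreal (Z i)" "PiE UNIV Z \<subseteq> T"
      using product_topology_open_contains_basis by meson
    then have Z: "\<And>i. x i \<in> Z i" "\<And>i. openin euclideanreal (Z i)" "\<And>y. (\<And>i. y i \<in> Z i) \<Longrightarrow> y \<in> T"
      by (auto simp: PiE_iff subset_iff)
    have "\<exists>e>0. \<forall>z. \<bar>z - x i\<bar> < e \<longrightarrow> z \<in> Z i" for i
      using Z(1)[of i] Z(2)[of i] by (auto simp: open_dist dist_real_def)
    then obtain e where e: "\<And>i. e i > 0" "\<And>i z. \<bar>z - x i\<bar> < e i \<Longrightarrow> z \<in> Z i" by metis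
    \<comment> \<open>Only the first n coordinates can differ, so finitely many radii matter; the
      extra 1 keeps the minimum defined when n = 0.\<close>
    define d where "d = Min (insert 1 (e ` {..<n}))"
    have d: "d > 0" "\<And>i. i < n \<Longrightarrow> d \<le> e i" unfolding d_def using e(1) by auto
    show ?thesis
    proof (intro exI conjI ballI impI)
      fix y assume y: "y \<in> topspace (Euclidean_space n)" "\<forall>i<n. \<bar>y i - x i\<bar> < d"
      have "y i \<in> Z i" for i
      proof (cases "i < n")
        case True then show ?thesis using y d(2)[of i] e(2)[of "y i" i] by auto
      next
        case False then have "y i = x i" using x T(2) y(1) by (auto simp: topspace_Euclidean_space)
        then show ?thesis using e(1)[of i] e(2)[of "y i" i] by simp
      qed
      then show "y \<in> U" using Z(3)[of y] T(2) y(1) by auto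
    qed (rule d)
  qed
  then show ?R using openin_subset[OF L] by auto
next
  assume R: ?R
  then obtain e where e: "\<And>x. x \<in> U \<Longrightarrow> e x > 0"
    "\<And>x y. x \<in> U \<Longrightarrow> y\<in>topspace (Euclidean_space n) \<Longrightarrow> (\<forall>i<n. \<bar>y i - x i\<bar> < e x) \<Longrightarrow> y \<in> U" by metis
  \<comment> \<open>These cylinders are open in the full function space; on the subspace they cut
    out exactly the boxes around the points of U.\<close>
  define T where "T = (\<Union>x\<in>U. \<Inter>i\<in>{..<n}. {y::nat\<Rightarrow>real. \<bar>y i - x i\<bar> < e x})"
  have "open T" unfolding T_def
    by (intro open_UN ballI open_INT finite_lessThan open_Collect_less continuous_intros continuous_on_product_coordinates)
  moreover have "U = T \<inter> topspace (Euclidean_space n)"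
  proof
    show "U \<subseteq> T \<inter> topspace (Euclidean_space n)"
      using R e(1) by (auto simp: T_def)
    show "T \<inter> topspace (Euclidean_space n) \<subseteq> U"
      using e(2) unfolding T_def by blast
  qed
  ultimately show ?L
    by (auto simp: Euclidean_space_def openin_subtopology euclidean_product_topology)
qed

text \<open>Passes between \<open>continuous_on\<close>, which refers to the topology of the
  function type, and the abstract topology \<open>Euclidean_space\<close>.\<close>

lemma top_of_set_Euclidean_space:
  assumes "U \<subseteq> topspace (Euclidean_space n)"
  shows "top_of_set U = subtopology (Euclidean_space n) U"
  using assms by (auto simp: Euclidean_space_def subtopology_subtopology euclidean_product_topology Int_absorb1)

lemma openin_continuous_preimage:
  assumes "openin (Euclidean_space n) U" "continuous_on U f" "openin (top_of_set V) A" "f ` U \<subseteq> V"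
  shows "openin (Euclidean_space n) {x\<in>U. f x \<in> A}"
proof -
  have "openin (top_of_set U) (U \<inter> f -` A)"
    using assms by (intro continuous_openin_preimage) auto
  then show ?thesis
    using assms(1) openin_subset[OF assms(1)]
    by (simp add: top_of_set_Euclidean_space openin_open_subtopology Int_def vimage_def)
qed

text \<open>The form in which continuity enters the estimates below: coordinates from n on vanish,
  so only n inequalities have to be checked.\<close>

lemma continuous_on_Euclidean_box:
  fixes f :: "(nat \<Rightarrow> real) \<Rightarrow> real"
  assumes U: "openin (Euclidean_space n) U"
  shows "continuous_on U f \<longleftrightarrow>
    (\<forall>x\<in>U. \<forall>\<epsilon>>0. \<exists>d>0. \<forall>y\<in>U. (\<forall>i<n. \<bar>y i - x i\<bar> < d) \<longrightarrow> \<bar>f y - f x\<bar> < \<epsilon>)" (is "?L \<longleftrightarrow> ?R")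
proof
  assume L: ?L
  show ?R
  proof (intro ballI allI impI)
    fix x and \<epsilon> :: real assume x: "x \<in> U" "\<epsilon> > 0"
    have "openin (Euclidean_space n) {y\<in>U. f y \<in> ball (f x) \<epsilon>}"
      by (rule openin_continuous_preimage[OF U L, of UNIV]) auto
    then obtain d where "d > 0"
      "\<forall>y\<in>topspace (Euclidean_space n). (\<forall>i<n. \<bar>y i - x i\<bar> < d) \<longrightarrow> y \<in> {y\<in>U. f y \<in> ball (f x) \<epsilon>}"
      unfolding openin_Euclidean_space_box using x by force
    then show "\<exists>d>0. \<forall>y\<in>U. (\<forall>i<n. \<bar>y i - x i\<bar> < d) \<longrightarrow> \<bar>f y - f x\<bar> < \<epsilon>"
      using openin_subset[OF U] by (intro exI[of _ d]) (auto simp: dist_real_def abs_minus_commute)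
  qed
next
  assume R: ?R
  have "openin (top_of_set U) (U \<inter> f -` B)" if B: "open B" for B
  proof -
    have "openin (Euclidean_space n) (U \<inter> f -` B)"
      unfolding openin_Euclidean_space_box
    proof (intro conjI ballI)
      fix x assume x: "x \<in> U \<inter> f -` B"
      then obtain \<epsilon> where \<epsilon>: "\<epsilon> > 0" "\<And>z. \<bar>z - f x\<bar> < \<epsilon> \<Longrightarrow> z \<in> B"
        using B by (auto simp: open_dist dist_real_def)
      obtain d where d: "d > 0" "\<And>y. y \<in> U \<Longrightarrow> (\<forall>i<n. \<bar>y i - x i\<bar> < d) \<Longrightarrow> \<bar>f y - f x\<bar> < \<epsilon>"
        using R x \<epsilon>(1) by blast
      obtain d' where d': "d' > 0" "\<And>y. y\<in>topspace (Euclidean_space n) \<Longrightarrow> (\<forall>i<n. \<bar>y i - x i\<bar> < d') \<Longrightarrow> y \<in> U"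
        using U x unfolding openin_Euclidean_space_box by blast
      show "\<exists>e>0. \<forall>y\<in>topspace (Euclidean_space n). (\<forall>i<n. \<bar>y i - x i\<bar> < e) \<longrightarrow> y \<in> U \<inter> f -` B"
        using d d' \<epsilon> by (intro exI[of _ "min d d'"]) auto
    qed (use openin_subset[OF U] in auto)
    then show ?thesis
      using U openin_subset[OF U] by (simp add: top_of_set_Euclidean_space openin_open_subtopology)
  qed
  then show ?L
    using continuous_on_open_gen[of f U UNIV] by simp
qed

lemma eventually_line_in_open:
  assumes U: "openin (Euclidean_space n) U" and x: "x \<in> U" and i: "i < n"
  shows "\<forall>\<^sub>F s in nhds (x i). x(i := s) \<in> U"
proof -
  obtain e where e: "e > 0" "\<And>y. y\<in>topspace (Euclidean_space n) \<Longrightarrow> (\<forall>i<n. \<bar>y i - x i\<bar> < e) \<Longrightarrow> y \<in> U"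
    using U x unfolding openin_Euclidean_space_box by meson
  have "x(i := s) \<in> U" if "dist s (x i) < e" for s
    using openin_subset[OF U] x i that e(1) by (intro e(2)) (auto simp: topspace_Euclidean_space dist_real_def)
  then show ?thesis using e(1) by (auto simp: eventually_nhds_metric)
qed

text \<open>A partial derivative depends only on the values near the point along one coordinate
  line, and such a line stays in an open set for nearby parameters.\<close>

lemma pd_cong:
  assumes "openin (Euclidean_space n) U" "x \<in> U" "i < n" "\<And>y. y \<in> U \<Longrightarrow> f y = h y"
  shows "pd i f x = pd i h x"
proof -
  have "\<forall>\<^sub>F s in nhds (x i). f (x(i := s)) = h (x(i := s))"
    using eventually_line_in_open[OF assms(1-3)] by eventually_elim (use assms(4) in auto)
  then show ?thesis unfolding pd_def by (intro deriv_cong_ev) auto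
qed

lemma differentiable_line_cong:
  assumes "openin (Euclidean_space n) U" "x \<in> U" "i < n" "\<And>y. y \<in> U \<Longrightarrow> f y = h y"
  shows "(\<lambda>s. f (x(i := s))) differentiable at (x i) \<longleftrightarrow> (\<lambda>s. h (x(i := s)) :: real) differentiable at (x i)"
proof -
  have *: "\<forall>\<^sub>F s in nhds (x i). f (x(i := s)) = h (x(i := s))"
    using eventually_line_in_open[OF assms(1-3)] by eventually_elim (use assms(4) in auto)
  then show ?thesis
    unfolding real_differentiable_def
    using DERIV_cong_ev[OF refl * refl] by blast
qed

lemma pd_eqI: "((\<lambda>s. f (x(i := s))) has_real_derivative d) (at (x i)) \<Longrightarrow> pd i f x = d"
  unfolding pd_def by (rule DERIV_imp_deriv)

text \<open>The class \<open>C\<^sup>r\<close>, which allows closure properties of smoothness to be proved by induction on r.\<close>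

primrec Ck :: "nat \<Rightarrow> nat \<Rightarrow> (nat \<Rightarrow> real) set \<Rightarrow> ((nat \<Rightarrow> real) \<Rightarrow> real) \<Rightarrow> bool" where
  "Ck 0 n U f \<longleftrightarrow> continuous_on U f"
| "Ck (Suc r) n U f \<longleftrightarrow> continuous_on U f \<and>
     (\<forall>i<n. (\<forall>x\<in>U. (\<lambda>s. f (x(i := s))) differentiable (at (x i))) \<and> Ck r n U (pd i f))"

text \<open>\<open>ipd\<close> applies the head of its list last, whereas \<open>Ck\<close> peels
  off the derivative that is applied first; splitting lists at the end reconciles the two.\<close>

lemma ipd_snoc: "ipd (is @ [i]) f = ipd is (pd i f)"
  by (induction "is") auto

lemma smooth_fn_pd:
  assumes "smooth_fn n U f" "i < n"
  shows "smooth_fn n U (pd i f)"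
  unfolding smooth_fn_def
proof (intro allI impI)
  fix "is" :: "nat list" assume "set is \<subseteq> {..<n}"
  then have "set (is @ [i]) \<subseteq> {..<n}" using assms(2) by auto
  from assms(1)[unfolded smooth_fn_def, rule_format, OF this]
  show "continuous_on U (ipd is (pd i f)) \<and>
      (\<forall>x\<in>U. \<forall>j<n. (\<lambda>s. ipd is (pd i f) (x(j := s))) differentiable (at (x j)))"
    by (simp add: ipd_snoc)
qed

lemma smooth_fn_iff_Ck: "smooth_fn n U f \<longleftrightarrow> (\<forall>r. Ck r n U f)"
proof
  have base: "continuous_on U f \<and> (\<forall>x\<in>U. \<forall>i<n. (\<lambda>s. f (x(i := s))) differentiable (at (x i)))"
    if "smooth_fn n U f" for f
    using that unfolding smooth_fn_def by (metis empty_set empty_subsetI ipd.simps(1))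
  have "Ck r n U f" if "smooth_fn n U f" for r
    using that
  proof (induction r arbitrary: f)
    case 0 then show ?case using base by auto
  next
    case (Suc r)
    then show ?case using base[of f] smooth_fn_pd[of n U f] by auto
  qed
  then show "smooth_fn n U f \<Longrightarrow> \<forall>r. Ck r n U f" by blast
next
  assume "\<forall>r. Ck r n U f"
  then have "continuous_on U (ipd is f) \<and> (\<forall>x\<in>U. \<forall>i<n. (\<lambda>s. ipd is f (x(i := s))) differentiable (at (x i)))"
    if "set is \<subseteq> {..<n}" for "is"
    using that
  proof (induction "is" arbitrary: f rule: rev_induct)
    case Nil
    then show ?case by (metis Ck.simps(2) ipd.simps(1))
  next
    case (snoc i "is")
    have "Ck r n U (pd i f)" for r
      using snoc.prems(1)[rule_format, of "Suc r"] snoc.prems(2) by auto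
    then show ?case using snoc.IH[of "pd i f"] snoc.prems(2) by (auto simp: ipd_snoc)
  qed
  then show "smooth_fn n U f" unfolding smooth_fn_def by blast
qed

lemma Ck_Suc_imp: "Ck (Suc r) n U f \<Longrightarrow> Ck r n U f"
  by (induction r arbitrary: f) auto

lemma Ck_imp_continuous: "Ck r n U f \<Longrightarrow> continuous_on U f"
  by (cases r) auto

lemma Ck_has_pd:
  assumes "Ck (Suc r) n U f" "x \<in> U" "i < n"
  shows "((\<lambda>s. f (x(i := s))) has_real_derivative pd i f x) (at (x i))"
  using assms unfolding pd_def by (auto simp: DERIV_deriv_iff_real_differentiable)

lemma Ck_cong:
  assumes "openin (Euclidean_space n) U" "\<And>y. y \<in> U \<Longrightarrow> f y = h y" "Ck r n U f"
  shows "Ck r n U h"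
  using assms(2,3)
proof (induction r arbitrary: f h)
  case 0 then show ?case using continuous_on_cong[of U U f h] by simp
next
  case (Suc r)
  have "Ck r n U (pd i h)" if i: "i < n" for i
  proof (rule Suc.IH)
    show "pd i f y = pd i h y" if "y \<in> U" for y
      by (rule pd_cong[OF assms(1) that i]) (rule Suc.prems(1))
    show "Ck r n U (pd i f)" using Suc.prems(2) i by simp
  qed
  moreover have "(\<lambda>s. h (x(i := s))) differentiable (at (x i))" if "i < n" "x \<in> U" for i x
    using differentiable_line_cong[OF assms(1) that(2,1), of f h] Suc.prems that by auto
  ultimately show ?case using Suc.prems continuous_on_cong[of U U f h] by auto
qed

text \<open>The partial derivatives may be given by any formula D, which is how the rules of
  differentiation deliver them.\<close>

lemma Ck_SucI:
  assumes U: "openin (Euclidean_space n) U" and "continuous_on U f"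
    and D: "\<And>i x. i < n \<Longrightarrow> x \<in> U \<Longrightarrow> ((\<lambda>s. f (x(i := s))) has_real_derivative D i x) (at (x i))"
    and C: "\<And>i. i < n \<Longrightarrow> Ck r n U (D i)"
  shows "Ck (Suc r) n U f"
proof -
  have "Ck r n U (pd i f)" if "i < n" for i
  proof (rule Ck_cong[OF U _ C[OF that]])
    show "D i y = pd i f y" if "y \<in> U" for y using pd_eqI[OF D[OF \<open>i < n\<close> that]] by simp
  qed
  then show ?thesis using assms(2) D by (auto simp: real_differentiable_def)
qed

section \<open>Closure properties of the classes \<open>Ck\<close>\<close>

lemma Ck_const [simp]: "Ck r n U (\<lambda>x. a)"
  by (induction r arbitrary: a) (auto simp: pd_def[abs_def])

lemma Ck_coord:
  assumes U: "openin (Euclidean_space n) U"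
  shows "Ck r n U (\<lambda>x. x k)"
proof (cases r)
  case 0 then show ?thesis using continuous_on_subset[OF continuous_on_product_coordinates, of U k] by simp
next
  case (Suc m)
  have "((\<lambda>s. (x(i := s)) k) has_real_derivative (if i = k then 1 else 0)) (at (x i))" for i and x :: "nat \<Rightarrow> real"
    by (cases "i = k") (auto intro!: derivative_eq_intros)
  then show ?thesis unfolding Suc
    by (intro Ck_SucI[OF U, where D = "\<lambda>i x. if i = k then 1 else 0"]) (use continuous_on_subset[OF continuous_on_product_coordinates, of U k] in auto)
qed

lemma Ck_add:
  assumes U: "openin (Euclidean_space n) U"
  shows "Ck r n U f \<Longrightarrow> Ck r n U h \<Longrightarrow> Ck r n U (\<lambda>x. f x + h x)"
proof (induction r arbitrary: f h)
  case 0 then show ?case by (auto intro: continuous_intros)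
next
  case (Suc r)
  show ?case
    by (rule Ck_SucI[OF U, where D = "\<lambda>i x. pd i f x + pd i h x"])
      (use Suc Ck_has_pd[OF Suc.prems(1)] Ck_has_pd[OF Suc.prems(2)] in \<open>auto intro: continuous_intros DERIV_add\<close>)
qed

lemma Ck_mult:
  assumes U: "openin (Euclidean_space n) U"
  shows "Ck r n U f \<Longrightarrow> Ck r n U h \<Longrightarrow> Ck r n U (\<lambda>x. f x * h x)"
proof (induction r arbitrary: f h)
  case 0 then show ?case by (auto intro: continuous_intros)
next
  case (Suc r)
  show ?case
  proof (rule Ck_SucI[OF U, where D = "\<lambda>i x. pd i f x * h x + pd i h x * f x"])
    fix i x assume ix: "i < n" "x \<in> U"
    show "((\<lambda>s. f (x(i := s)) * h (x(i := s))) has_real_derivative pd i f x * h x + pd i h x * f x) (at (x i))"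
      using DERIV_mult[OF Ck_has_pd[OF Suc.prems(1) ix(2,1)] Ck_has_pd[OF Suc.prems(2) ix(2,1)]] by (simp only: fun_upd_triv)
  next
    fix i assume "i < n"
    then show "Ck r n U (\<lambda>x. pd i f x * h x + pd i h x * f x)"
      using Suc.prems Suc.prems[THEN Ck_Suc_imp] by (intro Ck_add[OF U] Suc.IH) simp_all
  qed (use Suc.prems in \<open>auto intro: continuous_intros\<close>)
qed

lemma Ck_sum:
  assumes U: "openin (Euclidean_space n) U"
  shows "(\<And>k. k \<in> K \<Longrightarrow> Ck r n U (f k)) \<Longrightarrow> Ck r n U (\<lambda>x. \<Sum>k\<in>K. f k x)"
  by (induction K rule: infinite_finite_induct) (auto intro: Ck_add[OF U])

lemma Ck_inverse:
  assumes U: "openin (Euclidean_space n) U"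
  shows "Ck r n U f \<Longrightarrow> (\<And>x. x \<in> U \<Longrightarrow> f x \<noteq> 0) \<Longrightarrow> Ck r n U (\<lambda>x. inverse (f x))"
proof (induction r)
  case 0 then show ?case by (auto intro!: continuous_on_inverse)
next
  case (Suc r)
  show ?case
  \<comment> \<open>Written with \<open>inverse (f x)\<close> twice instead of a square in a
    denominator, so that the induction hypothesis and \<open>Ck_mult\<close> cover it.\<close>
  proof (rule Ck_SucI[OF U, where D = "\<lambda>i x. (-1) * (inverse (f x) * pd i f x * inverse (f x))"])
    fix i x assume ix: "i < n" "x \<in> U"
    show "((\<lambda>s. inverse (f (x(i := s)))) has_real_derivative (-1) * (inverse (f x) * pd i f x * inverse (f x))) (at (x i))"
      using DERIV_inverse'[OF Ck_has_pd[OF Suc.prems(1) ix(2,1)]] Suc.prems(2)[OF ix(2)]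
      by (simp only: fun_upd_triv mult_minus1 not_False_eq_True)
  next
    fix i assume "i < n"
    moreover have "Ck r n U (\<lambda>x. inverse (f x))" using Suc.IH[OF Ck_Suc_imp[OF Suc.prems(1)]] Suc.prems(2) by simp
    ultimately show "Ck r n U (\<lambda>x. (-1) * (inverse (f x) * pd i f x * inverse (f x)))"
      using Suc.prems by (intro Ck_mult[OF U]) auto
  qed (use Suc.prems in \<open>auto intro!: continuous_on_inverse\<close>)
qed

lemma Ck_exp:
  assumes U: "openin (Euclidean_space n) U"
  shows "Ck r n U f \<Longrightarrow> Ck r n U (\<lambda>x. exp (f x))"
proof (induction r)
  case 0 then show ?case by (auto intro!: continuous_on_exp)
next
  case (Suc r)
  show ?case
  proof (rule Ck_SucI[OF U, where D = "\<lambda>i x. exp (f x) * pd i f x"])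
    fix i x assume ix: "i < n" "x \<in> U"
    show "((\<lambda>s. exp (f (x(i := s)))) has_real_derivative exp (f x) * pd i f x) (at (x i))"
      using DERIV_fun_exp[OF Ck_has_pd[OF Suc.prems(1) ix(2,1)]] by (simp only: fun_upd_triv)
  next
    fix i assume "i < n"
    then show "Ck r n U (\<lambda>x. exp (f x) * pd i f x)"
      using Suc.IH[OF Ck_Suc_imp[OF Suc.prems(1)]] Suc.prems by (intro Ck_mult[OF U]) simp_all
  qed (use Suc.prems in \<open>auto intro!: continuous_on_exp\<close>)
qed

text \<open>No induction is involved: one differentiation leads from \<open>ln\<close> to
  \<open>inverse\<close>, whose closure is known.\<close>

lemma Ck_ln:
  assumes U: "openin (Euclidean_space n) U" and "Ck r n U f" "\<And>x. x \<in> U \<Longrightarrow> f x > 0"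
  shows "Ck r n U (\<lambda>x. ln (f x))"
proof (cases r)
  case 0 then show ?thesis using assms(2) assms(3) by (force intro!: continuous_on_ln)
next
  case (Suc m)
  note C = assms(2)[unfolded Suc]
  show ?thesis unfolding Suc
  proof (rule Ck_SucI[OF U, where D = "\<lambda>i x. inverse (f x) * pd i f x"])
    show "continuous_on U (\<lambda>x. ln (f x))" using C assms(3) by (force intro!: continuous_on_ln)
  next
    fix i x assume ix: "i < n" "x \<in> U"
    show "((\<lambda>s. ln (f (x(i := s)))) has_real_derivative inverse (f x) * pd i f x) (at (x i))"
      using DERIV_chain2[OF DERIV_ln Ck_has_pd[OF C ix(2,1)]] assms(3)[OF ix(2)] by (simp only: fun_upd_triv)
  next
    fix i assume "i < n"
    moreover have "Ck m n U (\<lambda>x. inverse (f x))"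
      using Ck_Suc_imp[OF C] assms(3) by (intro Ck_inverse[OF U]) force+
    ultimately show "Ck m n U (\<lambda>x. inverse (f x) * pd i f x)"
      using C by (intro Ck_mult[OF U]) auto
  qed
qed

section \<open>The chain rule from continuous partial derivatives\<close>

text \<open>The points a and b may come in either order or coincide, so that both sides of a
  difference quotient are treated at once.\<close>

lemma mvt_symmetric:
  fixes h :: "real \<Rightarrow> real"
  assumes "\<And>r. \<bar>r - a\<bar> \<le> \<bar>b - a\<bar> \<Longrightarrow> (h has_real_derivative h' r) (at r)"
  shows "\<exists>r. \<bar>r - a\<bar> \<le> \<bar>b - a\<bar> \<and> h b - h a = h' r * (b - a)"
proof -
  consider "a < b" | "b < a" | "a = b" by linarith
  then show ?thesis
  proof cases
    case 1
    then obtain z where "a < z" "z < b" "h b - h a = (b - a) * h' z"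
      using MVT2[of a b h h'] assms by auto
    then show ?thesis by (intro exI[of _ z]) auto
  next
    case 2
    then obtain z where "b < z" "z < a" "h a - h b = (a - b) * h' z"
      using MVT2[of b a h h'] assms by auto
    then show ?thesis by (intro exI[of _ z]) (auto simp: algebra_simps)
  qed auto
qed

text \<open>The coordinates of the curve are switched from time t to time s one after the other.
  Each switch moves along a coordinate line, where the mean value theorem applies, and continuity of
  the partial derivatives sends their values at the intermediate points to those at
  \<open>c t\<close>.\<close>

lemma DERIV_chain_partials:
  assumes V: "openin (Euclidean_space m) V"
    and D: "\<And>j x. j < m \<Longrightarrow> x \<in> V \<Longrightarrow> ((\<lambda>s. f (x(j := s))) has_real_derivative D j x) (at (x j))"
    and C: "\<And>j. j < m \<Longrightarrow> continuous_on V (D j)"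
    and ct: "c t \<in> V"
    and c0: "\<forall>\<^sub>F s in nhds t. c s \<in> topspace (Euclidean_space m)"
    and c': "\<And>j. j < m \<Longrightarrow> ((\<lambda>s. c s j) has_real_derivative c' j) (at t)"
  shows "((\<lambda>s. f (c s)) has_real_derivative (\<Sum>j<m. D j (c t) * c' j)) (at t)"
proof -
  \<comment> \<open>The first k coordinates have moved to time s, the others still wait at time t.
    So \<open>z 0 s\<close> is \<open>c t\<close>, and \<open>z m s\<close> is \<open>c s\<close>
    for s near t.\<close>
  define z where "z k s = (\<lambda>j. if j < k then c s j else c t j)" for k s
  have ctE: "c t \<in> topspace (Euclidean_space m)" using ct openin_subset[OF V] by auto
  obtain e where e: "e > 0" "\<And>y. y\<in>topspace (Euclidean_space m) \<Longrightarrow> (\<forall>i<m. \<bar>y i - c t i\<bar> < e) \<Longrightarrow> y \<in> V"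
    using V ct unfolding openin_Euclidean_space_box by meson
  have near: "\<forall>\<^sub>F s in at t. \<forall>j<m. \<bar>c s j - c t j\<bar> < d" if "d > 0" for d
  proof -
    have "\<forall>\<^sub>F s in at t. \<forall>j\<in>{..<m}. \<bar>c s j - c t j\<bar> < d"
    proof (intro eventually_ball_finite ballI)
      fix j assume "j \<in> {..<m}"
      then have "(\<lambda>s. c s j) \<midarrow>t\<rightarrow> c t j" using c'[of j] DERIV_isCont isCont_def by blast
      then show "\<forall>\<^sub>F s in at t. \<bar>c s j - c t j\<bar> < d" using that by (auto simp: tendsto_iff dist_real_def)
    qed auto
    then show ?thesis by eventually_elim auto
  qed
  have "((\<lambda>s. f (z k s)) has_real_derivative (\<Sum>j<k. D j (c t) * c' j)) (at t)" if "k \<le> m" for k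
    using that
  proof (induction k)
    case 0 then show ?case by (simp add: z_def)
  next
    case (Suc k)
    then have k: "k < m" by simp
    have "\<forall>\<^sub>F s in at t. \<exists>y\<in>V. (\<forall>j<m. \<bar>y j - c t j\<bar> \<le> \<bar>c s j - c t j\<bar>) \<and>
        f (z (Suc k) s) - f (z k s) = D k y * (c s k - c t k)"
      using near[OF e(1)]
    proof eventually_elim
      case (elim s)
      have zk: "(z k s) k = c t k" "(z k s)(k := c s k) = z (Suc k) s" "(z k s)(k := c t k) = z k s"
        by (auto simp: z_def fun_eq_iff less_Suc_eq)
      \<comment> \<open>In each coordinate the intermediate points are no farther from
        \<open>c t\<close> than \<open>c s\<close> is, hence they lie in the box of radius
        e.\<close>
      have inV: "(z k s)(k := r) \<in> V" if "\<bar>r - c t k\<bar> \<le> \<bar>c s k - c t k\<bar>" for r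
        using that elim k ctE e(1) by (intro e(2)) (auto simp: z_def topspace_Euclidean_space)
      have "((\<lambda>r. f ((z k s)(k := r))) has_real_derivative D k ((z k s)(k := r))) (at r)"
        if "\<bar>r - c t k\<bar> \<le> \<bar>c s k - c t k\<bar>" for r
        using D[OF k inV[OF that]] by simp
      then have "\<exists>r. \<bar>r - c t k\<bar> \<le> \<bar>c s k - c t k\<bar> \<and>
          f ((z k s)(k := c s k)) - f ((z k s)(k := c t k)) = D k ((z k s)(k := r)) * (c s k - c t k)"
        by (rule mvt_symmetric[where h = "\<lambda>r. f ((z k s)(k := r))" and h' = "\<lambda>r. D k ((z k s)(k := r))"])
      then obtain r where r: "\<bar>r - c t k\<bar> \<le> \<bar>c s k - c t k\<bar>"
        "f (z (Suc k) s) - f (z k s) = D k ((z k s)(k := r)) * (c s k - c t k)"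
        unfolding zk by blast
      show ?case
        by (rule bexI[OF _ inV[OF r(1)]]) (use r in \<open>auto simp: z_def\<close>)
    qed
    then obtain Y where Y: "\<forall>\<^sub>F s in at t. Y s \<in> V \<and> (\<forall>j<m. \<bar>Y s j - c t j\<bar> \<le> \<bar>c s j - c t j\<bar>) \<and>
        f (z (Suc k) s) - f (z k s) = D k (Y s) * (c s k - c t k)"
      unfolding Bex_def eventually_ex by blast
    have "((\<lambda>s. D k (Y s)) \<longlongrightarrow> D k (c t)) (at t)"
      unfolding tendsto_iff
    proof (intro allI impI)
      fix \<epsilon> :: real assume "\<epsilon> > 0"
      then have "\<exists>d>0. \<forall>y\<in>V. (\<forall>i<m. \<bar>y i - c t i\<bar> < d) \<longrightarrow> \<bar>D k y - D k (c t)\<bar> < \<epsilon>"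
        using C[OF k] ct unfolding continuous_on_Euclidean_box[OF V] by simp
      then obtain d where d: "d > 0" "\<And>y. y \<in> V \<Longrightarrow> (\<forall>i<m. \<bar>y i - c t i\<bar> < d) \<Longrightarrow> \<bar>D k y - D k (c t)\<bar> < \<epsilon>"
        by blast
      show "\<forall>\<^sub>F s in at t. dist (D k (Y s)) (D k (c t)) < \<epsilon>"
        using Y near[OF d(1)]
      proof eventually_elim
        case (elim s)
        then have "\<forall>i<m. \<bar>Y s i - c t i\<bar> < d" using le_less_trans by blast
        then show ?case using d(2)[of "Y s"] elim(1) by (simp add: dist_real_def)
      qed
    qed
    then have "((\<lambda>s. D k (Y s) * ((c s k - c t k) / (s - t))) \<longlongrightarrow> D k (c t) * c' k) (at t)"
      using c'[OF k] unfolding has_field_derivative_iff by (intro tendsto_mult)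
    moreover have "\<forall>\<^sub>F s in at t. (f (z (Suc k) s) - f (z k s)) / (s - t) = D k (Y s) * ((c s k - c t k) / (s - t))"
      using Y by eventually_elim auto
    ultimately have "((\<lambda>s. (f (z (Suc k) s) - f (z k s)) / (s - t)) \<longlongrightarrow> D k (c t) * c' k) (at t)"
      using tendsto_cong by fast
    moreover have "z j t = c t" for j by (auto simp: z_def)
    ultimately have "((\<lambda>s. f (z (Suc k) s) - f (z k s)) has_real_derivative D k (c t) * c' k) (at t)"
      unfolding has_field_derivative_iff by simp
    from DERIV_add[OF Suc.IH this] k show ?case by (simp add: add.commute)
  qed
  from this[of m] have "((\<lambda>s. f (z m s)) has_real_derivative (\<Sum>j<m. D j (c t) * c' j)) (at t)" by simp
  \<comment> \<open>Agreement beyond the index m needs \<open>c s\<close> to lie in the Euclidean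
    space, which is only assumed for s near t.\<close>
  moreover have "\<forall>\<^sub>F s in nhds t. f (z m s) = f (c s)"
    using c0
  proof eventually_elim
    case (elim s)
    then have "z m s = c s" using ctE by (auto simp: z_def topspace_Euclidean_space fun_eq_iff)
    then show ?case by simp
  qed
  ultimately show ?thesis using DERIV_cong_ev[OF refl _ refl] by fast
qed

text \<open>By the chain rule a partial derivative of the composite is a sum of products of
  \<open>pd k f\<close> composed with Y and partial derivatives of Y. The induction on r is for all
  f at once, because it is applied to \<open>pd k f\<close>.\<close>

lemma Ck_compose:
  assumes U: "openin (Euclidean_space n) U" and V: "openin (Euclidean_space m) V"
    and YV: "\<And>x. x \<in> U \<Longrightarrow> Y x \<in> V"
  shows "(\<And>k. k < m \<Longrightarrow> Ck r n U (\<lambda>x. Y x k)) \<Longrightarrow> Ck r m V f \<Longrightarrow> Ck r n U (\<lambda>x. f (Y x))"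
proof (induction r arbitrary: f)
  have cont: "continuous_on U (\<lambda>x. f (Y x))"
    if "\<And>k. k < m \<Longrightarrow> continuous_on U (\<lambda>x. Y x k)" "continuous_on V f" for f :: "(nat \<Rightarrow> real) \<Rightarrow> real"
  proof (rule continuous_on_compose2[OF that(2)])
    have "continuous_on U (\<lambda>x. Y x k)" for k
    proof (cases "k < m")
      case False
      then have "Y x k = 0" if "x \<in> U" for x
        using YV[OF that] openin_subset[OF V] by (auto simp: topspace_Euclidean_space)
      then show ?thesis using continuous_on_cong[of U U "\<lambda>x. Y x k" "\<lambda>x. 0"] by auto
    qed (rule that)
    then show "continuous_on U Y" by (intro continuous_on_coordinatewise_then_product)
  qed (use YV in auto)
  {
    case 0 then show ?case using cont by auto
  next
    case (Suc r)
    show ?case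
    proof (rule Ck_SucI[OF U, where D = "\<lambda>i x. \<Sum>k<m. pd k f (Y x) * pd i (\<lambda>x. Y x k) x"])
      show "continuous_on U (\<lambda>x. f (Y x))"
        by (rule cont) (rule Suc.prems[THEN Ck_imp_continuous], assumption?)+
    next
      fix i x assume ix: "i < n" "x \<in> U"
      have "((\<lambda>s. f (Y (x(i := s)))) has_real_derivative
          (\<Sum>k<m. pd k f (Y (x(i := x i))) * pd i (\<lambda>x. Y x k) x)) (at (x i))"
      proof (rule DERIV_chain_partials[OF V])
        show "\<And>j x. j < m \<Longrightarrow> x \<in> V \<Longrightarrow> ((\<lambda>s. f (x(j := s))) has_real_derivative pd j f x) (at (x j))"
          by (rule Ck_has_pd[OF Suc.prems(2)])
        show "\<And>j. j < m \<Longrightarrow> continuous_on V (pd j f)"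
          using Suc.prems(2) Ck_imp_continuous[of r m V] by simp
        show "\<forall>\<^sub>F s in nhds (x i). Y (x(i := s)) \<in> topspace (Euclidean_space m)"
          using eventually_line_in_open[OF U ix(2,1)] by eventually_elim (use YV openin_subset[OF V] in blast)
        show "\<And>j. j < m \<Longrightarrow> ((\<lambda>s. Y (x(i := s)) j) has_real_derivative pd i (\<lambda>x. Y x j) x) (at (x i))"
          by (rule Ck_has_pd[OF Suc.prems(1) ix(2,1)])
      qed (use YV ix in simp)
      then show "((\<lambda>s. f (Y (x(i := s)))) has_real_derivative (\<Sum>k<m. pd k f (Y x) * pd i (\<lambda>x. Y x k) x)) (at (x i))"
        by simp
    next
      fix i assume i: "i < n"
      show "Ck r n U (\<lambda>x. \<Sum>k<m. pd k f (Y x) * pd i (\<lambda>x. Y x k) x)"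
      proof (rule Ck_sum[OF U], rule Ck_mult[OF U])
        fix k assume k: "k \<in> {..<m}"
        show "Ck r n U (\<lambda>x. pd k f (Y x))"
          by (rule Suc.IH) (use Suc.prems(1)[THEN Ck_Suc_imp] Suc.prems(2) k in simp_all)
        show "Ck r n U (\<lambda>x. pd i (\<lambda>x. Y x k) x)"
          using Suc.prems(1)[of k] k i by simp
      qed
    qed
  }
qed

subsection \<open>Smoothness at a point\<close>

text \<open>Smoothness of the germ: it is required on a whole neighbourhood, so that
  \<open>pd i f\<close> is again smooth at x.\<close>

definition smooth_at :: "nat \<Rightarrow> (nat \<Rightarrow> real) \<Rightarrow> ((nat \<Rightarrow> real) \<Rightarrow> real) \<Rightarrow> bool" where
  "smooth_at n x f \<longleftrightarrow> (\<exists>Z. openin (Euclidean_space n) Z \<and> x \<in> Z \<and> smooth_fn n Z f)"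

lemma smooth_fn_subset: "smooth_fn n U f \<Longrightarrow> V \<subseteq> U \<Longrightarrow> smooth_fn n V f"
  unfolding smooth_fn_def using continuous_on_subset by blast

lemma smooth_fn_cong:
  "openin (Euclidean_space n) U \<Longrightarrow> (\<And>y. y \<in> U \<Longrightarrow> f y = h y) \<Longrightarrow> smooth_fn n U f \<Longrightarrow> smooth_fn n U h"
  unfolding smooth_fn_iff_Ck using Ck_cong[of n U f h] by simp

lemma smooth_fn_imp_at: "openin (Euclidean_space n) U \<Longrightarrow> smooth_fn n U f \<Longrightarrow> x \<in> U \<Longrightarrow> smooth_at n x f"
  unfolding smooth_at_def by blast

lemma continuous_on_locally_Euclidean:
  fixes f :: "(nat \<Rightarrow> real) \<Rightarrow> real"
  assumes U: "openin (Euclidean_space n) U"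
    and loc: "\<And>x. x \<in> U \<Longrightarrow> \<exists>Z. openin (Euclidean_space n) Z \<and> x \<in> Z \<and> continuous_on Z f"
  shows "continuous_on U f"
  unfolding continuous_on_Euclidean_box[OF U]
proof (intro ballI allI impI)
  fix x and \<epsilon> :: real assume x: "x \<in> U" "\<epsilon> > 0"
  obtain Z where Z: "openin (Euclidean_space n) Z" "x \<in> Z" "continuous_on Z f" using loc[OF x(1)] by blast
  obtain d where d: "d > 0" "\<forall>y\<in>Z. (\<forall>i<n. \<bar>y i - x i\<bar> < d) \<longrightarrow> \<bar>f y - f x\<bar> < \<epsilon>"
    using Z(3) Z(2) x(2) unfolding continuous_on_Euclidean_box[OF Z(1)] by blast
  obtain d' where d': "d' > 0" "\<forall>y\<in>topspace (Euclidean_space n). (\<forall>i<n. \<bar>y i - x i\<bar> < d') \<longrightarrow> y \<in> Z"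
    using Z(1) Z(2) unfolding openin_Euclidean_space_box by blast
  have "\<bar>f y - f x\<bar> < \<epsilon>" if "y \<in> U" "\<forall>i<n. \<bar>y i - x i\<bar> < min d d'" for y
  proof -
    have "y \<in> Z" using d'(2) that openin_subset[OF U] by auto
    then show ?thesis using d(2) that by auto
  qed
  then show "\<exists>d>0. \<forall>y\<in>U. (\<forall>i<n. \<bar>y i - x i\<bar> < d) \<longrightarrow> \<bar>f y - f x\<bar> < \<epsilon>"
    using d(1) d'(1) by (intro exI[of _ "min d d'"]) auto
qed

lemma smooth_fnI_at:
  assumes U: "openin (Euclidean_space n) U" and at: "\<And>x. x \<in> U \<Longrightarrow> smooth_at n x f"
  shows "smooth_fn n U f"
  unfolding smooth_fn_def
proof (intro allI impI conjI ballI)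
  fix "is" :: "nat list" assume s: "set is \<subseteq> {..<n}"
  show "continuous_on U (ipd is f)"
  proof (rule continuous_on_locally_Euclidean[OF U])
    fix x assume "x \<in> U"
    then show "\<exists>Z. openin (Euclidean_space n) Z \<and> x \<in> Z \<and> continuous_on Z (ipd is f)"
      using at[of x] s unfolding smooth_at_def smooth_fn_def by blast
  qed
  fix x i assume "x \<in> U" "i < n"
  then show "(\<lambda>s. ipd is f (x(i := s))) differentiable (at (x i))"
    using at[of x] s unfolding smooth_at_def smooth_fn_def by blast
qed

lemma smooth_at_cong:
  assumes "smooth_at n x f" "openin (Euclidean_space n) W" "x \<in> W" "\<And>y. y \<in> W \<Longrightarrow> f y = h y"
  shows "smooth_at n x h"
proof -
  obtain Z where Z: "openin (Euclidean_space n) Z" "x \<in> Z" "smooth_fn n Z f"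
    using assms(1) unfolding smooth_at_def by blast
  have op: "openin (Euclidean_space n) (Z \<inter> W)" using Z(1) assms(2) by (rule openin_Int)
  moreover have "smooth_fn n (Z \<inter> W) h"
    by (rule smooth_fn_cong[OF op _ smooth_fn_subset[OF Z(3)]]) (use assms(4) in auto)
  ultimately show ?thesis unfolding smooth_at_def using Z(2) assms(3) by blast
qed

lemma smooth_at_const [simp]: "x \<in> topspace (Euclidean_space n) \<Longrightarrow> smooth_at n x (\<lambda>x. a)"
  unfolding smooth_at_def smooth_fn_iff_Ck by (intro exI[of _ "topspace (Euclidean_space n)"]) simp

lemma smooth_at_coord: "x \<in> topspace (Euclidean_space n) \<Longrightarrow> smooth_at n x (\<lambda>x. x k)"
  unfolding smooth_at_def smooth_fn_iff_Ck
  by (intro exI[of _ "topspace (Euclidean_space n)"]) (simp add: Ck_coord)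

lemma smooth_at_common:
  assumes "smooth_at n x f" "smooth_at n x h"
  obtains Z where "openin (Euclidean_space n) Z" "x \<in> Z" "smooth_fn n Z f" "smooth_fn n Z h"
proof -
  obtain Z Z' where "openin (Euclidean_space n) Z" "x \<in> Z" "smooth_fn n Z f"
    "openin (Euclidean_space n) Z'" "x \<in> Z'" "smooth_fn n Z' h"
    using assms unfolding smooth_at_def by blast
  then show thesis
    by (intro that[of "Z \<inter> Z'"] openin_Int IntI smooth_fn_subset[of n Z f "Z \<inter> Z'"]
          smooth_fn_subset[of n Z' h "Z \<inter> Z'"]) auto
qed

lemma smooth_at_add: "smooth_at n x f \<Longrightarrow> smooth_at n x h \<Longrightarrow> smooth_at n x (\<lambda>x. f x + h x)"
  by (erule (1) smooth_at_common) (auto simp: smooth_at_def smooth_fn_iff_Ck intro!: exI Ck_add)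

lemma smooth_at_mult: "smooth_at n x f \<Longrightarrow> smooth_at n x h \<Longrightarrow> smooth_at n x (\<lambda>x. f x * h x)"
  by (erule (1) smooth_at_common) (auto simp: smooth_at_def smooth_fn_iff_Ck intro!: exI Ck_mult)

lemma smooth_at_exp: "smooth_at n x f \<Longrightarrow> smooth_at n x (\<lambda>x. exp (f x))"
  unfolding smooth_at_def smooth_fn_iff_Ck using Ck_exp by blast

lemma smooth_at_restrict:
  assumes "smooth_at n x f" "open B" "f x \<in> B"
  obtains Z where "openin (Euclidean_space n) Z" "x \<in> Z" "smooth_fn n Z f" "\<And>y. y \<in> Z \<Longrightarrow> f y \<in> B"
proof -
  obtain Z where Z: "openin (Euclidean_space n) Z" "x \<in> Z" "smooth_fn n Z f"
    using assms(1) unfolding smooth_at_def by blast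
  have "continuous_on Z f" using Z(3) unfolding smooth_fn_iff_Ck by (meson Ck.simps(1))
  then have "openin (Euclidean_space n) {y\<in>Z. f y \<in> B}"
    using Z(1) assms(2) by (intro openin_continuous_preimage[where V = UNIV]) auto
  then show thesis using Z assms(3) by (intro that[of "{y\<in>Z. f y \<in> B}"] smooth_fn_subset[OF Z(3)]) auto
qed

lemma smooth_at_ln: "smooth_at n x f \<Longrightarrow> f x > 0 \<Longrightarrow> smooth_at n x (\<lambda>x. ln (f x))"
  by (erule smooth_at_restrict[where B = "{0<..}"])
    (auto simp: smooth_at_def smooth_fn_iff_Ck intro!: exI Ck_ln)

lemma smooth_at_pd: "smooth_at n x f \<Longrightarrow> i < n \<Longrightarrow> smooth_at n x (pd i f)"
  unfolding smooth_at_def using smooth_fn_pd by blast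

lemma smooth_at_has_pd:
  assumes "smooth_at n x f" "i < n"
  shows "((\<lambda>s. f (x(i := s))) has_real_derivative pd i f x) (at (x i))"
  using assms unfolding smooth_at_def smooth_fn_iff_Ck by (blast intro: Ck_has_pd)

lemma smooth_at_DERIV_curve:
  assumes f: "smooth_at m (c t) f"
    and c0: "\<forall>\<^sub>F s in nhds t. c s \<in> topspace (Euclidean_space m)"
    and c': "\<And>j. j < m \<Longrightarrow> ((\<lambda>s. c s j) has_real_derivative c' j) (at t)"
  shows "((\<lambda>s. f (c s)) has_real_derivative (\<Sum>j<m. pd j f (c t) * c' j)) (at t)"
proof -
  obtain Z where Z: "openin (Euclidean_space m) Z" "c t \<in> Z" "smooth_fn m Z f"
    using f unfolding smooth_at_def by blast
  note Z3 = Z(3)[unfolded smooth_fn_iff_Ck, rule_format, of "Suc 0"]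
  show ?thesis
    by (rule DERIV_chain_partials[OF Z(1) Ck_has_pd[OF Z3] _ Z(2) c0 c']) (use Z3 in simp_all)
qed

text \<open>Used for the coordinates of a map: each is smooth on a neighbourhood of its own, and
  finitely many neighbourhoods are intersected.\<close>

lemma finite_common_open:
  assumes "openin T U" "x \<in> U" "\<And>k. k < (m::nat) \<Longrightarrow> \<exists>Z. openin T Z \<and> x \<in> Z \<and> P k Z"
    and mono: "\<And>k Z Z'. P k Z \<Longrightarrow> Z' \<subseteq> Z \<Longrightarrow> P k Z'"
  shows "\<exists>Z. openin T Z \<and> x \<in> Z \<and> Z \<subseteq> U \<and> (\<forall>k<m. P k Z)"
  using assms(3)
proof (induction m)
  case 0 then show ?case using assms(1,2) by auto
next
  case (Suc m)
  then obtain Z where Z: "openin T Z" "x \<in> Z" "Z \<subseteq> U" "\<forall>k<m. P k Z" by force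
  obtain Z' where Z': "openin T Z'" "x \<in> Z'" "P m Z'" using Suc.prems[of m] by auto
  have "P k (Z \<inter> Z')" if "k < Suc m" for k
  proof (cases "k = m")
    case True then show ?thesis using mono[OF Z'(3)] by simp
  next
    case False then show ?thesis using that Z(4) mono[of k Z] by simp
  qed
  then show ?case using Z Z' by (intro exI[of _ "Z \<inter> Z'"]) (auto intro: openin_Int)
qed

lemma continuous_on_into_Euclidean:
  assumes "\<And>x. x \<in> U \<Longrightarrow> Y x \<in> topspace (Euclidean_space m)" "\<And>k. k < m \<Longrightarrow> continuous_on U (\<lambda>x. Y x k)"
  shows "continuous_on U Y"
proof -
  have "continuous_on U (\<lambda>x. Y x k)" for k
  proof (cases "k < m")
    case False
    then have "Y x k = 0" if "x \<in> U" for x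
      using assms(1)[OF that] by (auto simp: topspace_Euclidean_space)
    then show ?thesis using continuous_on_cong[of U U "\<lambda>x. Y x k" "\<lambda>x. 0"] by simp
  qed (rule assms(2))
  then show "continuous_on U Y" by (intro continuous_on_coordinatewise_then_product)
qed

lemma openin_Euclidean_preimage:
  assumes "openin (Euclidean_space n) Z" "continuous_on Z Y" "openin (Euclidean_space m) V"
    "\<And>y. y \<in> Z \<Longrightarrow> Y y \<in> topspace (Euclidean_space m)"
  shows "openin (Euclidean_space n) {y\<in>Z. Y y \<in> V}"
proof (rule openin_continuous_preimage[OF assms(1,2), where V = "topspace (Euclidean_space m)"])
  show "openin (top_of_set (topspace (Euclidean_space m))) V"
    unfolding top_of_set_Euclidean_space[OF order_refl] subtopology_topspace by (rule assms(3))
qed (use assms(4) in auto)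

text \<open>Y has to take values in \<open>Euclidean_space m\<close> near x, since smoothness of the
  coordinates below m says nothing about the others.\<close>

lemma smooth_at_compose:
  assumes f: "smooth_at m (Y x) f" and U: "openin (Euclidean_space n) U" "x \<in> U"
    and Y: "\<And>y. y \<in> U \<Longrightarrow> Y y \<in> topspace (Euclidean_space m)"
    and Yk: "\<And>k. k < m \<Longrightarrow> smooth_at n x (\<lambda>x. Y x k)"
  shows "smooth_at n x (\<lambda>x. f (Y x))"
proof -
  obtain V where V: "openin (Euclidean_space m) V" "Y x \<in> V" "smooth_fn m V f"
    using f unfolding smooth_at_def by blast
  have "\<exists>Z. openin (Euclidean_space n) Z \<and> x \<in> Z \<and> Z \<subseteq> U \<and> (\<forall>k<m. smooth_fn n Z (\<lambda>x. Y x k))"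
  proof (rule finite_common_open[OF U, where P = "\<lambda>k Z. smooth_fn n Z (\<lambda>x. Y x k)"])
    show "\<exists>Z. openin (Euclidean_space n) Z \<and> x \<in> Z \<and> smooth_fn n Z (\<lambda>x. Y x k)" if "k < m" for k
      using Yk[OF that] unfolding smooth_at_def .
  qed (rule smooth_fn_subset)
  then obtain Z where Z: "openin (Euclidean_space n) Z" "x \<in> Z" "Z \<subseteq> U" "\<forall>k<m. smooth_fn n Z (\<lambda>x. Y x k)"
    by blast
  have "continuous_on Z Y"
  proof (rule continuous_on_into_Euclidean[where m = m])
    show "Y x \<in> topspace (Euclidean_space m)" if "x \<in> Z" for x using Y Z(3) that by blast
    show "continuous_on Z (\<lambda>x. Y x k)" if "k < m" for k
      using Z(4) that unfolding smooth_fn_iff_Ck by (meson Ck.simps(1))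
  qed
  then have op: "openin (Euclidean_space n) {y\<in>Z. Y y \<in> V}"
    using Y Z(3) V(1) by (intro openin_Euclidean_preimage[OF Z(1)]) auto
  have "smooth_fn n {y\<in>Z. Y y \<in> V} (\<lambda>x. f (Y x))"
    unfolding smooth_fn_iff_Ck
  proof
    fix r
    show "Ck r n {y\<in>Z. Y y \<in> V} (\<lambda>x. f (Y x))"
    proof (rule Ck_compose[OF op V(1), where Y = Y and f = f])
      show "Ck r n {y\<in>Z. Y y \<in> V} (\<lambda>x. Y x k)" if "k < m" for k
      proof -
        have "smooth_fn n {y\<in>Z. Y y \<in> V} (\<lambda>x. Y x k)"
          by (rule smooth_fn_subset[of n Z]) (use Z(4) that in auto)
        then show ?thesis unfolding smooth_fn_iff_Ck by blast
      qed
      show "Ck r m V f" using V(3) unfolding smooth_fn_iff_Ck by blast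
    qed simp
  qed
  then show ?thesis unfolding smooth_at_def using op Z(2) V(2) by blast
qed

lemma pd_compose:
  assumes f: "smooth_at m (Y x) f" and U: "openin (Euclidean_space n) U" "x \<in> U"
    and Y: "\<And>y. y \<in> U \<Longrightarrow> Y y \<in> topspace (Euclidean_space m)"
    and Yk: "\<And>k. k < m \<Longrightarrow> smooth_at n x (\<lambda>x. Y x k)" and i: "i < n"
  shows "pd i (\<lambda>x. f (Y x)) x = (\<Sum>k<m. pd k f (Y x) * pd i (\<lambda>x. Y x k) x)"
proof (rule pd_eqI)
  have "((\<lambda>s. f (Y (x(i := s)))) has_real_derivative
      (\<Sum>k<m. pd k f (Y (x(i := x i))) * pd i (\<lambda>x. Y x k) x)) (at (x i))"
  proof (rule smooth_at_DERIV_curve)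
    show "smooth_at m (Y (x(i := x i))) f" using f by (simp only: fun_upd_triv)
    show "\<forall>\<^sub>F s in nhds (x i). Y (x(i := s)) \<in> topspace (Euclidean_space m)"
      using eventually_line_in_open[OF U i] by eventually_elim (rule Y)
    show "((\<lambda>s. Y (x(i := s)) j) has_real_derivative pd i (\<lambda>x. Y x j) x) (at (x i))" if "j < m" for j
      by (rule smooth_at_has_pd[OF Yk[OF that] i])
  qed
  then show "((\<lambda>s. f (Y (x(i := s)))) has_real_derivative (\<Sum>k<m. pd k f (Y x) * pd i (\<lambda>x. Y x k) x)) (at (x i))"
    by (simp only: fun_upd_triv)
qed

subsection \<open>The implicit function theorem for a scalar equation\<close>

text \<open>The indices above i are shifted down to close the gap, so that points of
  \<open>Euclidean_space (Suc n)\<close> become points of \<open>Euclidean_space n\<close>;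
  \<open>ins\<close> reopens the gap.\<close>

definition del :: "nat \<Rightarrow> (nat \<Rightarrow> real) \<Rightarrow> nat \<Rightarrow> real" where
  "del i x = (\<lambda>j. if j < i then x j else x (Suc j))"

definition ins :: "nat \<Rightarrow> (nat \<Rightarrow> real) \<Rightarrow> real \<Rightarrow> nat \<Rightarrow> real" where
  "ins i y z = (\<lambda>j. if j < i then y j else if j = i then z else y (j - 1))"

lemma del_ins [simp]: "del i (ins i y z) = y"
  by (auto simp: del_def ins_def fun_eq_iff)

lemma ins_del [simp]: "ins i (del i x) (x i) = x"
  by (auto simp: del_def ins_def fun_eq_iff)

lemma ins_same [simp]: "ins i y z i = z"
  by (simp add: ins_def)

lemma ins_upd [simp]: "(ins i y z)(i := z') = ins i y z'"
  by (auto simp: ins_def fun_eq_iff)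

lemma ins_fun_upd: "ins i (y(j := s)) z = (ins i y z)((if j < i then j else Suc j) := s)"
  by (auto simp: ins_def fun_eq_iff)

lemma ins_topspace: "y \<in> topspace (Euclidean_space n) \<Longrightarrow> i \<le> n \<Longrightarrow> ins i y z \<in> topspace (Euclidean_space (Suc n))"
  by (auto simp: ins_def topspace_Euclidean_space)

text \<open>Both x and the neighbouring solution lie on the level c. Going from one to the other
  first along coordinate J and then along coordinate i, the two changes of F cancel. The mean value
  theorem on each leg turns this into a relation between the increments of y and of \<zeta>, and
  continuity of \<zeta> makes the intermediate points tend to x.\<close>

lemma implicit_has_pd:
  assumes U: "openin (Euclidean_space (Suc n)) U" and F: "smooth_fn (Suc n) U F" and i: "i \<le> n"
    and nz: "\<And>x. x \<in> U \<Longrightarrow> pd i F x \<noteq> 0"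
    and D: "openin (Euclidean_space n) D" and \<zeta>: "continuous_on D \<zeta>"
    and sol: "\<And>y. y \<in> D \<Longrightarrow> ins i y (\<zeta> y) \<in> U" "\<And>y. y \<in> D \<Longrightarrow> F (ins i y (\<zeta> y)) = c"
    and j: "j < n" and y: "y \<in> D"
  defines "J \<equiv> (if j < i then j else Suc j)" and "x \<equiv> ins i y (\<zeta> y)"
  shows "((\<lambda>s. \<zeta> (y(j := s))) has_real_derivative - (pd J F x * inverse (pd i F x))) (at (y j))"
proof -
  note F1 = F[unfolded smooth_fn_iff_Ck, rule_format, of "Suc 0"]
  have J: "J < Suc n" "J \<noteq> i" using j by (auto simp: J_def)
  have x: "x \<in> U" unfolding x_def by (rule sol(1)[OF y])
  then have xE: "x \<in> topspace (Euclidean_space (Suc n))" using openin_subset[OF U] by auto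
  have xJ: "x J = y j" "x i = \<zeta> y" by (auto simp: x_def J_def ins_def)
  obtain e where e: "e > 0" "\<forall>y\<in>topspace (Euclidean_space (Suc n)). (\<forall>i<Suc n. \<bar>y i - x i\<bar> < e) \<longrightarrow> y \<in> U"
    using U x unfolding openin_Euclidean_space_box by blast
  have \<zeta>near: "\<forall>\<^sub>F s in at (y j). \<bar>\<zeta> (y(j := s)) - \<zeta> y\<bar> < d" if "d > 0" for d
  proof -
    obtain d' where d': "d' > 0" "\<forall>z\<in>D. (\<forall>i<n. \<bar>z i - y i\<bar> < d') \<longrightarrow> \<bar>\<zeta> z - \<zeta> y\<bar> < d"
      using \<zeta> y \<open>d > 0\<close> unfolding continuous_on_Euclidean_box[OF D] by blast
    have "\<forall>\<^sub>F s in at (y j). dist s (y j) < d'" using d'(1) by (auto simp: eventually_at)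
    moreover have "\<forall>\<^sub>F s in at (y j). y(j := s) \<in> D"
      using eventually_line_in_open[OF D y j] by (simp add: eventually_nhds_conv_at)
    ultimately show ?thesis
      by eventually_elim (use d' in \<open>auto simp: dist_real_def\<close>)
  qed
  have inD: "\<forall>\<^sub>F s in at (y j). y(j := s) \<in> D"
    using eventually_line_in_open[OF D y j] by (simp add: eventually_nhds_conv_at)
  have near: "\<forall>\<^sub>F s in at (y j). \<bar>s - y j\<bar> < d" if "d > 0" for d
    using that by (auto simp: eventually_at dist_real_def intro!: exI[of _ d])
  have "\<forall>\<^sub>F s in at (y j). \<exists>u v. u \<in> U \<and> v \<in> U \<and>
      (\<forall>k<Suc n. \<bar>u k - x k\<bar> \<le> max \<bar>s - y j\<bar> \<bar>\<zeta> (y(j := s)) - \<zeta> y\<bar>) \<and>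
      (\<forall>k<Suc n. \<bar>v k - x k\<bar> \<le> max \<bar>s - y j\<bar> \<bar>\<zeta> (y(j := s)) - \<zeta> y\<bar>) \<and>
      pd i F u * (\<zeta> (y(j := s)) - \<zeta> y) = - (pd J F v * (s - y j))"
    using inD near[OF e(1)] \<zeta>near[OF e(1)]
  proof eventually_elim
    case (elim s)
    \<comment> \<open>The corner between the two legs: coordinate J has moved, coordinate i has
      not.\<close>
    define x' where "x' = x(J := s)"
    have x'i: "x' i = \<zeta> y" using J xJ by (simp add: x'_def)
    have xs: "ins i (y(j := s)) (\<zeta> (y(j := s))) = x'(i := \<zeta> (y(j := s)))"
      unfolding ins_fun_upd x'_def x_def J_def by (auto simp: fun_eq_iff ins_def)
    have inU: "z \<in> U" if "z \<in> topspace (Euclidean_space (Suc n))"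
      "\<forall>k<Suc n. \<bar>z k - x k\<bar> \<le> max \<bar>s - y j\<bar> \<bar>\<zeta> (y(j := s)) - \<zeta> y\<bar>" for z
    proof -
      have "max \<bar>s - y j\<bar> \<bar>\<zeta> (y(j := s)) - \<zeta> y\<bar> < e" using elim(2,3) by simp
      then show ?thesis using e(2) that le_less_trans by blast
    qed
    have u: "x'(i := r) \<in> topspace (Euclidean_space (Suc n))"
      "\<forall>k<Suc n. \<bar>(x'(i := r)) k - x k\<bar> \<le> max \<bar>s - y j\<bar> \<bar>\<zeta> (y(j := s)) - \<zeta> y\<bar>"
      if "\<bar>r - \<zeta> y\<bar> \<le> \<bar>\<zeta> (y(j := s)) - \<zeta> y\<bar>" for r
      using that xE J i xJ by (auto simp: x'_def topspace_Euclidean_space)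
    have v: "x(J := r) \<in> topspace (Euclidean_space (Suc n))"
      "\<forall>k<Suc n. \<bar>(x(J := r)) k - x k\<bar> \<le> max \<bar>s - y j\<bar> \<bar>\<zeta> (y(j := s)) - \<zeta> y\<bar>"
      if "\<bar>r - y j\<bar> \<le> \<bar>s - y j\<bar>" for r
      using that xE J i xJ by (auto simp: topspace_Euclidean_space)
    have "\<exists>r. \<bar>r - \<zeta> y\<bar> \<le> \<bar>\<zeta> (y(j := s)) - \<zeta> y\<bar> \<and>
        F (x'(i := \<zeta> (y(j := s)))) - F (x'(i := \<zeta> y)) = pd i F (x'(i := r)) * (\<zeta> (y(j := s)) - \<zeta> y)"
    proof (rule mvt_symmetric[where h = "\<lambda>r. F (x'(i := r))" and h' = "\<lambda>r. pd i F (x'(i := r))"])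
      fix r assume r: "\<bar>r - \<zeta> y\<bar> \<le> \<bar>\<zeta> (y(j := s)) - \<zeta> y\<bar>"
      show "((\<lambda>r. F (x'(i := r))) has_real_derivative pd i F (x'(i := r))) (at r)"
        using Ck_has_pd[OF F1 inU[OF u[OF r]], of i] i by (simp only: fun_upd_upd fun_upd_same less_Suc_eq_le)
    qed
    then obtain r where r: "\<bar>r - \<zeta> y\<bar> \<le> \<bar>\<zeta> (y(j := s)) - \<zeta> y\<bar>"
      "F (x'(i := \<zeta> (y(j := s)))) - F (x'(i := \<zeta> y)) = pd i F (x'(i := r)) * (\<zeta> (y(j := s)) - \<zeta> y)"
      by blast
    have "\<exists>r. \<bar>r - y j\<bar> \<le> \<bar>s - y j\<bar> \<and> F (x(J := s)) - F (x(J := y j)) = pd J F (x(J := r)) * (s - y j)"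
    proof (rule mvt_symmetric[where h = "\<lambda>r. F (x(J := r))" and h' = "\<lambda>r. pd J F (x(J := r))"])
      fix r assume r: "\<bar>r - y j\<bar> \<le> \<bar>s - y j\<bar>"
      show "((\<lambda>r. F (x(J := r))) has_real_derivative pd J F (x(J := r))) (at r)"
        using Ck_has_pd[OF F1 inU[OF v[OF r]] J(1)] by (simp only: fun_upd_upd fun_upd_same)
    qed
    then obtain q where q: "\<bar>q - y j\<bar> \<le> \<bar>s - y j\<bar>"
      "F (x(J := s)) - F (x(J := y j)) = pd J F (x(J := q)) * (s - y j)" by blast
    have "F (x'(i := \<zeta> (y(j := s)))) = c" using sol(2)[OF elim(1)] by (simp only: xs)
    moreover have "x'(i := \<zeta> y) = x(J := s)" using x'i unfolding x'_def by (metis fun_upd_triv)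
    moreover have "F (x(J := y j)) = c" using sol(2)[OF y] xJ unfolding x_def[symmetric] by (metis fun_upd_triv)
    ultimately have "pd i F (x'(i := r)) * (\<zeta> (y(j := s)) - \<zeta> y) = - (pd J F (x(J := q)) * (s - y j))"
      using r(2) q(2) by simp
    then show ?case using inU[OF u[OF r(1)]] inU[OF v[OF q(1)]] u(2)[OF r(1)] v(2)[OF q(1)] by blast
  qed
  then obtain u v where uv: "\<forall>\<^sub>F s in at (y j). u s \<in> U \<and> v s \<in> U \<and>
      (\<forall>k<Suc n. \<bar>u s k - x k\<bar> \<le> max \<bar>s - y j\<bar> \<bar>\<zeta> (y(j := s)) - \<zeta> y\<bar>) \<and>
      (\<forall>k<Suc n. \<bar>v s k - x k\<bar> \<le> max \<bar>s - y j\<bar> \<bar>\<zeta> (y(j := s)) - \<zeta> y\<bar>) \<and>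
      pd i F (u s) * (\<zeta> (y(j := s)) - \<zeta> y) = - (pd J F (v s) * (s - y j))"
    unfolding eventually_ex by blast
  have lim: "((\<lambda>s. pd k F (w s)) \<longlongrightarrow> pd k F x) (at (y j))"
    if k: "k < Suc n" and w: "\<forall>\<^sub>F s in at (y j). w s \<in> U \<and>
      (\<forall>k<Suc n. \<bar>w s k - x k\<bar> \<le> max \<bar>s - y j\<bar> \<bar>\<zeta> (y(j := s)) - \<zeta> y\<bar>)" for k w
    unfolding tendsto_iff
  proof (intro allI impI)
    fix \<epsilon> :: real assume "\<epsilon> > 0"
    moreover have "continuous_on U (pd k F)" using F1 k by simp
    ultimately obtain d where d: "d > 0" "\<forall>z\<in>U. (\<forall>i<Suc n. \<bar>z i - x i\<bar> < d) \<longrightarrow> \<bar>pd k F z - pd k F x\<bar> < \<epsilon>"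
      using x unfolding continuous_on_Euclidean_box[OF U] by blast
    show "\<forall>\<^sub>F s in at (y j). dist (pd k F (w s)) (pd k F x) < \<epsilon>"
      using w near[OF d(1)] \<zeta>near[OF d(1)]
    proof eventually_elim
      case (elim s)
      then have "max \<bar>s - y j\<bar> \<bar>\<zeta> (y(j := s)) - \<zeta> y\<bar> < d" by simp
      then have "\<forall>i<Suc n. \<bar>w s i - x i\<bar> < d" using elim(1) le_less_trans by blast
      then show ?case using d(2) elim(1) by (simp add: dist_real_def)
    qed
  qed
  have neq: "\<forall>\<^sub>F s in at (y j). s \<noteq> y j" by (simp add: eventually_at_filter)
  have "((\<lambda>s. - (pd J F (v s) * inverse (pd i F (u s)))) \<longlongrightarrow> - (pd J F x * inverse (pd i F x))) (at (y j))"
  proof (intro tendsto_minus tendsto_mult tendsto_inverse lim)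
    show "pd i F x \<noteq> 0" by (rule nz[OF x])
    show "J < Suc n" "i < Suc n" using J i by auto
    show "\<forall>\<^sub>F s in at (y j). v s \<in> U \<and> (\<forall>k<Suc n. \<bar>v s k - x k\<bar> \<le> max \<bar>s - y j\<bar> \<bar>\<zeta> (y(j := s)) - \<zeta> y\<bar>)"
      using uv by eventually_elim simp
    show "\<forall>\<^sub>F s in at (y j). u s \<in> U \<and> (\<forall>k<Suc n. \<bar>u s k - x k\<bar> \<le> max \<bar>s - y j\<bar> \<bar>\<zeta> (y(j := s)) - \<zeta> y\<bar>)"
      using uv by eventually_elim simp
  qed
  moreover have "\<forall>\<^sub>F s in at (y j). - (pd J F (v s) * inverse (pd i F (u s))) = (\<zeta> (y(j := s)) - \<zeta> y) / (s - y j)"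
    using uv neq
  proof eventually_elim
    case (elim s)
    have "pd i F (u s) \<noteq> 0" using nz elim by blast
    then show ?case using elim by (simp add: field_simps)
  qed
  ultimately have "((\<lambda>s. (\<zeta> (y(j := s)) - \<zeta> y) / (s - y j)) \<longlongrightarrow> - (pd J F x * inverse (pd i F x))) (at (y j))"
    by (rule Lim_transform_eventually)
  then show ?thesis unfolding has_field_derivative_iff by simp
qed

text \<open>Bootstrapping: the partial derivatives of \<zeta> are formed from those of F along the
  graph of \<zeta>, so they are as regular as \<zeta> itself, and each round gains one
  order.\<close>

lemma implicit_smooth:
  assumes U: "openin (Euclidean_space (Suc n)) U" and F: "smooth_fn (Suc n) U F" and i: "i \<le> n"
    and nz: "\<And>x. x \<in> U \<Longrightarrow> pd i F x \<noteq> 0"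
    and D: "openin (Euclidean_space n) D" and \<zeta>: "continuous_on D \<zeta>"
    and sol: "\<And>y. y \<in> D \<Longrightarrow> ins i y (\<zeta> y) \<in> U" "\<And>y. y \<in> D \<Longrightarrow> F (ins i y (\<zeta> y)) = c"
  shows "smooth_fn n D \<zeta>"
  unfolding smooth_fn_iff_Ck
proof
  fix r show "Ck r n D \<zeta>"
  proof (induction r)
    case 0 then show ?case using \<zeta> by simp
  next
    case (Suc r)
    show ?case
    proof (rule Ck_SucI[OF D \<zeta>])
      fix j assume j: "j < n"
      define J where "J = (if j < i then j else Suc j)"
      have J: "J < Suc n" using j by (auto simp: J_def)
      show "((\<lambda>s. \<zeta> (y(j := s))) has_real_derivative (-1) * (pd (if j < i then j else Suc j) F (ins i y (\<zeta> y)) *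
          inverse (pd i F (ins i y (\<zeta> y))))) (at (y j))" if "y \<in> D" for y
        using implicit_has_pd[OF U F i nz D \<zeta> sol j that] by (simp only: mult_minus1)
      have comp: "Ck r n D (\<lambda>y. pd k F (ins i y (\<zeta> y)))" if k: "k < Suc n" for k
      proof (rule Ck_compose[OF D U, where Y = "\<lambda>y. ins i y (\<zeta> y)" and f = "pd k F"])
        show "Ck r n D (\<lambda>y. ins i y (\<zeta> y) l)" if "l < Suc n" for l
        proof -
          consider "l < i" | "l = i" | "l > i" by linarith
          then show ?thesis by cases (use Suc Ck_coord[OF D] in \<open>simp_all add: ins_def\<close>)
        qed
        show "Ck r (Suc n) U (pd k F)"
          using smooth_fn_pd[OF F k] unfolding smooth_fn_iff_Ck by blast
      qed (rule sol(1))
      show "Ck r n D (\<lambda>y. (-1) * (pd (if j < i then j else Suc j) F (ins i y (\<zeta> y)) *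
          inverse (pd i F (ins i y (\<zeta> y)))))"
        unfolding J_def[symmetric]
        by (rule Ck_mult[OF D Ck_const Ck_mult[OF D comp[OF J] Ck_inverse[OF D comp]]])
          (use i nz sol(1) in auto)
    qed
  qed
qed

text \<open>F is strictly increasing along the i-th coordinate near x0, so the intermediate value
  theorem yields a unique solution, which depends continuously on the other coordinates.\<close>

lemma implicit_function_pos:
  assumes U: "openin (Euclidean_space (Suc n)) U" and F: "smooth_fn (Suc n) U F" and i: "i \<le> n"
    and x0: "x0 \<in> U" "F x0 = c" "pd i F x0 > 0"
  shows "\<exists>W \<zeta>. openin (Euclidean_space (Suc n)) W \<and> x0 \<in> W \<and> W \<subseteq> U \<and>
    openin (Euclidean_space n) (del i ` W) \<and> smooth_fn n (del i ` W) \<zeta> \<and>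
    (\<forall>y\<in>del i ` W. ins i y (\<zeta> y) \<in> W \<and> F (ins i y (\<zeta> y)) = c) \<and>
    (\<forall>x\<in>W. F x = c \<longrightarrow> x i = \<zeta> (del i x))"
proof -
  let ?E = "topspace (Euclidean_space (Suc n))"
  note F1 = F[unfolded smooth_fn_iff_Ck, rule_format, of "Suc 0"]
  have contF: "continuous_on U F" and contD: "continuous_on U (pd i F)" using F1 i by auto
  define U' where "U' = {x\<in>U. pd i F x \<in> {0<..}}"
  have U': "openin (Euclidean_space (Suc n)) U'" unfolding U'_def
    by (rule openin_continuous_preimage[OF U contD, where V = UNIV]) auto
  have lt: "openin (Euclidean_space (Suc n)) {x\<in>U. F x \<in> {..<c}}"
    and gt: "openin (Euclidean_space (Suc n)) {x\<in>U. F x \<in> {c<..}}"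
    by (rule openin_continuous_preimage[OF U contF, where V = UNIV]; auto)+
  have "x0 \<in> U'" using x0 by (simp add: U'_def)
  then obtain e' where e': "e' > 0" "\<forall>y\<in>?E. (\<forall>i<Suc n. \<bar>y i - x0 i\<bar> < e') \<longrightarrow> y \<in> U'"
    using U' unfolding openin_Euclidean_space_box by blast
  \<comment> \<open>Half the radius, so that the closed box of radius e, faces included, stays
    inside U'.\<close>
  define e where "e = e' / 2"
  have eU: "y \<in> U'" if "y \<in> ?E" "\<forall>i<Suc n. \<bar>y i - x0 i\<bar> \<le> e" for y
  proof -
    have "e < e'" using e'(1) by (simp add: e_def)
    then show ?thesis using e'(2) that le_less_trans by blast
  qed
  have e0: "e > 0" using e'(1) by (simp add: e_def)
  have x0E: "x0 \<in> ?E" using x0(1) openin_subset[OF U] by auto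
  have mono: "F (x(i := a)) < F (x(i := b))"
    if x: "x \<in> ?E" "\<forall>j<Suc n. j \<noteq> i \<longrightarrow> \<bar>x j - x0 j\<bar> \<le> e" and ab: "a < b" "\<bar>a - x0 i\<bar> \<le> e" "\<bar>b - x0 i\<bar> \<le> e" for x a b
  proof (rule DERIV_pos_imp_increasing[OF ab(1)])
    fix r assume r: "a \<le> r" "r \<le> b"
    have "x(i := r) \<in> U'" using x r ab i by (intro eU) (auto simp: topspace_Euclidean_space)
    then have "((\<lambda>r. F (x(i := r))) has_real_derivative pd i F (x(i := r))) (at r)" "pd i F (x(i := r)) > 0"
      using Ck_has_pd[OF F1, of "x(i := r)" i] i by (auto simp: U'_def)
    then show "\<exists>y. ((\<lambda>r. F (x(i := r))) has_real_derivative y) (at r) \<and> y > 0" by blast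
  qed
  have side: "x0(i := x0 i - e) \<in> {x\<in>U. F x \<in> {..<c}}" "x0(i := x0 i + e) \<in> {x\<in>U. F x \<in> {c<..}}"
  proof -
    have "x0(i := r) \<in> U" if "\<bar>r - x0 i\<bar> \<le> e" for r
      using eU[of "x0(i := r)"] that x0E i e0 by (auto simp: topspace_Euclidean_space U'_def)
    moreover have "F (x0(i := x0 i - e)) < F (x0(i := x0 i))" "F (x0(i := x0 i)) < F (x0(i := x0 i + e))"
      using e0 by (intro mono[OF x0E]; simp)+
    ultimately show "x0(i := x0 i - e) \<in> {x\<in>U. F x \<in> {..<c}}" "x0(i := x0 i + e) \<in> {x\<in>U. F x \<in> {c<..}}"
      using x0(2) e0 by simp_all
  qed
  obtain d1 where d1: "d1 > 0" "\<forall>y\<in>?E. (\<forall>j<Suc n. \<bar>y j - (x0(i := x0 i - e)) j\<bar> < d1) \<longrightarrow> y \<in> {x\<in>U. F x \<in> {..<c}}"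
    using lt side(1) unfolding openin_Euclidean_space_box by blast
  obtain d2 where d2: "d2 > 0" "\<forall>y\<in>?E. (\<forall>j<Suc n. \<bar>y j - (x0(i := x0 i + e)) j\<bar> < d2) \<longrightarrow> y \<in> {x\<in>U. F x \<in> {c<..}}"
    using gt side(2) unfolding openin_Euclidean_space_box by blast
  \<comment> \<open>Over a base of radius d the whole bottom face of the box has F < c and the whole
    top face has F > c.\<close>
  define d where "d = min e (min d1 d2)"
  have d: "d > 0" "d \<le> e" "d \<le> d1" "d \<le> d2" using d1 d2 e0 by (auto simp: d_def)
  define W where "W = {x\<in>?E. (\<forall>j<Suc n. j \<noteq> i \<longrightarrow> \<bar>x j - x0 j\<bar> < d) \<and> \<bar>x i - x0 i\<bar> < e}"
  define D where "D = {y\<in>topspace (Euclidean_space n). \<forall>j<n. \<bar>y j - del i x0 j\<bar> < d}"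
  have insW: "ins i y z \<in> W" if "y \<in> D" "\<bar>z - x0 i\<bar> < e" for y z
    unfolding W_def
  proof (intro CollectI conjI allI impI)
    show "ins i y z \<in> ?E" using that i by (intro ins_topspace) (auto simp: D_def)
    show "\<bar>ins i y z j - x0 j\<bar> < d" if j: "j < Suc n" "j \<noteq> i" for j
    proof (cases "j < i")
      case True
      then have "\<bar>y j - del i x0 j\<bar> < d" using \<open>y \<in> D\<close> i by (simp add: D_def)
      then show ?thesis using True by (simp add: ins_def del_def)
    next
      case False
      then have "\<bar>y (j - 1) - del i x0 (j - 1)\<bar> < d" using \<open>y \<in> D\<close> j by (auto simp: D_def)
      moreover have "\<not> j - 1 < i" "Suc (j - 1) = j" using False j by auto
      ultimately show ?thesis using False j by (simp add: ins_def del_def)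
    qed
    show "\<bar>ins i y z i - x0 i\<bar> < e" using that by simp
  qed
  have delW: "del i x \<in> D" if "x \<in> W" for x
    using that i by (auto simp: W_def D_def del_def topspace_Euclidean_space)
  have DW: "del i ` W = D"
  proof
    show "D \<subseteq> del i ` W"
    proof
      fix y assume "y \<in> D"
      then show "y \<in> del i ` W" using insW[of y "x0 i"] e0 by (intro image_eqI[of _ _ "ins i y (x0 i)"]) auto
    qed
  qed (use delW in auto)
  have Wopen: "openin (Euclidean_space (Suc n)) W"
    unfolding openin_Euclidean_space_box
  proof (intro conjI ballI)
    fix x assume x: "x \<in> W"
    \<comment> \<open>The distances from x to the faces of the box W; their minimum is an admissible
      radius around x.\<close>
    define K where "K = insert (e - \<bar>x i - x0 i\<bar>) ((\<lambda>j. d - \<bar>x j - x0 j\<bar>) ` ({..<Suc n} - {i}))"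
    have K: "finite K" "K \<noteq> {}" "\<forall>k\<in>K. k > 0" using x by (auto simp: K_def W_def)
    show "\<exists>r>0. \<forall>y\<in>?E. (\<forall>j<Suc n. \<bar>y j - x j\<bar> < r) \<longrightarrow> y \<in> W"
    proof (intro exI[of _ "Min K"] conjI ballI impI)
      show "Min K > 0" using K by simp
      fix y assume y: "y \<in> ?E" "\<forall>j<Suc n. \<bar>y j - x j\<bar> < Min K"
      have Mi: "Min K \<le> e - \<bar>x i - x0 i\<bar>" using K by (intro Min_le) (auto simp: K_def)
      have Mj: "Min K \<le> d - \<bar>x j - x0 j\<bar>" if "j < Suc n" "j \<noteq> i" for j
        using K that by (intro Min_le) (auto simp: K_def)
      have "\<bar>y j - x0 j\<bar> < d" if j: "j < Suc n" "j \<noteq> i" for j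
      proof -
        have "\<bar>y j - x j\<bar> < Min K" using y(2) j by blast
        then show ?thesis using Mj[OF j] by linarith
      qed
      moreover have "\<bar>y i - x0 i\<bar> < e"
      proof -
        have "\<bar>y i - x i\<bar> < Min K" using y(2) i by simp
        then show ?thesis using Mi by linarith
      qed
      ultimately show "y \<in> W" using y(1) by (simp add: W_def)
    qed
  qed (auto simp: W_def)
  have Dopen: "openin (Euclidean_space n) D"
    unfolding openin_Euclidean_space_box
  proof (intro conjI ballI)
    fix x assume x: "x \<in> D"
    define K where "K = insert d ((\<lambda>j. d - \<bar>x j - del i x0 j\<bar>) ` {..<n})"
    have K: "finite K" "K \<noteq> {}" "\<forall>k\<in>K. k > 0" using x d(1) by (auto simp: K_def D_def)
    show "\<exists>r>0. \<forall>y\<in>topspace (Euclidean_space n). (\<forall>j<n. \<bar>y j - x j\<bar> < r) \<longrightarrow> y \<in> D"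
    proof (intro exI[of _ "Min K"] conjI ballI impI)
      show "Min K > 0" using K by simp
      fix y assume y: "y \<in> topspace (Euclidean_space n)" "\<forall>j<n. \<bar>y j - x j\<bar> < Min K"
      have "\<bar>y j - del i x0 j\<bar> < d" if j: "j < n" for j
      proof -
        have "Min K \<le> d - \<bar>x j - del i x0 j\<bar>" using K j by (intro Min_le) (auto simp: K_def)
        moreover have "\<bar>y j - x j\<bar> < Min K" using y(2) j by blast
        ultimately show ?thesis by linarith
      qed
      then show "y \<in> D" using y(1) by (simp add: D_def)
    qed
  qed (auto simp: D_def)
  have WU': "W \<subseteq> U'"
  proof
    fix x assume x: "x \<in> W"
    have "\<bar>x j - x0 j\<bar> \<le> e" if "j < Suc n" for j
      using x that d(2) by (cases "j = i") (auto simp: W_def)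
    then show "x \<in> U'" using x by (intro eU) (auto simp: W_def)
  qed
  have bounds: "F (ins i y (x0 i - e)) < c" "F (ins i y (x0 i + e)) > c" "ins i y (x0 i) \<in> ?E"
    "\<forall>j<Suc n. j \<noteq> i \<longrightarrow> \<bar>ins i y (x0 i) j - x0 j\<bar> \<le> e" if "y \<in> D" for y
  proof -
    have y: "ins i y (x0 i) \<in> W" using insW[OF that, of "x0 i"] e0 by simp
    show E: "ins i y (x0 i) \<in> ?E" using y by (simp add: W_def)
    then have E': "ins i y z \<in> ?E" for z using that i by (intro ins_topspace) (auto simp: D_def)
    have "\<bar>ins i y z j - x0 j\<bar> < d" if "j < Suc n" "j \<noteq> i" for j z
    proof -
      have "ins i y z j = ins i y (x0 i) j" using that by (simp add: ins_def)
      then show ?thesis using y that by (simp add: W_def)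
    qed
    note close = this
    show "\<forall>j<Suc n. j \<noteq> i \<longrightarrow> \<bar>ins i y (x0 i) j - x0 j\<bar> \<le> e" using close d(2) by (meson less_imp_le order_trans)
    have "\<bar>ins i y (x0 i - e) j - (x0(i := x0 i - e)) j\<bar> < d1" if "j < Suc n" for j
      using close[of j "x0 i - e"] that d d1(1) by (cases "j = i") auto
    then show "F (ins i y (x0 i - e)) < c" using d1(2) E' by blast
    have "\<bar>ins i y (x0 i + e) j - (x0(i := x0 i + e)) j\<bar> < d2" if "j < Suc n" for j
      using close[of j "x0 i + e"] that d d2(1) by (cases "j = i") auto
    then show "F (ins i y (x0 i + e)) > c" using d2(2) E' by blast
  qed
  have mono': "F (ins i y a) < F (ins i y b)" if "y \<in> D" "a < b" "\<bar>a - x0 i\<bar> \<le> e" "\<bar>b - x0 i\<bar> \<le> e" for y a b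
    using mono[OF bounds(3,4)[OF that(1)] that(2-4)] by simp
  have "\<exists>z. \<bar>z - x0 i\<bar> < e \<and> F (ins i y z) = c" if y: "y \<in> D" for y
  proof -
    have "continuous_on {x0 i - e..x0 i + e} (\<lambda>z. F (ins i y z))"
    proof (rule continuous_at_imp_continuous_on, rule ballI)
      fix z assume z: "z \<in> {x0 i - e..x0 i + e}"
      have "ins i y z \<in> U'"
      proof (rule eU)
        show "ins i y z \<in> ?E" using y i by (intro ins_topspace) (auto simp: D_def)
        show "\<forall>j<Suc n. \<bar>ins i y z j - x0 j\<bar> \<le> e"
        proof (intro allI impI)
          fix j assume j: "j < Suc n"
          show "\<bar>ins i y z j - x0 j\<bar> \<le> e"
          proof (cases "j = i")
            case True then show ?thesis using z by auto
          next
            case False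
            then have "ins i y z j = ins i y (x0 i) j" by (simp add: ins_def)
            then show ?thesis using bounds(4)[OF y] j False by simp
          qed
        qed
      qed
      then have "ins i y z \<in> U" by (simp add: U'_def)
      from Ck_has_pd[OF F1 this, of i] i show "isCont (\<lambda>z. F (ins i y z)) z"
        by (auto dest: DERIV_isCont)
    qed
    then obtain z where z: "x0 i - e \<le> z" "z \<le> x0 i + e" "F (ins i y z) = c"
      using IVT'[of "\<lambda>z. F (ins i y z)" "x0 i - e" c "x0 i + e"] bounds(1,2)[OF y] e0 by auto
    moreover have "z \<noteq> x0 i - e" "z \<noteq> x0 i + e" using z(3) bounds(1,2)[OF y] by auto
    ultimately show ?thesis by (intro exI[of _ z]) auto
  qed
  then obtain \<zeta> where \<zeta>: "\<And>y. y \<in> D \<Longrightarrow> \<bar>\<zeta> y - x0 i\<bar> < e" "\<And>y. y \<in> D \<Longrightarrow> F (ins i y (\<zeta> y)) = c" by metis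
  have uniq: "z = \<zeta> y" if "y \<in> D" "\<bar>z - x0 i\<bar> < e" "F (ins i y z) = c" for y z
    using mono'[OF that(1), of z "\<zeta> y"] mono'[OF that(1), of "\<zeta> y" z] \<zeta>[OF that(1)] that(2,3)
    by (cases z "\<zeta> y" rule: linorder_cases) auto
  have cont: "continuous_on D \<zeta>"
    unfolding continuous_on_Euclidean_box[OF Dopen]
  proof (intro ballI allI impI)
    fix y and \<epsilon> :: real assume y: "y \<in> D" and \<epsilon>: "\<epsilon> > 0"
    \<comment> \<open>Below \<epsilon>, and small enough that the heights
      \<open>\<zeta> y - r\<close> and \<open>\<zeta> y + r\<close> stay in the interval on which F
      is increasing. The signs of F - c at these two heights persist for nearby z and trap
      \<open>\<zeta> z\<close> between them.\<close>
    define r where "r = min (\<epsilon>/2) ((e - \<bar>\<zeta> y - x0 i\<bar>) / 2)"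
    have r01: "r > 0" "r < \<epsilon>" "r < e - \<bar>\<zeta> y - x0 i\<bar>"
      using \<zeta>(1)[OF y] \<epsilon> by (auto simp: r_def min_def)
    have r: "r > 0" "r < \<epsilon>" "\<bar>\<zeta> y - r - x0 i\<bar> < e" "\<bar>\<zeta> y + r - x0 i\<bar> < e"
      using r01 by linarith+
    have inU: "ins i y (\<zeta> y - r) \<in> U" "ins i y (\<zeta> y + r) \<in> U"
      using insW[OF y r(3)] insW[OF y r(4)] WU' by (auto simp: U'_def)
    have "F (ins i y (\<zeta> y - r)) < c" "c < F (ins i y (\<zeta> y + r))"
      using mono'[OF y, of "\<zeta> y - r" "\<zeta> y"] mono'[OF y, of "\<zeta> y" "\<zeta> y + r"] r \<zeta>[OF y] by simp_all
    with inU have ab: "ins i y (\<zeta> y - r) \<in> {x\<in>U. F x \<in> {..<c}}" "ins i y (\<zeta> y + r) \<in> {x\<in>U. F x \<in> {c<..}}"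
      by simp_all
    obtain a where a: "a > 0" "\<forall>x\<in>?E. (\<forall>j<Suc n. \<bar>x j - ins i y (\<zeta> y - r) j\<bar> < a) \<longrightarrow> x \<in> {x\<in>U. F x \<in> {..<c}}"
      using lt ab(1) unfolding openin_Euclidean_space_box by blast
    obtain b where b: "b > 0" "\<forall>x\<in>?E. (\<forall>j<Suc n. \<bar>x j - ins i y (\<zeta> y + r) j\<bar> < b) \<longrightarrow> x \<in> {x\<in>U. F x \<in> {c<..}}"
      using gt ab(2) unfolding openin_Euclidean_space_box by blast
    show "\<exists>d>0. \<forall>z\<in>D. (\<forall>i<n. \<bar>z i - y i\<bar> < d) \<longrightarrow> \<bar>\<zeta> z - \<zeta> y\<bar> < \<epsilon>"
    proof (intro exI[of _ "min a b"] conjI ballI impI)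
      fix z assume z: "z \<in> D" "\<forall>i<n. \<bar>z i - y i\<bar> < min a b"
      have cl: "\<bar>ins i z w j - ins i y w j\<bar> < min a b" if j: "j < Suc n" for j w
      proof -
        consider "j < i" | "j = i" | "j > i" by linarith
        then show ?thesis
        proof cases
          case 1 then show ?thesis using z(2) i by (auto simp: ins_def)
        next
          case 2 then show ?thesis using a(1) b(1) by simp
        next
          case 3
          then have "\<bar>z (j - 1) - y (j - 1)\<bar> < min a b" using z(2) j by simp
          then show ?thesis using 3 by (simp add: ins_def)
        qed
      qed
      have E': "ins i z w \<in> ?E" for w using z(1) i by (intro ins_topspace) (auto simp: D_def)
      have "\<forall>j<Suc n. \<bar>ins i z (\<zeta> y - r) j - ins i y (\<zeta> y - r) j\<bar> < a"
        "\<forall>j<Suc n. \<bar>ins i z (\<zeta> y + r) j - ins i y (\<zeta> y + r) j\<bar> < b" using cl by simp_all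
      then have "ins i z (\<zeta> y - r) \<in> {x\<in>U. F x \<in> {..<c}}" "ins i z (\<zeta> y + r) \<in> {x\<in>U. F x \<in> {c<..}}"
        using a(2) b(2) E' by blast+
      then have F: "F (ins i z (\<zeta> y - r)) < c" "c < F (ins i z (\<zeta> y + r))" by auto
      have "\<zeta> y - r < \<zeta> z"
        using mono'[OF z(1), of "\<zeta> z" "\<zeta> y - r"] F(1) \<zeta>[OF z(1)] r by (cases "\<zeta> z" "\<zeta> y - r" rule: linorder_cases) auto
      moreover have "\<zeta> z < \<zeta> y + r"
        using mono'[OF z(1), of "\<zeta> y + r" "\<zeta> z"] F(2) \<zeta>[OF z(1)] r by (cases "\<zeta> z" "\<zeta> y + r" rule: linorder_cases) auto
      ultimately show "\<bar>\<zeta> z - \<zeta> y\<bar> < \<epsilon>" using r(2) by linarith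
    qed (use a b in auto)
  qed
  have sm: "smooth_fn n D \<zeta>"
  proof (rule implicit_smooth[OF U' _ i _ Dopen cont])
    show "smooth_fn (Suc n) U' F" by (rule smooth_fn_subset[OF F]) (auto simp: U'_def)
    show "ins i y (\<zeta> y) \<in> U'" if "y \<in> D" for y using insW[OF that \<zeta>(1)[OF that]] WU' by auto
  qed (use \<zeta> in \<open>auto simp: U'_def\<close>)
  show ?thesis
  proof (intro exI[of _ W] exI[of _ \<zeta>] conjI)
    show "x0 \<in> W" using x0E d e0 by (simp add: W_def)
    show "W \<subseteq> U" using WU' by (auto simp: U'_def)
    show "\<forall>y\<in>del i ` W. ins i y (\<zeta> y) \<in> W \<and> F (ins i y (\<zeta> y)) = c"
      unfolding DW using insW \<zeta> by blast
    show "\<forall>x\<in>W. F x = c \<longrightarrow> x i = \<zeta> (del i x)"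
    proof (intro ballI impI)
      fix x assume x: "x \<in> W" "F x = c"
      show "x i = \<zeta> (del i x)"
        by (rule uniq[OF delW[OF x(1)]]) (use x in \<open>auto simp: W_def\<close>)
    qed
  qed (use Wopen Dopen sm DW in auto)
qed

lemma implicit_function:
  assumes U: "openin (Euclidean_space (Suc n)) U" and F: "smooth_fn (Suc n) U F" and i: "i \<le> n"
    and x0: "x0 \<in> U" "F x0 = c" "pd i F x0 \<noteq> 0"
  shows "\<exists>W \<zeta>. openin (Euclidean_space (Suc n)) W \<and> x0 \<in> W \<and> W \<subseteq> U \<and>
    openin (Euclidean_space n) (del i ` W) \<and> smooth_fn n (del i ` W) \<zeta> \<and>
    (\<forall>y\<in>del i ` W. ins i y (\<zeta> y) \<in> W \<and> F (ins i y (\<zeta> y)) = c) \<and>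
    (\<forall>x\<in>W. F x = c \<longrightarrow> x i = \<zeta> (del i x))"
proof (cases "pd i F x0 > 0")
  case True
  then show ?thesis using implicit_function_pos[OF U F i x0(1,2)] by blast
next
  case False
  \<comment> \<open>When the derivative is negative the increasing case applies to -F at the level
    -c.\<close>
  have F': "smooth_fn (Suc n) U (\<lambda>x. (-1) * F x)"
    unfolding smooth_fn_iff_Ck
    using F[unfolded smooth_fn_iff_Ck] by (intro allI Ck_mult[OF U] Ck_const) blast
  have "pd i (\<lambda>x. (-1) * F x) x0 = (-1) * pd i F x0"
    by (rule pd_eqI, rule DERIV_cmult, rule Ck_has_pd[where r = 0, OF _ x0(1)])
      (use F i in \<open>auto simp: smooth_fn_iff_Ck simp del: Ck.simps\<close>)
  with False x0(3) have "pd i (\<lambda>x. (-1) * F x) x0 > 0" by simp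
  from implicit_function_pos[OF U F' i x0(1) _ this, of "-c"] x0(2) show ?thesis by simp
qed

subsection \<open>Charts\<close>

lemma chart_open: "smooth_manifold M \<Longrightarrow> (U, \<phi>) \<in> atlas M \<Longrightarrow> openin (mtop M) U"
  unfolding smooth_manifold_def by fast

lemma chart_image_open: "smooth_manifold M \<Longrightarrow> (U, \<phi>) \<in> atlas M \<Longrightarrow> openin (Euclidean_space (mdim M)) (\<phi> ` U)"
  unfolding smooth_manifold_def by fast

lemma chart_homeo: "smooth_manifold M \<Longrightarrow> (U, \<phi>) \<in> atlas M \<Longrightarrow>
    homeomorphic_map (subtopology (mtop M) U) (subtopology (Euclidean_space (mdim M)) (\<phi> ` U)) \<phi>"
  unfolding smooth_manifold_def by fast

lemma chart_transition: "smooth_manifold M \<Longrightarrow> (U, \<phi>) \<in> atlas M \<Longrightarrow> (V, \<psi>) \<in> atlas M \<Longrightarrow> k < mdim M \<Longrightarrow>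
    smooth_fn (mdim M) (\<phi> ` (U \<inter> V)) (\<lambda>x. \<psi> (inv_into U \<phi> x) k)"
  unfolding smooth_manifold_def by fast

lemma chart_ex:
  assumes "smooth_manifold M" "p \<in> points M"
  obtains U \<phi> where "(U, \<phi>) \<in> atlas M" "p \<in> U"
proof -
  have "(\<Union>(U, \<phi>)\<in>atlas M. U) = points M" using assms(1) unfolding smooth_manifold_def by fast
  then show thesis using assms(2) that by fastforce
qed

lemma chart_subset: "smooth_manifold M \<Longrightarrow> (U, \<phi>) \<in> atlas M \<Longrightarrow> U \<subseteq> points M"
  using chart_open openin_subset by metis

lemma chart_inj:
  assumes "smooth_manifold M" "(U, \<phi>) \<in> atlas M"
  shows "inj_on \<phi> U"
  using homeomorphic_imp_injective_map[OF chart_homeo[OF assms]] chart_subset[OF assms]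
  by (simp add: Int_absorb1)

lemma chart_inv: "smooth_manifold M \<Longrightarrow> (U, \<phi>) \<in> atlas M \<Longrightarrow> p \<in> U \<Longrightarrow> inv_into U \<phi> (\<phi> p) = p"
  using chart_inj inv_into_f_f by metis

lemma chart_topspace:
  "smooth_manifold M \<Longrightarrow> (U, \<phi>) \<in> atlas M \<Longrightarrow> p \<in> U \<Longrightarrow> \<phi> p \<in> topspace (Euclidean_space (mdim M))"
  using openin_subset[OF chart_image_open] by blast

lemma chart_open_image:
  assumes "smooth_manifold M" "(U, \<phi>) \<in> atlas M" "openin (mtop M) W"
  shows "openin (Euclidean_space (mdim M)) (\<phi> ` (U \<inter> W))"
proof -
  have "openin (subtopology (mtop M) U) (U \<inter> W)"
    using assms(3) by (simp add: openin_subtopology_Int2)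
  then have "openin (subtopology (Euclidean_space (mdim M)) (\<phi> ` U)) (\<phi> ` (U \<inter> W))"
    using homeomorphic_imp_open_map[OF chart_homeo[OF assms(1,2)]] unfolding open_map_def by blast
  then show ?thesis using chart_image_open[OF assms(1,2)] by (simp add: openin_open_subtopology)
qed

lemma chart_open_preimage:
  assumes "smooth_manifold M" "(U, \<phi>) \<in> atlas M" "openin (Euclidean_space (mdim M)) V"
  shows "openin (mtop M) {p\<in>U. \<phi> p \<in> V}"
proof -
  have "continuous_map (subtopology (mtop M) U) (Euclidean_space (mdim M)) \<phi>"
    using homeomorphic_imp_continuous_map[OF chart_homeo[OF assms(1,2)]] continuous_map_in_subtopology by blast
  from openin_continuous_map_preimage[OF this assms(3)]
  moreover have "{p \<in> topspace (subtopology (mtop M) U). \<phi> p \<in> V} = {p\<in>U. \<phi> p \<in> V}"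
    using chart_subset[OF assms(1,2)] by auto
  ultimately have "openin (subtopology (mtop M) U) {p\<in>U. \<phi> p \<in> V}" by simp
  then show ?thesis using chart_open[OF assms(1,2)] by (simp add: openin_open_subtopology)
qed

subsection \<open>Functions smooth near a point\<close>

text \<open>The definition asks for smoothness in every chart; transition maps are smooth, so one
  chart around p decides.\<close>

lemma smooth_near_iff:
  assumes M: "smooth_manifold M" and c: "(U, \<phi>) \<in> atlas M" and p: "p \<in> U"
  shows "smooth_near M p f \<longleftrightarrow> smooth_at (mdim M) (\<phi> p) (\<lambda>x. f (inv_into U \<phi> x))"
proof
  assume "smooth_near M p f"
  then obtain W where W: "openin (mtop M) W" "p \<in> W"
    "\<forall>(U, \<phi>)\<in>atlas M. smooth_fn (mdim M) (\<phi> ` (U \<inter> W)) (\<lambda>x. f (inv_into U \<phi> x))"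
    unfolding smooth_near_def by blast
  have "smooth_fn (mdim M) (\<phi> ` (U \<inter> W)) (\<lambda>x. f (inv_into U \<phi> x))" using W(3) c by fast
  then show "smooth_at (mdim M) (\<phi> p) (\<lambda>x. f (inv_into U \<phi> x))"
    by (rule smooth_fn_imp_at[OF chart_open_image[OF M c W(1)]]) (use p W(2) in blast)
next
  assume "smooth_at (mdim M) (\<phi> p) (\<lambda>x. f (inv_into U \<phi> x))"
  then obtain Z where Z: "openin (Euclidean_space (mdim M)) Z" "\<phi> p \<in> Z"
    "smooth_fn (mdim M) Z (\<lambda>x. f (inv_into U \<phi> x))" unfolding smooth_at_def by blast
  define W where "W = {q\<in>U. \<phi> q \<in> Z}"
  have W: "openin (mtop M) W" unfolding W_def by (rule chart_open_preimage[OF M c Z(1)])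
  have "smooth_fn (mdim M) (\<psi> ` (V \<inter> W)) (\<lambda>x. f (inv_into V \<psi> x))" if d: "(V, \<psi>) \<in> atlas M" for V \<psi>
  proof (rule smooth_fnI_at[OF chart_open_image[OF M d W]])
    fix x assume "x \<in> \<psi> ` (V \<inter> W)"
    then obtain q where q: "q \<in> V" "q \<in> U" "\<phi> q \<in> Z" "x = \<psi> q" by (auto simp: W_def)
    have op: "openin (Euclidean_space (mdim M)) (\<psi> ` (V \<inter> U))"
      by (rule chart_open_image[OF M d chart_open[OF M c]])
    have x: "x \<in> \<psi> ` (V \<inter> U)" using q by blast
    have ix: "inv_into V \<psi> x = q" using chart_inv[OF M d q(1)] q(4) by simp
    \<comment> \<open>In the second chart f is its expression in the first one composed with the
      transition map.\<close>
    have "smooth_at (mdim M) x (\<lambda>x. f (inv_into U \<phi> (\<phi> (inv_into V \<psi> x))))"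
    proof (rule smooth_at_compose[OF _ op x, where Y = "\<lambda>x. \<phi> (inv_into V \<psi> x)" and m = "mdim M"])
      show "smooth_at (mdim M) (\<phi> (inv_into V \<psi> x)) (\<lambda>x. f (inv_into U \<phi> x))"
        unfolding ix by (rule smooth_fn_imp_at[OF Z(1,3) q(3)])
      show "\<phi> (inv_into V \<psi> y) \<in> topspace (Euclidean_space (mdim M))" if "y \<in> \<psi> ` (V \<inter> U)" for y
        using that chart_inv[OF M d] chart_topspace[OF M c] by auto
      show "smooth_at (mdim M) x (\<lambda>x. \<phi> (inv_into V \<psi> x) k)" if "k < mdim M" for k
        by (rule smooth_fn_imp_at[OF op chart_transition[OF M d c that] x])
    qed
    then show "smooth_at (mdim M) x (\<lambda>x. f (inv_into V \<psi> x))"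
      by (rule smooth_at_cong[OF _ op x]) (use chart_inv[OF M d] chart_inv[OF M c] in auto)
  qed
  then have "\<forall>(V, \<psi>)\<in>atlas M. smooth_fn (mdim M) (\<psi> ` (V \<inter> W)) (\<lambda>x. f (inv_into V \<psi> x))" by blast
  then show "smooth_near M p f" unfolding smooth_near_def using W p Z(2) by (auto simp: W_def)
qed

lemma smooth_near_point: "smooth_near M p f \<Longrightarrow> p \<in> points M"
  unfolding smooth_near_def using openin_subset by blast

lemma smooth_near_nbhd: "smooth_near M p f \<Longrightarrow> \<exists>W. openin (mtop M) W \<and> p \<in> W \<and> (\<forall>q\<in>W. smooth_near M q f)"
  unfolding smooth_near_def by blast

lemma smooth_near_cong:
  assumes M: "smooth_manifold M" and f: "smooth_near M p f"
    and W: "openin (mtop M) W" "p \<in> W" "\<And>q. q \<in> W \<Longrightarrow> f q = h q"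
  shows "smooth_near M p h"
proof -
  obtain U \<phi> where c: "(U, \<phi>) \<in> atlas M" "p \<in> U" using chart_ex[OF M smooth_near_point[OF f]] .
  have "smooth_at (mdim M) (\<phi> p) (\<lambda>x. f (inv_into U \<phi> x))" using f smooth_near_iff[OF M c] by blast
  then have "smooth_at (mdim M) (\<phi> p) (\<lambda>x. h (inv_into U \<phi> x))"
    by (rule smooth_at_cong[OF _ chart_open_image[OF M c(1) W(1)]])
      (use c W chart_inv[OF M c(1)] in auto)
  then show ?thesis using smooth_near_iff[OF M c] by blast
qed

lemma smooth_near_const [simp]:
  assumes M: "smooth_manifold M" and p: "p \<in> points M"
  shows "smooth_near M p (\<lambda>q. a)"
proof -
  obtain U \<phi> where c: "(U, \<phi>) \<in> atlas M" "p \<in> U" using chart_ex[OF M p] .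
  then show ?thesis using smooth_near_iff[OF M c] chart_topspace[OF M c] by simp
qed

lemma smooth_near_add:
  assumes M: "smooth_manifold M" and "smooth_near M p f" "smooth_near M p h"
  shows "smooth_near M p (\<lambda>q. f q + h q)"
proof -
  obtain U \<phi> where c: "(U, \<phi>) \<in> atlas M" "p \<in> U" using chart_ex[OF M smooth_near_point[OF assms(2)]] .
  then show ?thesis using assms(2,3) unfolding smooth_near_iff[OF M c] by (rule_tac smooth_at_add)
qed

lemma smooth_near_mult:
  assumes M: "smooth_manifold M" and "smooth_near M p f" "smooth_near M p h"
  shows "smooth_near M p (\<lambda>q. f q * h q)"
proof -
  obtain U \<phi> where c: "(U, \<phi>) \<in> atlas M" "p \<in> U" using chart_ex[OF M smooth_near_point[OF assms(2)]] .
  then show ?thesis using assms(2,3) unfolding smooth_near_iff[OF M c] by (rule_tac smooth_at_mult)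
qed

lemma smooth_near_sum:
  assumes M: "smooth_manifold M" and p: "p \<in> points M"
  shows "(\<And>k. k \<in> K \<Longrightarrow> smooth_near M p (f k)) \<Longrightarrow> smooth_near M p (\<lambda>q. \<Sum>k\<in>K. f k q)"
  by (induction K rule: infinite_finite_induct) (auto intro: smooth_near_add[OF M] simp: M p)

lemma smooth_near_exp:
  assumes M: "smooth_manifold M" and "smooth_near M p f"
  shows "smooth_near M p (\<lambda>q. exp (f q))"
proof -
  obtain U \<phi> where c: "(U, \<phi>) \<in> atlas M" "p \<in> U" using chart_ex[OF M smooth_near_point[OF assms(2)]] .
  then show ?thesis using assms(2) unfolding smooth_near_iff[OF M c] by (rule_tac smooth_at_exp)
qed

lemma smooth_near_ln:
  assumes M: "smooth_manifold M" and "smooth_near M p f" "f p > 0"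
  shows "smooth_near M p (\<lambda>q. ln (f q))"
proof -
  obtain U \<phi> where c: "(U, \<phi>) \<in> atlas M" "p \<in> U" using chart_ex[OF M smooth_near_point[OF assms(2)]] .
  then show ?thesis using assms(2,3) chart_inv[OF M c] unfolding smooth_near_iff[OF M c]
    by (rule_tac smooth_at_ln) simp_all
qed

lemma smooth_near_coord:
  assumes M: "smooth_manifold M" and c: "(U, \<phi>) \<in> atlas M" "p \<in> U"
  shows "smooth_near M p (\<lambda>q. \<phi> q k)"
  unfolding smooth_near_iff[OF M c]
  by (rule smooth_at_cong[OF smooth_at_coord[OF chart_topspace[OF M c]] chart_image_open[OF M c(1)]])
    (use c(2) chart_inv[OF M c(1)] in auto)

lemma smooth_near_compose:
  assumes M: "smooth_manifold M" and G: "smooth_at m (Y p) G" and W: "openin (mtop M) W" "p \<in> W"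
    and Y: "\<And>q. q \<in> W \<Longrightarrow> Y q \<in> topspace (Euclidean_space m)"
    and Yk: "\<And>k. k < m \<Longrightarrow> smooth_near M p (\<lambda>q. Y q k)"
  shows "smooth_near M p (\<lambda>q. G (Y q))"
proof -
  have p: "p \<in> points M" using W openin_subset by blast
  obtain U \<phi> where c: "(U, \<phi>) \<in> atlas M" "p \<in> U" using chart_ex[OF M p] .
  show ?thesis unfolding smooth_near_iff[OF M c]
  proof (rule smooth_at_compose[where Y = "\<lambda>x. Y (inv_into U \<phi> x)" and m = m])
    show "smooth_at m (Y (inv_into U \<phi> (\<phi> p))) G" using G chart_inv[OF M c] by simp
    show "openin (Euclidean_space (mdim M)) (\<phi> ` (U \<inter> W))" by (rule chart_open_image[OF M c(1) W(1)])
    show "\<phi> p \<in> \<phi> ` (U \<inter> W)" using c(2) W(2) by blast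
    show "Y (inv_into U \<phi> y) \<in> topspace (Euclidean_space m)" if "y \<in> \<phi> ` (U \<inter> W)" for y
      using that chart_inv[OF M c(1)] Y by auto
    show "smooth_at (mdim M) (\<phi> p) (\<lambda>x. Y (inv_into U \<phi> x) k)" if "k < m" for k
      using Yk[OF that] unfolding smooth_near_iff[OF M c] .
  qed
qed

subsection \<open>Smooth maps\<close>

lemma open_preimage:
  "continuous_map (mtop M) (mtop N) F \<Longrightarrow> openin (mtop N) V \<Longrightarrow> openin (mtop M) {q \<in> points M. F q \<in> V}"
  by (rule openin_continuous_map_preimage)

lemma smooth_near_pull_chart:
  assumes M: "smooth_manifold M" and N: "smooth_manifold N" and F: "continuous_map (mtop M) (mtop N) F"
    and d: "(V, \<psi>) \<in> atlas N" "F p \<in> V" and p: "p \<in> points M"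
    and k: "\<And>k. k < mdim N \<Longrightarrow> smooth_near M p (\<lambda>q. \<psi> (F q) k)"
    and f: "smooth_near N (F p) f"
  shows "smooth_near M p (\<lambda>q. f (F q))"
proof -
  let ?W = "{q \<in> points M. F q \<in> V}"
  have W: "openin (mtop M) ?W" "p \<in> ?W" using open_preimage[OF F chart_open[OF N d(1)]] p d(2) by auto
  have "smooth_near M p (\<lambda>q. f (inv_into V \<psi> (\<psi> (F q))))"
  proof (rule smooth_near_compose[OF M _ W, where Y = "\<lambda>q. \<psi> (F q)" and m = "mdim N"])
    show "smooth_at (mdim N) (\<psi> (F p)) (\<lambda>x. f (inv_into V \<psi> x))" using f unfolding smooth_near_iff[OF N d] .
    show "\<psi> (F q) \<in> topspace (Euclidean_space (mdim N))" if "q \<in> ?W" for q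
      using that chart_topspace[OF N d(1)] by blast
  qed (rule k)
  then show ?thesis
    by (rule smooth_near_cong[OF M _ W]) (use chart_inv[OF N d(1)] in auto)
qed

lemma smooth_map_iff:
  assumes M: "smooth_manifold M" and N: "smooth_manifold N"
  shows "smooth_map M N F \<longleftrightarrow> continuous_map (mtop M) (mtop N) F \<and>
    (\<forall>p\<in>points M. \<forall>(V, \<psi>)\<in>atlas N. F p \<in> V \<longrightarrow> (\<forall>k<mdim N. smooth_near M p (\<lambda>q. \<psi> (F q) k)))"
    (is "?L \<longleftrightarrow> ?R")
proof -
  have eq: "\<phi> ` {q\<in>U. F q \<in> V} = \<phi> ` (U \<inter> {q \<in> points M. F q \<in> V})" if "(U, \<phi>) \<in> atlas M" for U \<phi> V
    using chart_subset[OF M that] by blast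
  have op: "openin (Euclidean_space (mdim M)) (\<phi> ` {q\<in>U. F q \<in> V})"
    if "continuous_map (mtop M) (mtop N) F" "(U, \<phi>) \<in> atlas M" "(V, \<psi>) \<in> atlas N" for U \<phi> V \<psi>
    unfolding eq[OF that(2)] by (rule chart_open_image[OF M that(2) open_preimage[OF that(1) chart_open[OF N that(3)]]])
  show ?thesis
  proof
    assume L: ?L
    then have F: "continuous_map (mtop M) (mtop N) F" by (simp add: smooth_map_def)
    have "smooth_near M p (\<lambda>q. \<psi> (F q) k)"
      if p: "p \<in> points M" and d: "(V, \<psi>) \<in> atlas N" "F p \<in> V" and k: "k < mdim N" for p V \<psi> k
    proof -
      obtain U \<phi> where c: "(U, \<phi>) \<in> atlas M" "p \<in> U" using chart_ex[OF M p] .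
      have "smooth_fn (mdim M) (\<phi> ` {p \<in> U. F p \<in> V}) (\<lambda>x. \<psi> (F (inv_into U \<phi> x)) k)"
        using L c(1) d(1) k unfolding smooth_map_def by fast
      then show ?thesis unfolding smooth_near_iff[OF M c]
        by (rule smooth_fn_imp_at[OF op[OF F c(1) d(1)]]) (use c(2) d(2) in blast)
    qed
    with F show ?R by blast
  next
    assume R: ?R
    then have F: "continuous_map (mtop M) (mtop N) F" by simp
    have "smooth_fn (mdim M) (\<phi> ` {p \<in> U. F p \<in> V}) (\<lambda>x. \<psi> (F (inv_into U \<phi> x)) k)"
      if c: "(U, \<phi>) \<in> atlas M" and d: "(V, \<psi>) \<in> atlas N" and k: "k < mdim N" for U \<phi> V \<psi> k
    proof (rule smooth_fnI_at[OF op[OF F c d]])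
      fix x assume "x \<in> \<phi> ` {p \<in> U. F p \<in> V}"
      then obtain q where q: "q \<in> U" "F q \<in> V" "x = \<phi> q" by blast
      have "smooth_near M q (\<lambda>q. \<psi> (F q) k)" using R q d k chart_subset[OF M c] by blast
      then show "smooth_at (mdim M) x (\<lambda>x. \<psi> (F (inv_into U \<phi> x)) k)"
        unfolding smooth_near_iff[OF M c q(1)] q(3) .
    qed
    with F show ?L unfolding smooth_map_def by blast
  qed
qed

lemma smooth_map_continuous: "smooth_map M N F \<Longrightarrow> continuous_map (mtop M) (mtop N) F"
  by (simp add: smooth_map_def)

lemma smooth_map_in: "smooth_map M N F \<Longrightarrow> p \<in> points M \<Longrightarrow> F p \<in> points N"
  using smooth_map_continuous continuous_map_image_subset_topspace by blast

lemma smooth_mapD: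
  assumes "smooth_manifold M" "smooth_manifold N" "smooth_map M N F" "p \<in> points M"
    "(V, \<psi>) \<in> atlas N" "F p \<in> V" "k < mdim N"
  shows "smooth_near M p (\<lambda>q. \<psi> (F q) k)"
  using assms(3-) unfolding smooth_map_iff[OF assms(1,2)] by blast

text \<open>One chart of the target per point is enough: the coordinates of any other chart are
  smooth functions there and can be pulled back through the first.\<close>

lemma smooth_mapI:
  assumes M: "smooth_manifold M" and N: "smooth_manifold N" and F: "continuous_map (mtop M) (mtop N) F"
    and loc: "\<And>p. p \<in> points M \<Longrightarrow>
      \<exists>V \<psi>. (V, \<psi>) \<in> atlas N \<and> F p \<in> V \<and> (\<forall>k<mdim N. smooth_near M p (\<lambda>q. \<psi> (F q) k))"
  shows "smooth_map M N F"
  unfolding smooth_map_iff[OF M N]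
proof (intro conjI F ballI, clarify)
  fix p V' \<psi>' k assume p: "p \<in> points M" and d': "(V', \<psi>') \<in> atlas N" "F p \<in> V'" "k < mdim N"
  obtain V \<psi> where d: "(V, \<psi>) \<in> atlas N" "F p \<in> V" and k: "\<And>k. k < mdim N \<Longrightarrow> smooth_near M p (\<lambda>q. \<psi> (F q) k)"
    using loc[OF p] by blast
  show "smooth_near M p (\<lambda>q. \<psi>' (F q) k)"
    by (rule smooth_near_pull_chart[OF M N F d p k, where f = "\<lambda>q. \<psi>' q k"])
      (assumption, rule smooth_near_coord[OF N d'(1,2)])
qed

lemma smooth_near_pull:
  assumes M: "smooth_manifold M" and N: "smooth_manifold N" and F: "smooth_map M N F"
    and p: "p \<in> points M" and f: "smooth_near N (F p) f"
  shows "smooth_near M p (\<lambda>q. f (F q))"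
proof -
  obtain V \<psi> where d: "(V, \<psi>) \<in> atlas N" "F p \<in> V" using chart_ex[OF N smooth_map_in[OF F p]] .
  show ?thesis
    by (rule smooth_near_pull_chart[OF M N smooth_map_continuous[OF F] d p smooth_mapD[OF M N F p d] f])
qed

lemma smooth_map_compose:
  assumes M: "smooth_manifold M" and N: "smooth_manifold N" and P: "smooth_manifold P"
    and F: "smooth_map M N F" and G: "smooth_map N P G"
  shows "smooth_map M P (\<lambda>q. G (F q))"
proof (rule smooth_mapI[OF M P])
  show "continuous_map (mtop M) (mtop P) (\<lambda>q. G (F q))"
    using continuous_map_compose[OF smooth_map_continuous[OF F] smooth_map_continuous[OF G]] by (simp add: o_def)
  fix p assume p: "p \<in> points M"
  obtain V \<psi> where d: "(V, \<psi>) \<in> atlas P" "G (F p) \<in> V"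
    using chart_ex[OF P smooth_map_in[OF G smooth_map_in[OF F p]]] .
  have "smooth_near M p (\<lambda>q. \<psi> (G (F q)) k)" if "k < mdim P" for k
    by (rule smooth_near_pull[OF M N F p, where f = "\<lambda>q. \<psi> (G q) k"])
      (rule smooth_mapD[OF N P G smooth_map_in[OF F p] d that])
  then show "\<exists>V \<psi>. (V, \<psi>) \<in> atlas P \<and> G (F p) \<in> V \<and> (\<forall>k<mdim P. smooth_near M p (\<lambda>q. \<psi> (G (F q)) k))"
    using d by blast
qed

lemma smooth_map_cong:
  assumes M: "smooth_manifold M" and N: "smooth_manifold N" and F: "smooth_map M N F"
    and eq: "\<And>p. p \<in> points M \<Longrightarrow> F p = G p"
  shows "smooth_map M N G"
proof (rule smooth_mapI[OF M N])
  show "continuous_map (mtop M) (mtop N) G"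
    by (rule continuous_map_eq[OF smooth_map_continuous[OF F] eq])
  fix p assume p: "p \<in> points M"
  obtain V \<psi> where d: "(V, \<psi>) \<in> atlas N" "F p \<in> V" using chart_ex[OF N smooth_map_in[OF F p]] .
  have "smooth_near M p (\<lambda>q. \<psi> (G q) k)" if "k < mdim N" for k
    by (rule smooth_near_cong[OF M smooth_mapD[OF M N F p d that], of "points M"]) (simp_all add: p eq)
  then show "\<exists>V \<psi>. (V, \<psi>) \<in> atlas N \<and> G p \<in> V \<and> (\<forall>k<mdim N. smooth_near M p (\<lambda>q. \<psi> (G q) k))"
    using d eq[OF p] by auto
qed

lemma smooth_map_id:
  assumes M: "smooth_manifold M"
  shows "smooth_map M M (\<lambda>p. p)"
proof (rule smooth_mapI[OF M M])
  fix p assume p: "p \<in> points M"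
  obtain U \<phi> where c: "(U, \<phi>) \<in> atlas M" "p \<in> U" using chart_ex[OF M p] .
  then show "\<exists>V \<psi>. (V, \<psi>) \<in> atlas M \<and> p \<in> V \<and> (\<forall>k<mdim M. smooth_near M p (\<lambda>q. \<psi> q k))"
    using smooth_near_coord[OF M c] by blast
qed simp

lemma smooth_map_const:
  assumes M: "smooth_manifold M" and N: "smooth_manifold N" and a: "a \<in> points N"
  shows "smooth_map M N (\<lambda>p. a)"
proof (rule smooth_mapI[OF M N])
  fix p assume p: "p \<in> points M"
  obtain U \<phi> where c: "(U, \<phi>) \<in> atlas N" "a \<in> U" using chart_ex[OF N a] .
  then show "\<exists>V \<psi>. (V, \<psi>) \<in> atlas N \<and> a \<in> V \<and> (\<forall>k<mdim N. smooth_near M p (\<lambda>q. \<psi> a k))"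
    using smooth_near_const[OF M p] by blast
qed (use a in simp)

subsection \<open>Tangent vectors as derivations\<close>

lemma tangentE:
  assumes "v \<in> tangent_space M p"
  obtains U \<phi> a where "(U, \<phi>) \<in> atlas M" "p \<in> U" "v = (\<lambda>f. \<Sum>i<mdim M. a i * coord_vec M (U, \<phi>) p i f)"
  using assms unfolding tangent_space_def by fastforce

lemma tangentI:
  assumes "(U, \<phi>) \<in> atlas M" "p \<in> U"
  shows "(\<lambda>f. \<Sum>i<mdim M. a i * coord_vec M (U, \<phi>) p i f) \<in> tangent_space M p"
  unfolding tangent_space_def mem_Collect_eq
  by (rule bexI[OF _ assms(1)], rule conjI) (use assms(2) in simp, rule exI, rule refl)

lemma tangent_point: "smooth_manifold M \<Longrightarrow> v \<in> tangent_space M p \<Longrightarrow> p \<in> points M"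
  by (erule tangentE) (use chart_subset in blast)

lemma tangent_nonsmooth: "v \<in> tangent_space M p \<Longrightarrow> \<not> smooth_near M p f \<Longrightarrow> v f = 0"
  by (erule tangentE) (simp add: coord_vec_def)

lemma coord_vec_cong:
  assumes M: "smooth_manifold M" and c: "(U, \<phi>) \<in> atlas M" "p \<in> U" and i: "i < mdim M"
    and W: "openin (mtop M) W" "p \<in> W" "\<And>q. q \<in> W \<Longrightarrow> f q = h q"
  shows "coord_vec M (U, \<phi>) p i f = coord_vec M (U, \<phi>) p i h"
proof -
  have "smooth_near M p f \<longleftrightarrow> smooth_near M p h"
    using smooth_near_cong[OF M _ W(1,2), of f h] smooth_near_cong[OF M _ W(1,2), of h f] W(3) by auto
  moreover have "pd i (\<lambda>x. f (inv_into U \<phi> x)) (\<phi> p) = pd i (\<lambda>x. h (inv_into U \<phi> x)) (\<phi> p)"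
    by (rule pd_cong[OF chart_open_image[OF M c(1) W(1)] _ i]) (use c W chart_inv[OF M c(1)] in auto)
  ultimately show ?thesis by (simp add: coord_vec_def)
qed

text \<open>Tangent vectors act on functions of the whole type, but only through partial
  derivatives, so the germ at p decides.\<close>

lemma tangent_cong:
  assumes M: "smooth_manifold M" and v: "v \<in> tangent_space M p"
    and W: "openin (mtop M) W" "p \<in> W" "\<And>q. q \<in> W \<Longrightarrow> f q = h q"
  shows "v f = v h"
proof -
  obtain U \<phi> a where c: "(U, \<phi>) \<in> atlas M" "p \<in> U" "v = (\<lambda>f. \<Sum>i<mdim M. a i * coord_vec M (U, \<phi>) p i f)"
    using tangentE[OF v] .
  show ?thesis unfolding c(3)
    by (rule sum.cong) (use coord_vec_cong[OF M c(1,2) _ W] in auto)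
qed

lemma coord_vec_compose:
  assumes M: "smooth_manifold M" and c: "(U, \<phi>) \<in> atlas M" "p \<in> U" and i: "i < mdim M"
    and G: "smooth_at m (Y p) G" and W: "openin (mtop M) W" "p \<in> W"
    and Y: "\<And>q. q \<in> W \<Longrightarrow> Y q \<in> topspace (Euclidean_space m)"
    and Yk: "\<And>k. k < m \<Longrightarrow> smooth_near M p (\<lambda>q. Y q k)"
  shows "coord_vec M (U, \<phi>) p i (\<lambda>q. G (Y q)) = (\<Sum>k<m. pd k G (Y p) * coord_vec M (U, \<phi>) p i (\<lambda>q. Y q k))"
proof -
  have "pd i (\<lambda>x. G (Y (inv_into U \<phi> x))) (\<phi> p) =
      (\<Sum>k<m. pd k G (Y (inv_into U \<phi> (\<phi> p))) * pd i (\<lambda>x. Y (inv_into U \<phi> x) k) (\<phi> p))"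
  proof (rule pd_compose[where Y = "\<lambda>x. Y (inv_into U \<phi> x)" and m = m])
    show "smooth_at m (Y (inv_into U \<phi> (\<phi> p))) G" using G chart_inv[OF M c] by simp
    show "openin (Euclidean_space (mdim M)) (\<phi> ` (U \<inter> W))" by (rule chart_open_image[OF M c(1) W(1)])
    show "\<phi> p \<in> \<phi> ` (U \<inter> W)" using c(2) W(2) by blast
    show "Y (inv_into U \<phi> y) \<in> topspace (Euclidean_space m)" if "y \<in> \<phi> ` (U \<inter> W)" for y
      using that chart_inv[OF M c(1)] Y by auto
    show "smooth_at (mdim M) (\<phi> p) (\<lambda>x. Y (inv_into U \<phi> x) k)" if "k < m" for k
      using Yk[OF that] unfolding smooth_near_iff[OF M c] .
  qed (rule i)
  moreover have "smooth_near M p (\<lambda>q. G (Y q))" by (rule smooth_near_compose[OF M G W Y Yk])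
  ultimately show ?thesis using Yk by (simp add: coord_vec_def chart_inv[OF M c])
qed

text \<open>The chain rule for tangent vectors as operators. Linear behaviour in f, the vanishing on
  constants, the expansion in a chart and the coordinates of a differential are all drawn from it,
  with different choices of G and Y.\<close>

lemma tangent_compose:
  assumes M: "smooth_manifold M" and v: "v \<in> tangent_space M p"
    and G: "smooth_at m (Y p) G" and W: "openin (mtop M) W" "p \<in> W"
    and Y: "\<And>q. q \<in> W \<Longrightarrow> Y q \<in> topspace (Euclidean_space m)"
    and Yk: "\<And>k. k < m \<Longrightarrow> smooth_near M p (\<lambda>q. Y q k)"
  shows "v (\<lambda>q. G (Y q)) = (\<Sum>k<m. pd k G (Y p) * v (\<lambda>q. Y q k))"
proof -
  obtain U \<phi> a where c: "(U, \<phi>) \<in> atlas M" "p \<in> U" "v = (\<lambda>f. \<Sum>i<mdim M. a i * coord_vec M (U, \<phi>) p i f)"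
    using tangentE[OF v] .
  have "v (\<lambda>q. G (Y q)) = (\<Sum>i<mdim M. a i * (\<Sum>k<m. pd k G (Y p) * coord_vec M (U, \<phi>) p i (\<lambda>q. Y q k)))"
    unfolding c(3)
  proof (rule sum.cong[OF refl])
    fix i assume i: "i \<in> {..<mdim M}"
    have "coord_vec M (U, \<phi>) p i (\<lambda>q. G (Y q)) = (\<Sum>k<m. pd k G (Y p) * coord_vec M (U, \<phi>) p i (\<lambda>q. Y q k))"
      by (rule coord_vec_compose[OF M c(1,2) _ G W Y Yk]) (use i in auto)
    then show "a i * coord_vec M (U, \<phi>) p i (\<lambda>q. G (Y q)) =
        a i * (\<Sum>k<m. pd k G (Y p) * coord_vec M (U, \<phi>) p i (\<lambda>q. Y q k))" by simp
  qed
  also have "\<dots> = (\<Sum>k<m. pd k G (Y p) * v (\<lambda>q. Y q k))"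
    unfolding c(3) sum_distrib_left
    by (subst sum.swap) (simp add: mult_ac)
  finally show ?thesis .
qed

lemma coord_vec_tangent:
  assumes "(U, \<phi>) \<in> atlas M" "p \<in> U" "i < mdim M"
  shows "coord_vec M (U, \<phi>) p i \<in> tangent_space M p"
proof -
  have "coord_vec M (U, \<phi>) p i = (\<lambda>f. \<Sum>j<mdim M. (if j = i then 1 else 0) * coord_vec M (U, \<phi>) p j f)"
    using assms(3) by (simp add: if_distrib[of "\<lambda>x. x * _"] sum.delta cong: if_cong)
  then show ?thesis using tangentI[OF assms(1,2), of "\<lambda>j. if j = i then 1 else 0"] by simp
qed

text \<open>A tangent vector is given in some chart around p; this expands it in a prescribed one.
  Near p, f is a function of the coordinates \<open>\<phi>\<close>, so the chain rule
  applies.\<close>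

lemma tangent_coords:
  assumes M: "smooth_manifold M" and v: "v \<in> tangent_space M p" and c: "(U, \<phi>) \<in> atlas M" "p \<in> U"
  shows "v = (\<lambda>f. \<Sum>i<mdim M. v (\<lambda>q. \<phi> q i) * coord_vec M (U, \<phi>) p i f)"
proof
  fix f
  show "v f = (\<Sum>i<mdim M. v (\<lambda>q. \<phi> q i) * coord_vec M (U, \<phi>) p i f)"
  proof (cases "smooth_near M p f")
    case False then show ?thesis using tangent_nonsmooth[OF v False] by (simp add: coord_vec_def)
  next
    case True
    have "v f = v (\<lambda>q. f (inv_into U \<phi> (\<phi> q)))"
      by (rule tangent_cong[OF M v chart_open[OF M c(1)] c(2)]) (simp add: chart_inv[OF M c(1)])
    also have "\<dots> = (\<Sum>i<mdim M. pd i (\<lambda>x. f (inv_into U \<phi> x)) (\<phi> p) * v (\<lambda>q. \<phi> q i))"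
      by (rule tangent_compose[OF M v _ chart_open[OF M c(1)] c(2)])
        (use True smooth_near_iff[OF M c] chart_topspace[OF M c(1)] smooth_near_coord[OF M c] in auto)
    finally show ?thesis using True by (simp add: coord_vec_def mult.commute)
  qed
qed

lemma tangent_eqI:
  assumes M: "smooth_manifold M" and "u \<in> tangent_space M p" "v \<in> tangent_space M p" and c: "(U, \<phi>) \<in> atlas M" "p \<in> U"
    and eq: "\<And>i. i < mdim M \<Longrightarrow> u (\<lambda>q. \<phi> q i) = v (\<lambda>q. \<phi> q i)"
  shows "u = v"
  by (subst tangent_coords[OF M assms(2) c], subst tangent_coords[OF M assms(3) c]) (simp add: eq)

lemma coord_vec_coord:
  assumes M: "smooth_manifold M" and c: "(U, \<phi>) \<in> atlas M" "p \<in> U" and i: "i < mdim M"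
  shows "coord_vec M (U, \<phi>) p i (\<lambda>q. \<phi> q j) = (if i = j then 1 else 0)"
proof -
  have "pd i (\<lambda>x. \<phi> (inv_into U \<phi> x) j) (\<phi> p) = pd i (\<lambda>x. x j) (\<phi> p)"
    by (rule pd_cong[OF chart_image_open[OF M c(1)] _ i]) (use c(2) chart_inv[OF M c(1)] in auto)
  also have "\<dots> = (if i = j then 1 else 0)"
    by (rule pd_eqI) (cases "i = j"; auto intro!: derivative_eq_intros)
  finally show ?thesis using smooth_near_coord[OF M c] by (simp add: coord_vec_def)
qed

text \<open>The summands may come from different charts, so all are first expanded in a common
  one.\<close>

lemma tangent_sum:
  assumes M: "smooth_manifold M" and p: "p \<in> points M" and v: "\<And>k. k \<in> K \<Longrightarrow> v k \<in> tangent_space M p"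
  shows "(\<lambda>f. \<Sum>k\<in>K. a k * v k f) \<in> tangent_space M p"
proof -
  obtain U \<phi> where c: "(U, \<phi>) \<in> atlas M" "p \<in> U" using chart_ex[OF M p] .
  have eq: "(\<Sum>k\<in>K. a k * v k f) = (\<Sum>i<mdim M. (\<Sum>k\<in>K. a k * v k (\<lambda>q. \<phi> q i)) * coord_vec M (U, \<phi>) p i f)" for f
  proof -
    have "(\<Sum>k\<in>K. a k * v k f) = (\<Sum>k\<in>K. a k * (\<Sum>i<mdim M. v k (\<lambda>q. \<phi> q i) * coord_vec M (U, \<phi>) p i f))"
      by (rule sum.cong) (use fun_cong[OF tangent_coords[OF M v c], of _ f] in auto)
    then show ?thesis
      unfolding sum_distrib_left sum_distrib_right by (subst sum.swap) (simp add: mult_ac)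
  qed
  from tangentI[OF c, of "\<lambda>i. \<Sum>k\<in>K. a k * v k (\<lambda>q. \<phi> q i)"] show ?thesis
    by (simp only: eq[symmetric])
qed

lemma tangent_lincomb:
  assumes M: "smooth_manifold M" and u: "u \<in> tangent_space M p" and v: "v \<in> tangent_space M p"
  shows "(\<lambda>f. a * u f + b * v f) \<in> tangent_space M p"
proof -
  have "(\<lambda>f. \<Sum>k\<in>{True, False}. (if k then a else b) * (if k then u else v) f) \<in> tangent_space M p"
    by (rule tangent_sum[OF M tangent_point[OF M u]]) (simp add: u v)
  then show ?thesis by simp
qed

lemma tangent_zero: "smooth_manifold M \<Longrightarrow> p \<in> points M \<Longrightarrow> (\<lambda>f. 0) \<in> tangent_space M p"
  using tangent_sum[of M p "{}"] by simp

lemma linear_form_lincomb: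
  "linear_form T \<omega> \<Longrightarrow> u \<in> T \<Longrightarrow> v \<in> T \<Longrightarrow> \<omega> (\<lambda>f. a * u f + b * v f) = a * \<omega> u + b * \<omega> v"
  unfolding linear_form_def by blast

lemma linear_form_sum:
  assumes M: "smooth_manifold M" and p: "p \<in> points M" and \<omega>: "linear_form (tangent_space M p) \<omega>"
  shows "(\<And>k. k \<in> K \<Longrightarrow> v k \<in> tangent_space M p) \<Longrightarrow> \<omega> (\<lambda>f. \<Sum>k\<in>K. a k * v k f) = (\<Sum>k\<in>K. a k * \<omega> (v k))"
proof (induction K rule: infinite_finite_induct)
  case (insert k K)
  have "\<omega> (\<lambda>f. a k * v k f + 1 * (\<Sum>k\<in>K. a k * v k f)) = a k * \<omega> (v k) + 1 * \<omega> (\<lambda>f. \<Sum>k\<in>K. a k * v k f)"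
    by (rule linear_form_lincomb[OF \<omega>]) (use insert.prems tangent_sum[OF M p, of K v a] in auto)
  then show ?case using insert by simp
qed (use linear_form_lincomb[OF \<omega> tangent_zero[OF M p] tangent_zero[OF M p], of 0 0] in simp_all)

subsection \<open>Differentials\<close>

lemma pushforward_lincomb:
  "pushforward N F p (\<lambda>f. a * u f + b * v f) = (\<lambda>f. a * pushforward N F p u f + b * pushforward N F p v f)"
  by (auto simp: pushforward_def)

lemma pushforward_coords:
  assumes M: "smooth_manifold M" and N: "smooth_manifold N" and F: "smooth_map M N F"
    and v: "v \<in> tangent_space M p" and d: "(V, \<psi>) \<in> atlas N" "F p \<in> V"
  shows "pushforward N F p v = (\<lambda>f. \<Sum>k<mdim N. v (\<lambda>q. \<psi> (F q) k) * coord_vec N (V, \<psi>) (F p) k f)"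
proof
  fix f
  note p = tangent_point[OF M v]
  show "pushforward N F p v f = (\<Sum>k<mdim N. v (\<lambda>q. \<psi> (F q) k) * coord_vec N (V, \<psi>) (F p) k f)"
  proof (cases "smooth_near N (F p) f")
    case False then show ?thesis by (simp add: pushforward_def coord_vec_def)
  next
    case True
    let ?W = "{q \<in> points M. F q \<in> V}"
    have W: "openin (mtop M) ?W" "p \<in> ?W"
      using open_preimage[OF smooth_map_continuous[OF F] chart_open[OF N d(1)]] p d(2) by auto
    have "pushforward N F p v f = v (\<lambda>q. f (F q))" using True by (simp add: pushforward_def)
    also have "\<dots> = v (\<lambda>q. f (inv_into V \<psi> (\<psi> (F q))))"
      by (rule tangent_cong[OF M v W]) (simp add: chart_inv[OF N d(1)])
    also have "\<dots> = (\<Sum>k<mdim N. pd k (\<lambda>x. f (inv_into V \<psi> x)) (\<psi> (F p)) * v (\<lambda>q. \<psi> (F q) k))"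
      by (rule tangent_compose[OF M v _ W])
        (use True smooth_near_iff[OF N d] chart_topspace[OF N d(1)] smooth_mapD[OF M N F p d] in auto)
    finally show ?thesis using True by (simp add: coord_vec_def mult.commute)
  qed
qed

lemma pushforward_tangent:
  assumes M: "smooth_manifold M" and N: "smooth_manifold N" and F: "smooth_map M N F" and v: "v \<in> tangent_space M p"
  shows "pushforward N F p v \<in> tangent_space N (F p)"
proof -
  obtain V \<psi> where d: "(V, \<psi>) \<in> atlas N" "F p \<in> V" using chart_ex[OF N smooth_map_in[OF F tangent_point[OF M v]]] .
  show ?thesis unfolding pushforward_coords[OF M N F v d] by (rule tangentI[OF d])
qed

text \<open>If f is smooth near the final point then its composite with G is smooth near
  \<open>F p\<close>, so the inner conditional takes its first branch; otherwise both sides are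
  0.\<close>

lemma pushforward_compose:
  assumes N: "smooth_manifold N" and P: "smooth_manifold P" and G: "smooth_map N P G" and "F p \<in> points N"
  shows "pushforward P G (F p) (pushforward N F p v) = pushforward P (\<lambda>q. G (F q)) p v"
  using smooth_near_pull[OF N P G assms(4)] by (auto simp: pushforward_def)

lemma pushforward_id:
  assumes v: "v \<in> tangent_space M p"
  shows "pushforward M (\<lambda>q. q) p v = v"
  using tangent_nonsmooth[OF v] by (auto simp: pushforward_def)

lemma pushforward_cong:
  assumes M: "smooth_manifold M" and v: "v \<in> tangent_space M p"
    and W: "openin (mtop M) W" "p \<in> W" "\<And>q. q \<in> W \<Longrightarrow> F q = G q"
  shows "pushforward N F p v = pushforward N G p v"
proof
  fix f
  have "v (\<lambda>q. f (F q)) = v (\<lambda>q. f (G q))"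
    by (rule tangent_cong[OF M v W(1,2)]) (simp add: W(3))
  then show "pushforward N F p v f = pushforward N G p v f"
    using W(3)[OF W(2)] by (simp add: pushforward_def)
qed

subsection \<open>Construction of manifolds\<close>

lemma continuous_map_into_Euclidean:
  assumes "\<And>p. p \<in> topspace T \<Longrightarrow> Y p \<in> topspace (Euclidean_space m)"
    "\<And>k. k < m \<Longrightarrow> continuous_map T euclideanreal (\<lambda>p. Y p k)"
  shows "continuous_map T (Euclidean_space m) Y"
proof (rule continuous_map_eq)
  show "continuous_map T (Euclidean_space m) (\<lambda>p i. if i < m then Y p i else 0)"
    unfolding continuous_map_componentwise_Euclidean_space using assms(2) by blast
  show "(\<lambda>i. if i < m then Y p i else 0) = Y p" if "p \<in> topspace T" for p
    using assms(1)[OF that] by (auto simp: topspace_Euclidean_space fun_eq_iff)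
qed

lemma continuous_map_Euclidean_coord: "continuous_map (Euclidean_space n) euclideanreal (\<lambda>x. x k)"
  unfolding Euclidean_space_def
  by (rule continuous_map_from_subtopology, rule continuous_map_product_projection) simp

lemma chart_coord_continuous:
  assumes "smooth_manifold M" "(U, \<phi>) \<in> atlas M"
  shows "continuous_map (subtopology (mtop M) U) euclideanreal (\<lambda>p. \<phi> p k)"
proof -
  have "continuous_map (subtopology (mtop M) U) (Euclidean_space (mdim M)) \<phi>"
    using homeomorphic_imp_continuous_map[OF chart_homeo[OF assms]] continuous_map_in_subtopology by blast
  from continuous_map_compose[OF this continuous_map_Euclidean_coord] show ?thesis by (simp add: o_def)
qed

lemma chart_inv_continuous:
  assumes "smooth_manifold M" "(U, \<phi>) \<in> atlas M"
  shows "continuous_map (subtopology (Euclidean_space (mdim M)) (\<phi> ` U)) (mtop M) (inv_into U \<phi>)"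
proof -
  obtain g where g: "homeomorphic_maps (subtopology (mtop M) U) (subtopology (Euclidean_space (mdim M)) (\<phi> ` U)) \<phi> g"
    using chart_homeo[OF assms] unfolding homeomorphic_map_maps by blast
  have "continuous_map (subtopology (Euclidean_space (mdim M)) (\<phi> ` U)) (mtop M) g"
    using g continuous_map_in_subtopology unfolding homeomorphic_maps_def by blast
  then show ?thesis
  proof (rule continuous_map_eq)
    fix x assume "x \<in> topspace (subtopology (Euclidean_space (mdim M)) (\<phi> ` U))"
    then obtain q where q: "q \<in> U" "x = \<phi> q" by auto
    then have "g x = q" using g chart_subset[OF assms] unfolding homeomorphic_maps_def by auto
    then show "g x = inv_into U \<phi> x" using q chart_inv[OF assms] by simp
  qed
qed

text \<open>Used for intervals, products, transported structures and level sets. Overlaps need not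
  be shown open: this follows from continuity of the inverse charts, and smoothness of transition
  maps is then checked point by point.\<close>

lemma smooth_manifoldI:
  assumes "Hausdorff_space (mtop M)" "second_countable (mtop M)"
    and cover: "\<And>p. p \<in> points M \<Longrightarrow> \<exists>U \<phi>. (U, \<phi>) \<in> atlas M \<and> p \<in> U"
    and opn: "\<And>U \<phi>. (U, \<phi>) \<in> atlas M \<Longrightarrow> openin (mtop M) U"
    and img: "\<And>U \<phi>. (U, \<phi>) \<in> atlas M \<Longrightarrow> openin (Euclidean_space (mdim M)) (\<phi> ` U)"
    and inj: "\<And>U \<phi>. (U, \<phi>) \<in> atlas M \<Longrightarrow> inj_on \<phi> U"
    and cont: "\<And>U \<phi>. (U, \<phi>) \<in> atlas M \<Longrightarrow> continuous_map (subtopology (mtop M) U) (Euclidean_space (mdim M)) \<phi>"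
    and cinv: "\<And>U \<phi>. (U, \<phi>) \<in> atlas M \<Longrightarrow>
      continuous_map (subtopology (Euclidean_space (mdim M)) (\<phi> ` U)) (mtop M) (inv_into U \<phi>)"
    and trans: "\<And>U \<phi> V \<psi> k q. (U, \<phi>) \<in> atlas M \<Longrightarrow> (V, \<psi>) \<in> atlas M \<Longrightarrow> k < mdim M \<Longrightarrow> q \<in> U \<Longrightarrow> q \<in> V \<Longrightarrow>
      smooth_at (mdim M) (\<phi> q) (\<lambda>x. \<psi> (inv_into U \<phi> x) k)"
  shows "smooth_manifold M"
  unfolding smooth_manifold_def
proof (intro conjI assms(1,2))
  have sub: "U \<subseteq> points M" if "(U, \<phi>) \<in> atlas M" for U \<phi> using openin_subset[OF opn[OF that]] .
  show "(\<Union>(U, \<phi>)\<in>atlas M. U) = points M"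
  proof
    show "(\<Union>(U, \<phi>)\<in>atlas M. U) \<subseteq> points M" using sub by auto
    show "points M \<subseteq> (\<Union>(U, \<phi>)\<in>atlas M. U)" using cover by fastforce
  qed
  show "\<forall>(U, \<phi>)\<in>atlas M. openin (mtop M) U \<and> openin (Euclidean_space (mdim M)) (\<phi> ` U) \<and>
        homeomorphic_map (subtopology (mtop M) U) (subtopology (Euclidean_space (mdim M)) (\<phi> ` U)) \<phi>"
  proof clarify
    fix U \<phi> assume c: "(U, \<phi>) \<in> atlas M"
    have "homeomorphic_maps (subtopology (mtop M) U) (subtopology (Euclidean_space (mdim M)) (\<phi> ` U)) \<phi> (inv_into U \<phi>)"
      unfolding homeomorphic_maps_def
    proof (intro conjI ballI)
      show "continuous_map (subtopology (mtop M) U) (subtopology (Euclidean_space (mdim M)) (\<phi> ` U)) \<phi>"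
        using cont[OF c] by (auto simp: continuous_map_in_subtopology)
      show "continuous_map (subtopology (Euclidean_space (mdim M)) (\<phi> ` U)) (subtopology (mtop M) U) (inv_into U \<phi>)"
        using cinv[OF c] inv_into_into[of _ \<phi> U] by (auto simp: continuous_map_in_subtopology)
    qed (auto simp: inj[OF c] f_inv_into_f)
    then show "openin (mtop M) U \<and> openin (Euclidean_space (mdim M)) (\<phi> ` U) \<and>
        homeomorphic_map (subtopology (mtop M) U) (subtopology (Euclidean_space (mdim M)) (\<phi> ` U)) \<phi>"
      using opn[OF c] img[OF c] homeomorphic_map_maps by blast
  qed
  show "\<forall>(U, \<phi>)\<in>atlas M. \<forall>(V, \<psi>)\<in>atlas M. \<forall>k<mdim M.
        smooth_fn (mdim M) (\<phi> ` (U \<inter> V)) (\<lambda>x. \<psi> (inv_into U \<phi> x) k)"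
  proof clarify
    fix U \<phi> V \<psi> k assume c: "(U, \<phi>) \<in> atlas M" and d: "(V, \<psi>) \<in> atlas M" and k: "k < mdim M"
    have "openin (subtopology (Euclidean_space (mdim M)) (\<phi> ` U))
        {x \<in> topspace (subtopology (Euclidean_space (mdim M)) (\<phi> ` U)). inv_into U \<phi> x \<in> V}"
      by (rule openin_continuous_map_preimage[OF cinv[OF c] opn[OF d]])
    moreover have "{x \<in> topspace (subtopology (Euclidean_space (mdim M)) (\<phi> ` U)). inv_into U \<phi> x \<in> V} = \<phi> ` (U \<inter> V)"
      using openin_subset[OF img[OF c]] inj[OF c] by auto
    ultimately have op: "openin (Euclidean_space (mdim M)) (\<phi> ` (U \<inter> V))"
      using img[OF c] by (simp add: openin_open_subtopology)
    show "smooth_fn (mdim M) (\<phi> ` (U \<inter> V)) (\<lambda>x. \<psi> (inv_into U \<phi> x) k)"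
      by (rule smooth_fnI_at[OF op]) (use trans[OF c d k] in blast)
  qed
qed

lemma smooth_near_continuous:
  assumes M: "smooth_manifold M" and f: "\<And>p. p \<in> points M \<Longrightarrow> smooth_near M p f"
  shows "continuous_map (mtop M) euclideanreal f"
  unfolding continuous_map_def
proof (intro conjI allI impI)
  fix B :: "real set" assume B: "openin euclideanreal B"
  show "openin (mtop M) {p \<in> points M. f p \<in> B}"
  proof (subst openin_subopen, intro ballI)
    fix p assume p: "p \<in> {p \<in> points M. f p \<in> B}"
    obtain U \<phi> where c: "(U, \<phi>) \<in> atlas M" "p \<in> U" using chart_ex[OF M, of p] p by blast
    have "smooth_at (mdim M) (\<phi> p) (\<lambda>x. f (inv_into U \<phi> x))"
      using f[of p] p unfolding smooth_near_iff[OF M c] by blast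
    then obtain Z where Z: "openin (Euclidean_space (mdim M)) Z" "\<phi> p \<in> Z" "\<And>y. y \<in> Z \<Longrightarrow> f (inv_into U \<phi> y) \<in> B"
      using smooth_at_restrict[of "mdim M" "\<phi> p" "\<lambda>x. f (inv_into U \<phi> x)" B] B p chart_inv[OF M c] by auto
    have "openin (mtop M) {q \<in> U. \<phi> q \<in> Z}" by (rule chart_open_preimage[OF M c(1) Z(1)])
    moreover have "{q \<in> U. \<phi> q \<in> Z} \<subseteq> {p \<in> points M. f p \<in> B}"
      using Z(3) chart_inv[OF M c(1)] chart_subset[OF M c(1)] by force
    ultimately show "\<exists>T. openin (mtop M) T \<and> p \<in> T \<and> T \<subseteq> {p \<in> points M. f p \<in> B}"
      using c(2) Z(2) by blast
  qed
qed simp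

subsection \<open>The real line\<close>

abbreviation rchart :: "real \<Rightarrow> nat \<Rightarrow> real" where
  "rchart \<equiv> \<lambda>x i. if i = 0 then x else 0"

lemma real_mfd_simps [simp]:
  "mtop (real_mfd S) = top_of_set S" "mdim (real_mfd S) = 1" "atlas (real_mfd S) = {(S, rchart)}"
  by (simp_all add: real_mfd_def)

lemma inj_rchart: "inj_on rchart S"
  by (rule inj_onI) (metis (full_types))

lemma inv_rchart: "x \<in> rchart ` S \<Longrightarrow> inv_into S rchart x = x 0"
  using inv_into_f_f[OF inj_rchart] by auto

lemma rchart_image: "rchart ` S = {x \<in> topspace (Euclidean_space 1). x 0 \<in> S}"
proof
  show "{x \<in> topspace (Euclidean_space 1). x 0 \<in> S} \<subseteq> rchart ` S"
  proof
    fix x assume x: "x \<in> {x \<in> topspace (Euclidean_space 1). x 0 \<in> S}"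
    then have "x = rchart (x 0)" by (auto simp: topspace_Euclidean_space fun_eq_iff)
    then show "x \<in> rchart ` S" using x by blast
  qed
qed (auto simp: topspace_Euclidean_space)

lemma rchart_image_open: "open S \<Longrightarrow> openin (Euclidean_space 1) (rchart ` S)"
  unfolding rchart_image
  using openin_continuous_map_preimage[OF continuous_map_Euclidean_coord[of 1 0], of S] by simp

lemma second_countable_real: "second_countable euclideanreal"
proof -
  obtain \<B> :: "real set set" where B: "countable \<B>" "\<And>C. C \<in> \<B> \<Longrightarrow> open C" "\<And>S. open S \<Longrightarrow> \<exists>U. U \<subseteq> \<B> \<and> S = \<Union>U"
    using univ_second_countable by blast
  have "\<exists>V\<in>\<B>. x \<in> V \<and> V \<subseteq> U" if "open U" "x \<in> U" for U x
    using B(3)[OF that(1)] that(2) by blast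
  then show ?thesis unfolding second_countable_def using B(1,2) by (intro exI[of _ \<B>]) auto
qed

lemma smooth_manifold_real:
  assumes S: "open S"
  shows "smooth_manifold (real_mfd S)"
proof (rule smooth_manifoldI)
  show "Hausdorff_space (mtop (real_mfd S))" by (simp add: Hausdorff_space_subtopology)
  show "second_countable (mtop (real_mfd S))" by (simp add: second_countable_subtopology second_countable_real)
  show "\<exists>U \<phi>. (U, \<phi>) \<in> atlas (real_mfd S) \<and> p \<in> U" if "p \<in> points (real_mfd S)" for p
    using that by auto
  fix U :: "real set" and \<phi> assume "(U, \<phi>) \<in> atlas (real_mfd S)"
  then have c: "U = S" "\<phi> = rchart" by auto
  show "openin (mtop (real_mfd S)) U" unfolding c by simp
  show "openin (Euclidean_space (mdim (real_mfd S))) (\<phi> ` U)" unfolding c using rchart_image_open[OF S] by simp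
  show "inj_on \<phi> U" unfolding c by (rule inj_rchart)
  show "continuous_map (subtopology (mtop (real_mfd S)) U) (Euclidean_space (mdim (real_mfd S))) \<phi>"
    unfolding c by (rule continuous_map_into_Euclidean)
      (auto simp: topspace_Euclidean_space, intro continuous_map_from_subtopology, simp)
  have "continuous_map (subtopology (Euclidean_space 1) (rchart ` S)) (top_of_set S) (inv_into S rchart)"
  proof (rule continuous_map_eq)
    show "continuous_map (subtopology (Euclidean_space 1) (rchart ` S)) (top_of_set S) (\<lambda>x. x 0)"
      using continuous_map_Euclidean_coord by (auto simp: continuous_map_in_subtopology intro: continuous_map_from_subtopology)
  qed (use inv_rchart[of _ S] in auto)
  then show "continuous_map (subtopology (Euclidean_space (mdim (real_mfd S))) (\<phi> ` U)) (mtop (real_mfd S)) (inv_into U \<phi>)"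
    unfolding c by simp
  fix V :: "real set" and \<psi> k q assume "(V, \<psi>) \<in> atlas (real_mfd S)" and k: "k < mdim (real_mfd S)" and q: "q \<in> U"
  then have d: "\<psi> = rchart" by auto
  have qE: "rchart q \<in> rchart ` S" using q c by blast
  have "smooth_at 1 (rchart q) (\<lambda>x. rchart (inv_into S rchart x) k)"
  proof (rule smooth_at_cong[OF smooth_at_coord rchart_image_open[OF S] qE])
    show "rchart q \<in> topspace (Euclidean_space 1)" by (simp add: topspace_Euclidean_space)
    show "y k = rchart (inv_into S rchart y) k" if "y \<in> rchart ` S" for y
      using inv_rchart[OF that] k by simp
  qed
  then show "smooth_at (mdim (real_mfd S)) (\<phi> q) (\<lambda>x. \<psi> (inv_into U \<phi> x) k)" unfolding c d by simp
qed

lemma smooth_near_real_id: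
  assumes "open S" "s \<in> S"
  shows "smooth_near (real_mfd S) s (\<lambda>s. s)"
  using smooth_near_coord[OF smooth_manifold_real[OF assms(1)], of S rchart s 0] assms(2) by simp

lemma smooth_map_into_real:
  assumes M: "smooth_manifold M" and S: "open S" and f: "\<And>p. p \<in> points M \<Longrightarrow> smooth_near M p f \<and> f p \<in> S"
  shows "smooth_map M (real_mfd S) f"
proof (rule smooth_mapI[OF M smooth_manifold_real[OF S]])
  have "continuous_map (mtop M) euclideanreal f" by (rule smooth_near_continuous[OF M]) (use f in blast)
  then show "continuous_map (mtop M) (mtop (real_mfd S)) f"
    using f by (auto simp: continuous_map_in_subtopology)
  fix p assume p: "p \<in> points M"
  show "\<exists>V \<psi>. (V, \<psi>) \<in> atlas (real_mfd S) \<and> f p \<in> V \<and> (\<forall>k<mdim (real_mfd S). smooth_near M p (\<lambda>q. \<psi> (f q) k))"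
    using f[OF p] by (intro exI[of _ S] exI[of _ rchart]) auto
qed

lemma smooth_near_of_real_map:
  assumes M: "smooth_manifold M" and S: "open S" and f: "smooth_map M (real_mfd S) f" and p: "p \<in> points M"
  shows "smooth_near M p f"
  using smooth_near_pull[OF M smooth_manifold_real[OF S] f p, of "\<lambda>s. s"]
    smooth_near_real_id[OF S] smooth_map_in[OF f p] by simp

text \<open>The chart only pads a number with zeros, so its coordinate vector is ordinary
  differentiation.\<close>

lemma real_smooth_near_pd:
  assumes S: "open S" "s \<in> S" and f: "smooth_near (real_mfd S) s f"
  shows "((\<lambda>r. f r) has_real_derivative coord_vec (real_mfd S) (S, rchart) s 0 f) (at s)"
proof -
  note R = smooth_manifold_real[OF S(1)]
  have c: "(S, rchart) \<in> atlas (real_mfd S)" by simp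
  let ?h = "\<lambda>x. f (inv_into S rchart x)"
  have "smooth_at 1 (rchart s) ?h" using f smooth_near_iff[OF R c S(2), of f] by simp
  then have "((\<lambda>r. ?h ((rchart s)(0 := r))) has_real_derivative pd 0 ?h (rchart s)) (at (rchart s 0))"
    by (rule smooth_at_has_pd) simp
  moreover have "\<forall>\<^sub>F r in nhds s. ?h ((rchart s)(0 := r)) = f r"
  proof -
    have "\<forall>\<^sub>F r in nhds s. r \<in> S" using S by (rule eventually_nhds_in_open)
    then show ?thesis
    proof eventually_elim
      case (elim r)
      have "(rchart s)(0 := r) = rchart r" by (auto simp: fun_eq_iff)
      then show ?case using inv_rchart[of "rchart r" S] elim by simp
    qed
  qed
  ultimately have "((\<lambda>r. f r) has_real_derivative pd 0 ?h (rchart s)) (at s)"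
    using DERIV_cong_ev[OF refl _ refl] by fastforce
  then show ?thesis using f by (simp add: coord_vec_def)
qed

lemma coord_vec_real:
  assumes S: "open S" "s \<in> S" and f: "smooth_near (real_mfd S) s f"
  shows "coord_vec (real_mfd S) (S, rchart) s 0 f = deriv f s"
  using DERIV_imp_deriv[OF real_smooth_near_pd[OF assms]] by simp

lemma coord_vec_real_tangent: "s \<in> S \<Longrightarrow> coord_vec (real_mfd S) (S, rchart) s 0 \<in> tangent_space (real_mfd S) s"
  by (rule coord_vec_tangent) simp_all

subsection \<open>Products\<close>

text \<open>\<open>lo\<close> and \<open>hi\<close> are the projections of
  \<open>Euclidean_space (m + n)\<close> onto its two factors; \<open>lo\<close> has to fill up with
  zeros to land in the smaller space.\<close>

definition lo :: "nat \<Rightarrow> (nat \<Rightarrow> real) \<Rightarrow> nat \<Rightarrow> real" where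
  "lo m x = (\<lambda>i. if i < m then x i else 0)"

definition hi :: "nat \<Rightarrow> (nat \<Rightarrow> real) \<Rightarrow> nat \<Rightarrow> real" where
  "hi m x = (\<lambda>i. x (i + m))"

definition pchart :: "nat \<Rightarrow> ('a \<Rightarrow> nat \<Rightarrow> real) \<Rightarrow> ('b \<Rightarrow> nat \<Rightarrow> real) \<Rightarrow> 'a \<times> 'b \<Rightarrow> nat \<Rightarrow> real" where
  "pchart m \<phi> \<psi> = (\<lambda>(p, q) i. if i < m then \<phi> p i else \<psi> q (i - m))"

lemma prod_mfd_simps [simp]:
  "mtop (prod_mfd M N) = prod_topology (mtop M) (mtop N)" "mdim (prod_mfd M N) = mdim M + mdim N"
  by (simp_all add: prod_mfd_def)

lemma atlas_prod: "atlas (prod_mfd M N) =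
    {(U \<times> V, pchart (mdim M) \<phi> \<psi>) | U \<phi> V \<psi>. (U, \<phi>) \<in> atlas M \<and> (V, \<psi>) \<in> atlas N}"
  by (simp add: prod_mfd_def pchart_def)

lemma lo_topspace: "lo m x \<in> topspace (Euclidean_space m)"
  by (simp add: lo_def topspace_Euclidean_space)

lemma hi_topspace: "x \<in> topspace (Euclidean_space (m + n)) \<Longrightarrow> hi m x \<in> topspace (Euclidean_space n)"
  by (simp add: hi_def topspace_Euclidean_space)

lemma lo_pchart: "\<phi> p \<in> topspace (Euclidean_space m) \<Longrightarrow> lo m (pchart m \<phi> \<psi> (p, q)) = \<phi> p"
  by (auto simp: lo_def pchart_def topspace_Euclidean_space fun_eq_iff)

lemma hi_pchart: "hi m (pchart m \<phi> \<psi> (p, q)) = \<psi> q"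
  by (auto simp: hi_def pchart_def fun_eq_iff)

lemma pchart_topspace:
  "\<psi> q \<in> topspace (Euclidean_space n) \<Longrightarrow> pchart m \<phi> \<psi> (p, q) \<in> topspace (Euclidean_space (m + n))"
  by (auto simp: pchart_def topspace_Euclidean_space)

lemma pchart_lo_hi: "\<phi> p = lo m x \<Longrightarrow> \<psi> q = hi m x \<Longrightarrow> pchart m \<phi> \<psi> (p, q) = x"
  by (auto simp: pchart_def lo_def hi_def fun_eq_iff)

lemma continuous_map_lo: "continuous_map (Euclidean_space (m + n)) (Euclidean_space m) (lo m)"
  by (rule continuous_map_into_Euclidean[OF lo_topspace]) (simp add: lo_def continuous_map_Euclidean_coord)

lemma continuous_map_hi: "continuous_map (Euclidean_space (m + n)) (Euclidean_space n) (hi m)"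
  by (rule continuous_map_into_Euclidean[OF hi_topspace]) (simp_all add: hi_def continuous_map_Euclidean_coord)

lemma second_countable_prod:
  assumes "second_countable T" "second_countable T'"
  shows "second_countable (prod_topology T T')"
proof -
  obtain \<B> where B: "countable \<B>" "\<forall>V\<in>\<B>. openin T V" "\<forall>U x. openin T U \<and> x \<in> U \<longrightarrow> (\<exists>V\<in>\<B>. x \<in> V \<and> V \<subseteq> U)"
    using assms(1) unfolding second_countable_def by blast
  obtain \<B>' where B': "countable \<B>'" "\<forall>V\<in>\<B>'. openin T' V" "\<forall>U x. openin T' U \<and> x \<in> U \<longrightarrow> (\<exists>V\<in>\<B>'. x \<in> V \<and> V \<subseteq> U)"
    using assms(2) unfolding second_countable_def by blast
  show ?thesis unfolding second_countable_def
  proof (intro exI[of _ "(\<lambda>(V, W). V \<times> W) ` (\<B> \<times> \<B>')"] conjI allI impI)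
    show "countable ((\<lambda>(V, W). V \<times> W) ` (\<B> \<times> \<B>'))" using B(1) B'(1) by blast
    show "\<forall>V\<in>(\<lambda>(V, W). V \<times> W) ` (\<B> \<times> \<B>'). openin (prod_topology T T') V"
      using B(2) B'(2) by (auto simp: openin_prod_Times_iff)
    fix U x assume U: "openin (prod_topology T T') U \<and> x \<in> U"
    obtain a b where x: "x = (a, b)" by (cases x)
    then obtain A A' where A: "openin T A" "openin T' A'" "a \<in> A" "b \<in> A'" "A \<times> A' \<subseteq> U"
      using U unfolding openin_prod_topology_alt by blast
    obtain V where V: "V \<in> \<B>" "a \<in> V" "V \<subseteq> A" using B(3) A by blast
    obtain V' where V': "V' \<in> \<B>'" "b \<in> V'" "V' \<subseteq> A'" using B'(3) A by blast
    show "\<exists>W\<in>(\<lambda>(V, W). V \<times> W) ` (\<B> \<times> \<B>'). x \<in> W \<and> W \<subseteq> U"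
    proof (rule bexI[of _ "V \<times> V'"])
      show "V \<times> V' \<in> (\<lambda>(V, W). V \<times> W) ` (\<B> \<times> \<B>')" using V(1) V'(1) by auto
      show "x \<in> V \<times> V' \<and> V \<times> V' \<subseteq> U" using x V V' A(5) by auto
    qed
  qed
qed

lemma smooth_manifold_prod:
  assumes M: "smooth_manifold M" and N: "smooth_manifold N"
  shows "smooth_manifold (prod_mfd M N)"
proof (rule smooth_manifoldI)
  let ?m = "mdim M" and ?n = "mdim N"
  show "Hausdorff_space (mtop (prod_mfd M N))"
    using M N unfolding smooth_manifold_def by (simp add: Hausdorff_space_prod_topology)
  show "second_countable (mtop (prod_mfd M N))"
    using M N unfolding smooth_manifold_def by (simp add: second_countable_prod)
  show "\<exists>U \<phi>. (U, \<phi>) \<in> atlas (prod_mfd M N) \<and> p \<in> U" if "p \<in> points (prod_mfd M N)" for p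
  proof -
    have p: "fst p \<in> points M" "snd p \<in> points N" using that by auto
    obtain U \<phi> where c: "(U, \<phi>) \<in> atlas M" "fst p \<in> U" using chart_ex[OF M p(1)] .
    obtain V \<psi> where d: "(V, \<psi>) \<in> atlas N" "snd p \<in> V" using chart_ex[OF N p(2)] .
    show ?thesis unfolding atlas_prod using c d
      by (intro exI[of _ "U \<times> V"] exI[of _ "pchart ?m \<phi> \<psi>"]) (auto simp: mem_Times_iff)
  qed
  fix Q \<omega> assume "(Q, \<omega>) \<in> atlas (prod_mfd M N)"
  then obtain U \<phi> V \<psi> where Q: "Q = U \<times> V" "\<omega> = pchart ?m \<phi> \<psi>" and c: "(U, \<phi>) \<in> atlas M" and d: "(V, \<psi>) \<in> atlas N"
    unfolding atlas_prod by blast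
  show "openin (mtop (prod_mfd M N)) Q"
    unfolding Q using chart_open[OF M c] chart_open[OF N d] by (simp add: openin_prod_Times_iff)
  show inj: "inj_on \<omega> Q"
  proof (rule inj_onI)
    fix z w assume zw: "z \<in> Q" "w \<in> Q" "\<omega> z = \<omega> w"
    obtain a b a' b' where ab: "z = (a, b)" "w = (a', b')" by (cases z, cases w)
    then have mem: "a \<in> U" "a' \<in> U" "b \<in> V" "b' \<in> V" using zw Q by auto
    have "\<phi> a = \<phi> a'" using lo_pchart[where \<phi> = \<phi>, OF chart_topspace[OF M c mem(1)], of \<psi> b]
        lo_pchart[where \<phi> = \<phi>, OF chart_topspace[OF M c mem(2)], of \<psi> b'] zw(3) unfolding Q ab by simp
    moreover have "\<psi> b = \<psi> b'" using hi_pchart[of ?m \<phi> \<psi> a b] hi_pchart[of ?m \<phi> \<psi> a' b'] zw(3) unfolding Q ab by simp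
    ultimately show "z = w" using chart_inj[OF M c] chart_inj[OF N d] mem unfolding ab inj_on_def by blast
  qed
  have img: "\<omega> ` Q = {x \<in> topspace (Euclidean_space (?m + ?n)). lo ?m x \<in> \<phi> ` U \<and> hi ?m x \<in> \<psi> ` V}"
  proof
    show "\<omega> ` Q \<subseteq> {x \<in> topspace (Euclidean_space (?m + ?n)). lo ?m x \<in> \<phi> ` U \<and> hi ?m x \<in> \<psi> ` V}"
      unfolding Q using pchart_topspace[where \<psi> = \<psi>, OF chart_topspace[OF N d]]
      by (auto simp: hi_pchart lo_pchart[where \<phi> = \<phi>, OF chart_topspace[OF M c]])
    show "{x \<in> topspace (Euclidean_space (?m + ?n)). lo ?m x \<in> \<phi> ` U \<and> hi ?m x \<in> \<psi> ` V} \<subseteq> \<omega> ` Q"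
    proof
      fix x assume "x \<in> {x \<in> topspace (Euclidean_space (?m + ?n)). lo ?m x \<in> \<phi> ` U \<and> hi ?m x \<in> \<psi> ` V}"
      then obtain p q where "p \<in> U" "q \<in> V" "\<phi> p = lo ?m x" "\<psi> q = hi ?m x" by auto
      then show "x \<in> \<omega> ` Q" unfolding Q by (intro image_eqI[of _ _ "(p, q)"]) (simp_all add: pchart_lo_hi)
    qed
  qed
  have oplo: "openin (Euclidean_space (?m + ?n)) {x \<in> topspace (Euclidean_space (?m + ?n)). lo ?m x \<in> \<phi> ` U}"
    by (rule openin_continuous_map_preimage[OF continuous_map_lo chart_image_open[OF M c]])
  have ophi: "openin (Euclidean_space (?m + ?n)) {x \<in> topspace (Euclidean_space (?m + ?n)). hi ?m x \<in> \<psi> ` V}"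
    by (rule openin_continuous_map_preimage[OF continuous_map_hi chart_image_open[OF N d]])
  have "openin (Euclidean_space (?m + ?n)) (\<omega> ` Q)"
    unfolding img using openin_Int[OF oplo ophi] by (rule back_subst) auto
  then show op: "openin (Euclidean_space (mdim (prod_mfd M N))) (\<omega> ` Q)" by simp
  \<comment> \<open>The inverse of a product chart acts factor by factor, which reduces its
    continuity and the transition maps to the factors.\<close>
  have inv: "inv_into Q \<omega> x = (inv_into U \<phi> (lo ?m x), inv_into V \<psi> (hi ?m x))" if xQ: "x \<in> \<omega> ` Q" for x
  proof -
    obtain z where z: "z \<in> Q" "x = \<omega> z" using xQ by blast
    obtain p q where "z = (p, q)" by (cases z)
    with z Q(1) have pq: "p \<in> U" "q \<in> V" "x = \<omega> (p, q)" by auto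
    then have "inv_into Q \<omega> x = (p, q)" using inv_into_f_f[OF inj] Q(1) by auto
    then show ?thesis unfolding pq(3) Q(2) lo_pchart[where \<phi> = \<phi>, OF chart_topspace[OF M c pq(1)]] hi_pchart
      using chart_inv[OF M c pq(1)] chart_inv[OF N d pq(2)] by simp
  qed
  have sub: "topspace (subtopology (prod_topology (mtop M) (mtop N)) Q) = Q"
    using chart_subset[OF M c] chart_subset[OF N d] Q(1) by auto
  have "continuous_map (subtopology (prod_topology (mtop M) (mtop N)) Q) (Euclidean_space (?m + ?n)) \<omega>"
  proof (rule continuous_map_into_Euclidean)
    show "\<omega> z \<in> topspace (Euclidean_space (?m + ?n))" if "z \<in> topspace (subtopology (prod_topology (mtop M) (mtop N)) Q)" for z
      using that img unfolding sub by blast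
    fix k assume "k < ?m + ?n"
    have f1: "continuous_map (subtopology (prod_topology (mtop M) (mtop N)) Q) (subtopology (mtop M) U) fst"
      unfolding continuous_map_in_subtopology sub
    proof
      show "continuous_map (subtopology (prod_topology (mtop M) (mtop N)) Q) (mtop M) fst"
        by (rule continuous_map_from_subtopology[OF continuous_map_fst])
    qed (auto simp: Q(1))
    have f2: "continuous_map (subtopology (prod_topology (mtop M) (mtop N)) Q) (subtopology (mtop N) V) snd"
      unfolding continuous_map_in_subtopology sub
    proof
      show "continuous_map (subtopology (prod_topology (mtop M) (mtop N)) Q) (mtop N) snd"
        by (rule continuous_map_from_subtopology[OF continuous_map_snd])
    qed (auto simp: Q(1))
    show "continuous_map (subtopology (prod_topology (mtop M) (mtop N)) Q) euclideanreal (\<lambda>z. \<omega> z k)"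
      using continuous_map_compose[OF f1 chart_coord_continuous[OF M c, of k]]
        continuous_map_compose[OF f2 chart_coord_continuous[OF N d, of "k - ?m"]]
      unfolding Q(2) pchart_def by (cases "k < ?m") (simp_all add: o_def case_prod_beta)
  qed
  then show "continuous_map (subtopology (mtop (prod_mfd M N)) Q) (Euclidean_space (mdim (prod_mfd M N))) \<omega>" by simp
  let ?T = "subtopology (Euclidean_space (?m + ?n)) (\<omega> ` Q)"
  have topT: "topspace ?T = \<omega> ` Q" using openin_subset[OF op] by auto
  have "continuous_map ?T (prod_topology (mtop M) (mtop N)) (inv_into Q \<omega>)"
  proof (rule continuous_map_eq)
    have "continuous_map ?T (subtopology (Euclidean_space ?m) (\<phi> ` U)) (lo ?m)"
      unfolding continuous_map_in_subtopology topT
      using img continuous_map_from_subtopology[OF continuous_map_lo] by auto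
    from continuous_map_compose[OF this chart_inv_continuous[OF M c]]
    have 1: "continuous_map ?T (mtop M) (\<lambda>x. inv_into U \<phi> (lo ?m x))" by (simp add: o_def)
    have "continuous_map ?T (subtopology (Euclidean_space ?n) (\<psi> ` V)) (hi ?m)"
      unfolding continuous_map_in_subtopology topT
      using img continuous_map_from_subtopology[OF continuous_map_hi] by auto
    from continuous_map_compose[OF this chart_inv_continuous[OF N d]]
    have 2: "continuous_map ?T (mtop N) (\<lambda>x. inv_into V \<psi> (hi ?m x))" by (simp add: o_def)
    show "continuous_map ?T (prod_topology (mtop M) (mtop N)) (\<lambda>x. (inv_into U \<phi> (lo ?m x), inv_into V \<psi> (hi ?m x)))"
      by (rule continuous_map_pairedI[OF 1 2])
  qed (simp add: inv topT del: topspace_subtopology)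
  then show "continuous_map (subtopology (Euclidean_space (mdim (prod_mfd M N))) (\<omega> ` Q)) (mtop (prod_mfd M N)) (inv_into Q \<omega>)"
    by simp
  fix Q' \<omega>' k z assume "(Q', \<omega>') \<in> atlas (prod_mfd M N)" and k: "k < mdim (prod_mfd M N)" and z: "z \<in> Q" "z \<in> Q'"
  then obtain U' \<phi>' V' \<psi>' where Q': "Q' = U' \<times> V'" "\<omega>' = pchart ?m \<phi>' \<psi>'" and c': "(U', \<phi>') \<in> atlas M" and d': "(V', \<psi>') \<in> atlas N"
    unfolding atlas_prod by blast
  obtain p q where pq: "z = (p, q)" "p \<in> U" "q \<in> V" "p \<in> U'" "q \<in> V'" using z Q Q' by auto
  have lz: "lo ?m (\<omega> z) = \<phi> p" unfolding Q pq(1) by (rule lo_pchart[where \<phi> = \<phi>, OF chart_topspace[OF M c pq(2)]])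
  have hz: "hi ?m (\<omega> z) = \<psi> q" unfolding Q pq(1) by (rule hi_pchart)
  have zQ: "\<omega> z \<in> \<omega> ` Q" using z by blast
  have zE: "\<omega> z \<in> topspace (Euclidean_space (?m + ?n))" using zQ openin_subset[OF op] by auto
  have "smooth_at (?m + ?n) (\<omega> z) (\<lambda>x. if k < ?m then \<phi>' (inv_into U \<phi> (lo ?m x)) k else \<psi>' (inv_into V \<psi> (hi ?m x)) (k - ?m))"
  proof (cases "k < ?m")
    case True
    have "smooth_at (?m + ?n) (\<omega> z) (\<lambda>x. \<phi>' (inv_into U \<phi> (lo ?m x)) k)"
    proof (rule smooth_at_compose[where Y = "lo ?m" and m = ?m])
      have "smooth_near M p (\<lambda>q. \<phi>' q k)" by (rule smooth_near_coord[OF M c' pq(4)])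
      then show "smooth_at ?m (lo ?m (\<omega> z)) (\<lambda>x. \<phi>' (inv_into U \<phi> x) k)"
        unfolding lz smooth_near_iff[OF M c pq(2)] .
      show "smooth_at (?m + ?n) (\<omega> z) (\<lambda>x. lo ?m x j)" if "j < ?m" for j
        using smooth_at_coord[OF zE, of j] that by (simp add: lo_def)
      show "lo ?m y \<in> topspace (Euclidean_space ?m)" for y by (rule lo_topspace)
    qed (use op zQ in auto)
    then show ?thesis using True by simp
  next
    case False
    have "smooth_at (?m + ?n) (\<omega> z) (\<lambda>x. \<psi>' (inv_into V \<psi> (hi ?m x)) (k - ?m))"
    proof (rule smooth_at_compose[where Y = "hi ?m" and m = ?n])
      have "smooth_near N q (\<lambda>q. \<psi>' q (k - ?m))" by (rule smooth_near_coord[OF N d' pq(5)])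
      then show "smooth_at ?n (hi ?m (\<omega> z)) (\<lambda>x. \<psi>' (inv_into V \<psi> x) (k - ?m))"
        unfolding hz smooth_near_iff[OF N d pq(3)] .
      show "smooth_at (?m + ?n) (\<omega> z) (\<lambda>x. hi ?m x j)" if "j < ?n" for j
        using smooth_at_coord[OF zE, of "j + ?m"] by (simp add: hi_def)
      show "hi ?m y \<in> topspace (Euclidean_space ?n)" if "y \<in> \<omega> ` Q" for y
        using that openin_subset[OF op] by (intro hi_topspace) auto
    qed (use op zQ in auto)
    then show ?thesis using False by simp
  qed
  then have "smooth_at (?m + ?n) (\<omega> z) (\<lambda>x. \<omega>' (inv_into Q \<omega> x) k)"
  proof (rule smooth_at_cong)
    show "openin (Euclidean_space (?m + ?n)) (\<omega> ` Q)" using op by simp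
  qed (use zQ inv in \<open>auto simp: Q'(2) pchart_def\<close>)
  then show "smooth_at (mdim (prod_mfd M N)) (\<omega> z) (\<lambda>x. \<omega>' (inv_into Q \<omega> x) k)" by simp
qed

lemma prod_chart:
  "(U, \<phi>) \<in> atlas M \<Longrightarrow> (V, \<psi>) \<in> atlas N \<Longrightarrow> (U \<times> V, pchart (mdim M) \<phi> \<psi>) \<in> atlas (prod_mfd M N)"
  unfolding atlas_prod by blast

lemma smooth_map_fst:
  assumes M: "smooth_manifold M" and N: "smooth_manifold N"
  shows "smooth_map (prod_mfd M N) M fst"
proof (rule smooth_mapI[OF smooth_manifold_prod[OF M N] M])
  show "continuous_map (mtop (prod_mfd M N)) (mtop M) fst" by (simp add: continuous_map_fst)
  fix z assume z: "z \<in> points (prod_mfd M N)"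
  obtain p q where pq: "z = (p, q)" "p \<in> points M" "q \<in> points N" using z by auto
  obtain U \<phi> where c: "(U, \<phi>) \<in> atlas M" "p \<in> U" using chart_ex[OF M pq(2)] .
  obtain V \<psi> where d: "(V, \<psi>) \<in> atlas N" "q \<in> V" using chart_ex[OF N pq(3)] .
  note pc = prod_chart[OF c(1) d(1)]
  have zUV: "z \<in> U \<times> V" using pq c d by simp
  have "smooth_near (prod_mfd M N) z (\<lambda>w. \<phi> (fst w) k)" if "k < mdim M" for k
    by (rule smooth_near_cong[OF smooth_manifold_prod[OF M N] smooth_near_coord[OF smooth_manifold_prod[OF M N] pc zUV, of k]
          chart_open[OF smooth_manifold_prod[OF M N] pc] zUV])
      (use that in \<open>auto simp: pchart_def\<close>)
  then show "\<exists>V \<psi>. (V, \<psi>) \<in> atlas M \<and> fst z \<in> V \<and> (\<forall>k<mdim M. smooth_near (prod_mfd M N) z (\<lambda>q. \<psi> (fst q) k))"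
    using c pq(1) by auto
qed

lemma smooth_map_snd:
  assumes M: "smooth_manifold M" and N: "smooth_manifold N"
  shows "smooth_map (prod_mfd M N) N snd"
proof (rule smooth_mapI[OF smooth_manifold_prod[OF M N] N])
  show "continuous_map (mtop (prod_mfd M N)) (mtop N) snd" by (simp add: continuous_map_snd)
  fix z assume z: "z \<in> points (prod_mfd M N)"
  obtain p q where pq: "z = (p, q)" "p \<in> points M" "q \<in> points N" using z by auto
  obtain U \<phi> where c: "(U, \<phi>) \<in> atlas M" "p \<in> U" using chart_ex[OF M pq(2)] .
  obtain V \<psi> where d: "(V, \<psi>) \<in> atlas N" "q \<in> V" using chart_ex[OF N pq(3)] .
  note pc = prod_chart[OF c(1) d(1)]
  have zUV: "z \<in> U \<times> V" using pq c d by simp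
  have "smooth_near (prod_mfd M N) z (\<lambda>w. \<psi> (snd w) k)" if "k < mdim N" for k
    by (rule smooth_near_cong[OF smooth_manifold_prod[OF M N] smooth_near_coord[OF smooth_manifold_prod[OF M N] pc zUV, of "k + mdim M"]
          chart_open[OF smooth_manifold_prod[OF M N] pc] zUV])
      (use that in \<open>auto simp: pchart_def\<close>)
  then show "\<exists>V \<psi>. (V, \<psi>) \<in> atlas N \<and> snd z \<in> V \<and> (\<forall>k<mdim N. smooth_near (prod_mfd M N) z (\<lambda>q. \<psi> (snd q) k))"
    using d pq(1) by auto
qed

lemma smooth_map_pair:
  assumes P: "smooth_manifold P" and M: "smooth_manifold M" and N: "smooth_manifold N"
    and F: "smooth_map P M F" and G: "smooth_map P N G"
  shows "smooth_map P (prod_mfd M N) (\<lambda>z. (F z, G z))"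
proof (rule smooth_mapI[OF P smooth_manifold_prod[OF M N]])
  show "continuous_map (mtop P) (mtop (prod_mfd M N)) (\<lambda>z. (F z, G z))"
    using continuous_map_pairedI[OF smooth_map_continuous[OF F] smooth_map_continuous[OF G]] by simp
  fix z assume z: "z \<in> points P"
  obtain U \<phi> where c: "(U, \<phi>) \<in> atlas M" "F z \<in> U" using chart_ex[OF M smooth_map_in[OF F z]] .
  obtain V \<psi> where d: "(V, \<psi>) \<in> atlas N" "G z \<in> V" using chart_ex[OF N smooth_map_in[OF G z]] .
  have "smooth_near P z (\<lambda>w. pchart (mdim M) \<phi> \<psi> (F w, G w) k)" if "k < mdim M + mdim N" for k
    using smooth_mapD[OF P M F z c, of k] smooth_mapD[OF P N G z d, of "k - mdim M"] that
    by (cases "k < mdim M") (simp_all add: pchart_def)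
  then show "\<exists>W \<omega>. (W, \<omega>) \<in> atlas (prod_mfd M N) \<and> (F z, G z) \<in> W \<and>
      (\<forall>k<mdim (prod_mfd M N). smooth_near P z (\<lambda>w. \<omega> (F w, G w) k))"
    using prod_chart[OF c(1) d(1)] c(2) d(2) by (intro exI[of _ "U \<times> V"] exI[of _ "pchart (mdim M) \<phi> \<psi>"]) auto
qed

subsection \<open>Forms\<close>

text \<open>A constant function factors through the space of dimension 0, for which the sum in the
  chain rule is empty.\<close>

lemma tangent_const:
  assumes M: "smooth_manifold M" and v: "v \<in> tangent_space M p"
  shows "v (\<lambda>q. a) = 0"
  using tangent_compose[OF M v, where Y = "\<lambda>q i. 0" and G = "\<lambda>x. a" and m = 0 and W = "points M"] tangent_point[OF M v]
  by (simp add: topspace_Euclidean_space)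

text \<open>Turns the conditions on coefficients in the definitions of forms and metrics, stated on
  chart images, into smoothness of functions on the manifold.\<close>

lemma smooth_fn_chart_iff:
  assumes M: "smooth_manifold M" and c: "(U, \<phi>) \<in> atlas M"
  shows "smooth_fn (mdim M) (\<phi> ` U) (\<lambda>x. h (inv_into U \<phi> x)) \<longleftrightarrow> (\<forall>p\<in>U. smooth_near M p h)"
proof
  assume L: "smooth_fn (mdim M) (\<phi> ` U) (\<lambda>x. h (inv_into U \<phi> x))"
  show "\<forall>p\<in>U. smooth_near M p h"
  proof
    fix p assume p: "p \<in> U"
    show "smooth_near M p h" unfolding smooth_near_iff[OF M c p]
      by (rule smooth_fn_imp_at[OF chart_image_open[OF M c] L]) (use p in blast)
  qed
next
  assume R: "\<forall>p\<in>U. smooth_near M p h"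
  show "smooth_fn (mdim M) (\<phi> ` U) (\<lambda>x. h (inv_into U \<phi> x))"
  proof (rule smooth_fnI_at[OF chart_image_open[OF M c]])
    fix x assume "x \<in> \<phi> ` U"
    then obtain p where p: "p \<in> U" "x = \<phi> p" by blast
    then show "smooth_at (mdim M) x (\<lambda>x. h (inv_into U \<phi> x))"
      using R smooth_near_iff[OF M c p(1)] by blast
  qed
qed

lemma coord_vec_smooth:
  assumes M: "smooth_manifold M" and c: "(U, \<phi>) \<in> atlas M" "p \<in> U" and i: "i < mdim M" and f: "smooth_near M p f"
  shows "smooth_near M p (\<lambda>q. coord_vec M (U, \<phi>) q i f)"
proof -
  let ?h = "\<lambda>x. f (inv_into U \<phi> x)"
  obtain W where W: "openin (mtop M) W" "p \<in> W" "\<forall>q\<in>W. smooth_near M q f" using smooth_near_nbhd[OF f] by blast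
  have "smooth_at (mdim M) (\<phi> p) (pd i ?h)"
    using f i unfolding smooth_near_iff[OF M c] by (rule smooth_at_pd)
  then have "smooth_at (mdim M) (\<phi> p) (\<lambda>x. pd i ?h (\<phi> (inv_into U \<phi> x)))"
    by (rule smooth_at_cong[OF _ chart_image_open[OF M c(1)]]) (use c(2) chart_inv[OF M c(1)] in auto)
  then have "smooth_near M p (\<lambda>q. pd i ?h (\<phi> q))" unfolding smooth_near_iff[OF M c] .
  then show ?thesis
    by (rule smooth_near_cong[OF M _ W(1,2)]) (use W(3) in \<open>simp add: coord_vec_def\<close>)
qed

lemma smooth_one_form_iff:
  assumes M: "smooth_manifold M"
  shows "smooth_one_form M \<theta> \<longleftrightarrow> (\<forall>p\<in>points M. linear_form (tangent_space M p) (\<theta> p)) \<and>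
    (\<forall>U \<phi>. (U, \<phi>) \<in> atlas M \<longrightarrow> (\<forall>i<mdim M. \<forall>p\<in>U. smooth_near M p (\<lambda>q. \<theta> q (coord_vec M (U, \<phi>) q i))))"
proof -
  have "smooth_fn (mdim M) (\<phi> ` U) (\<lambda>x. \<theta> (inv_into U \<phi> x) (coord_vec M (U, \<phi>) (inv_into U \<phi> x) i)) \<longleftrightarrow>
      (\<forall>p\<in>U. smooth_near M p (\<lambda>q. \<theta> q (coord_vec M (U, \<phi>) q i)))" if "(U, \<phi>) \<in> atlas M" for U \<phi> i
    by (rule smooth_fn_chart_iff[OF M that])
  then show ?thesis unfolding smooth_one_form_def by (simp add: Let_def split_paired_Ball_Sigma Ball_def)
qed

lemma smooth_symmetric_form_iff:
  assumes M: "smooth_manifold M"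
  shows "smooth_symmetric_form M g \<longleftrightarrow>
    (\<forall>p\<in>points M. \<forall>u\<in>tangent_space M p.
        linear_form (tangent_space M p) (g p u) \<and> (\<forall>v\<in>tangent_space M p. g p u v = g p v u)) \<and>
    (\<forall>U \<phi>. (U, \<phi>) \<in> atlas M \<longrightarrow> (\<forall>i<mdim M. \<forall>j<mdim M. \<forall>p\<in>U.
        smooth_near M p (\<lambda>q. g q (coord_vec M (U, \<phi>) q i) (coord_vec M (U, \<phi>) q j))))"
proof -
  have "smooth_fn (mdim M) (\<phi> ` U) (\<lambda>x. g (inv_into U \<phi> x) (coord_vec M (U, \<phi>) (inv_into U \<phi> x) i)
        (coord_vec M (U, \<phi>) (inv_into U \<phi> x) j)) \<longleftrightarrow>
      (\<forall>p\<in>U. smooth_near M p (\<lambda>q. g q (coord_vec M (U, \<phi>) q i) (coord_vec M (U, \<phi>) q j)))"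
    if "(U, \<phi>) \<in> atlas M" for U \<phi> i j
    by (rule smooth_fn_chart_iff[OF M that])
  then show ?thesis unfolding smooth_symmetric_form_def metric_coeff_def
    by (simp add: Let_def split_paired_Ball_Sigma Ball_def)
qed

lemma one_form_linear: "smooth_one_form M \<theta> \<Longrightarrow> p \<in> points M \<Longrightarrow> linear_form (tangent_space M p) (\<theta> p)"
  unfolding smooth_one_form_def by blast

lemma sym_form_linear:
  "smooth_symmetric_form M g \<Longrightarrow> p \<in> points M \<Longrightarrow> u \<in> tangent_space M p \<Longrightarrow> linear_form (tangent_space M p) (g p u)"
  unfolding smooth_symmetric_form_def by blast

lemma sym_form_sym:
  "smooth_symmetric_form M g \<Longrightarrow> p \<in> points M \<Longrightarrow> u \<in> tangent_space M p \<Longrightarrow> v \<in> tangent_space M p \<Longrightarrow> g p u v = g p v u"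
  unfolding smooth_symmetric_form_def by blast

lemma sym_form_linear1:
  assumes M: "smooth_manifold M" and g: "smooth_symmetric_form M g" and p: "p \<in> points M" and v: "v \<in> tangent_space M p"
  shows "linear_form (tangent_space M p) (\<lambda>u. g p u v)"
  unfolding linear_form_def
proof (intro ballI allI)
  fix u w a b assume uw: "u \<in> tangent_space M p" "w \<in> tangent_space M p"
  have "g p (\<lambda>f. a * u f + b * w f) v = g p v (\<lambda>f. a * u f + b * w f)"
    by (rule sym_form_sym[OF g p tangent_lincomb[OF M uw] v])
  also have "\<dots> = a * g p v u + b * g p v w" by (rule linear_form_lincomb[OF sym_form_linear[OF g p v] uw])
  finally show "g p (\<lambda>f. a * u f + b * w f) v = a * g p u v + b * g p w v"
    using sym_form_sym[OF g p v] uw by simp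
qed

lemma linear_form_coords:
  assumes M: "smooth_manifold M" and \<omega>: "linear_form (tangent_space M p) \<omega>"
    and c: "(U, \<phi>) \<in> atlas M" "p \<in> U" and v: "v \<in> tangent_space M p"
  shows "\<omega> v = (\<Sum>k<mdim M. v (\<lambda>q. \<phi> q k) * \<omega> (coord_vec M (U, \<phi>) p k))"
proof -
  have "\<omega> v = \<omega> (\<lambda>f. \<Sum>i<mdim M. v (\<lambda>q. \<phi> q i) * coord_vec M (U, \<phi>) p i f)"
    by (rule arg_cong[where f = \<omega>, OF tangent_coords[OF M v c]])
  also have "\<dots> = (\<Sum>k<mdim M. v (\<lambda>q. \<phi> q k) * \<omega> (coord_vec M (U, \<phi>) p k))"
    by (rule linear_form_sum[OF M tangent_point[OF M v] \<omega>]) (use coord_vec_tangent[OF c] in simp)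
  finally show ?thesis .
qed

text \<open>Y is a vector field along the map F. In a chart of the target, its value under \<theta>
  is a finite sum of components of Y times coefficients of \<theta> composed with F, all of them
  smooth near p.\<close>

lemma one_form_along:
  assumes M: "smooth_manifold M" and N: "smooth_manifold N" and F: "smooth_map M N F" and \<theta>: "smooth_one_form N \<theta>"
    and W: "openin (mtop M) W" "p \<in> W" and d: "(V, \<psi>) \<in> atlas N" "F p \<in> V"
    and Y: "\<And>q. q \<in> W \<Longrightarrow> Y q \<in> tangent_space N (F q)"
    and Yk: "\<And>k. k < mdim N \<Longrightarrow> smooth_near M p (\<lambda>q. Y q (\<lambda>r. \<psi> r k))"
  shows "smooth_near M p (\<lambda>q. \<theta> (F q) (Y q))"
proof -
  have p: "p \<in> points M" using W openin_subset by blast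
  let ?W = "W \<inter> {q \<in> points M. F q \<in> V}"
  have W': "openin (mtop M) ?W" "p \<in> ?W"
    using W p d(2) open_preimage[OF smooth_map_continuous[OF F] chart_open[OF N d(1)]] by auto
  have "smooth_near M p (\<lambda>q. \<Sum>k<mdim N. Y q (\<lambda>r. \<psi> r k) * \<theta> (F q) (coord_vec N (V, \<psi>) (F q) k))"
  proof (rule smooth_near_sum[OF M p], rule smooth_near_mult[OF M])
    fix k assume k: "k \<in> {..<mdim N}"
    show "smooth_near M p (\<lambda>q. Y q (\<lambda>r. \<psi> r k))" using Yk k by simp
    show "smooth_near M p (\<lambda>q. \<theta> (F q) (coord_vec N (V, \<psi>) (F q) k))"
      by (rule smooth_near_pull[OF M N F p, where f = "\<lambda>r. \<theta> r (coord_vec N (V, \<psi>) r k)"])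
        (use \<theta> k d in \<open>simp add: smooth_one_form_iff[OF N]\<close>)
  qed
  then show ?thesis
  proof (rule smooth_near_cong[OF M _ W'])
    fix q assume q: "q \<in> ?W"
    show "(\<Sum>k<mdim N. Y q (\<lambda>r. \<psi> r k) * \<theta> (F q) (coord_vec N (V, \<psi>) (F q) k)) = \<theta> (F q) (Y q)"
      by (rule linear_form_coords[OF N one_form_linear[OF \<theta>] d(1), symmetric])
        (use q Y smooth_map_in[OF F] in auto)
  qed
qed

text \<open>The same expansion in two arguments. Taken along the differential of F it gives
  pulled-back metrics; taken along the identity it gives functions such as g(\<xi>,\<xi>).\<close>

lemma sym_form_along:
  assumes M: "smooth_manifold M" and N: "smooth_manifold N" and F: "smooth_map M N F" and g: "smooth_symmetric_form N g"
    and W: "openin (mtop M) W" "p \<in> W" and d: "(V, \<psi>) \<in> atlas N" "F p \<in> V"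
    and Y: "\<And>q. q \<in> W \<Longrightarrow> Y q \<in> tangent_space N (F q)" "\<And>q. q \<in> W \<Longrightarrow> Z q \<in> tangent_space N (F q)"
    and Yk: "\<And>k. k < mdim N \<Longrightarrow> smooth_near M p (\<lambda>q. Y q (\<lambda>r. \<psi> r k))"
      "\<And>k. k < mdim N \<Longrightarrow> smooth_near M p (\<lambda>q. Z q (\<lambda>r. \<psi> r k))"
  shows "smooth_near M p (\<lambda>q. g (F q) (Y q) (Z q))"
proof -
  have p: "p \<in> points M" using W openin_subset by blast
  let ?W = "W \<inter> {q \<in> points M. F q \<in> V}"
  have W': "openin (mtop M) ?W" "p \<in> ?W"
    using W p d(2) open_preimage[OF smooth_map_continuous[OF F] chart_open[OF N d(1)]] by auto
  let ?e = "coord_vec N (V, \<psi>)"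
  have "smooth_near M p (\<lambda>q. \<Sum>k<mdim N. Y q (\<lambda>r. \<psi> r k) *
      (\<Sum>l<mdim N. Z q (\<lambda>r. \<psi> r l) * g (F q) (?e (F q) k) (?e (F q) l)))"
  proof (rule smooth_near_sum[OF M p], rule smooth_near_mult[OF M])
    fix k assume k: "k \<in> {..<mdim N}"
    show "smooth_near M p (\<lambda>q. Y q (\<lambda>r. \<psi> r k))" using Yk k by simp
    show "smooth_near M p (\<lambda>q. \<Sum>l<mdim N. Z q (\<lambda>r. \<psi> r l) * g (F q) (?e (F q) k) (?e (F q) l))"
    proof (rule smooth_near_sum[OF M p], rule smooth_near_mult[OF M])
      fix l assume l: "l \<in> {..<mdim N}"
      show "smooth_near M p (\<lambda>q. Z q (\<lambda>r. \<psi> r l))" using Yk l by simp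
      show "smooth_near M p (\<lambda>q. g (F q) (?e (F q) k) (?e (F q) l))"
        by (rule smooth_near_pull[OF M N F p, where f = "\<lambda>r. g r (?e r k) (?e r l)"])
          (use g k l d in \<open>simp add: smooth_symmetric_form_iff[OF N]\<close>)
    qed
  qed
  then show ?thesis
  proof (rule smooth_near_cong[OF M _ W'])
    fix q assume q: "q \<in> ?W"
    have Fq: "F q \<in> points N" "F q \<in> V" using q smooth_map_in[OF F] by auto
    have "g (F q) (Y q) (Z q) = (\<Sum>k<mdim N. Y q (\<lambda>r. \<psi> r k) * g (F q) (?e (F q) k) (Z q))"
      by (rule linear_form_coords[OF N sym_form_linear1[OF N g Fq(1)] d(1)]) (use q Y in auto)
    also have "\<dots> = (\<Sum>k<mdim N. Y q (\<lambda>r. \<psi> r k) *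
      (\<Sum>l<mdim N. Z q (\<lambda>r. \<psi> r l) * g (F q) (?e (F q) k) (?e (F q) l)))"
    proof (rule sum.cong[OF refl])
      fix k assume k: "k \<in> {..<mdim N}"
      have "g (F q) (?e (F q) k) (Z q) = (\<Sum>l<mdim N. Z q (\<lambda>r. \<psi> r l) * g (F q) (?e (F q) k) (?e (F q) l))"
        by (rule linear_form_coords[OF N sym_form_linear[OF g Fq(1)] d(1)])
          (use q Y k Fq coord_vec_tangent[OF d(1) Fq(2)] in auto)
      then show "Y q (\<lambda>r. \<psi> r k) * g (F q) (?e (F q) k) (Z q) = Y q (\<lambda>r. \<psi> r k) *
          (\<Sum>l<mdim N. Z q (\<lambda>r. \<psi> r l) * g (F q) (?e (F q) k) (?e (F q) l))" by simp
    qed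
    finally show "(\<Sum>k<mdim N. Y q (\<lambda>r. \<psi> r k) *
      (\<Sum>l<mdim N. Z q (\<lambda>r. \<psi> r l) * g (F q) (?e (F q) k) (?e (F q) l))) = g (F q) (Y q) (Z q)" by (rule sym)
  qed
qed

lemma pushforward_coord_smooth:
  assumes M: "smooth_manifold M" and N: "smooth_manifold N" and F: "smooth_map M N F"
    and c: "(U, \<phi>) \<in> atlas M" "p \<in> U" and i: "i < mdim M" and d: "(V, \<psi>) \<in> atlas N" "F p \<in> V" and k: "k < mdim N"
  shows "smooth_near M p (\<lambda>q. pushforward N F q (coord_vec M (U, \<phi>) q i) (\<lambda>r. \<psi> r k))"
proof -
  have p: "p \<in> points M" using c chart_subset[OF M] by blast
  let ?W = "{q \<in> points M. F q \<in> V}"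
  have W: "openin (mtop M) ?W" "p \<in> ?W"
    using p d(2) open_preimage[OF smooth_map_continuous[OF F] chart_open[OF N d(1)]] by auto
  have "smooth_near M p (\<lambda>q. coord_vec M (U, \<phi>) q i (\<lambda>r. \<psi> (F r) k))"
    by (rule coord_vec_smooth[OF M c i smooth_mapD[OF M N F p d k]])
  then show ?thesis
    by (rule smooth_near_cong[OF M _ W]) (use smooth_near_coord[OF N d(1)] in \<open>simp add: pushforward_def\<close>)
qed

lemma pull_one_form_coeff:
  assumes M: "smooth_manifold M" and N: "smooth_manifold N" and F: "smooth_map M N F" and \<theta>: "smooth_one_form N \<theta>"
    and c: "(U, \<phi>) \<in> atlas M" "p \<in> U" and i: "i < mdim M"
  shows "smooth_near M p (\<lambda>q. \<theta> (F q) (pushforward N F q (coord_vec M (U, \<phi>) q i)))"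
proof -
  have p: "p \<in> points M" using c chart_subset[OF M] by blast
  obtain V \<psi> where d: "(V, \<psi>) \<in> atlas N" "F p \<in> V" using chart_ex[OF N smooth_map_in[OF F p]] .
  show ?thesis
  proof (rule one_form_along[OF M N F \<theta> chart_open[OF M c(1)] c(2) d,
        where Y = "\<lambda>q. pushforward N F q (coord_vec M (U, \<phi>) q i)"])
    show "pushforward N F q (coord_vec M (U, \<phi>) q i) \<in> tangent_space N (F q)" if "q \<in> U" for q
      by (rule pushforward_tangent[OF M N F coord_vec_tangent[OF c(1) that i]])
  qed (rule pushforward_coord_smooth[OF M N F c i d])
qed

lemma pull_sym_form_coeff:
  assumes M: "smooth_manifold M" and N: "smooth_manifold N" and F: "smooth_map M N F" and g: "smooth_symmetric_form N g"
    and c: "(U, \<phi>) \<in> atlas M" "p \<in> U" and i: "i < mdim M" and j: "j < mdim M"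
  shows "smooth_near M p (\<lambda>q. g (F q) (pushforward N F q (coord_vec M (U, \<phi>) q i)) (pushforward N F q (coord_vec M (U, \<phi>) q j)))"
proof -
  have p: "p \<in> points M" using c chart_subset[OF M] by blast
  obtain V \<psi> where d: "(V, \<psi>) \<in> atlas N" "F p \<in> V" using chart_ex[OF N smooth_map_in[OF F p]] .
  have T: "pushforward N F q (coord_vec M (U, \<phi>) q i) \<in> tangent_space N (F q)" if "q \<in> U" "i < mdim M" for q i
    by (rule pushforward_tangent[OF M N F coord_vec_tangent[OF c(1) that]])
  show ?thesis
    by (rule sym_form_along[OF M N F g chart_open[OF M c(1)] c(2) d,
          where Y = "\<lambda>q. pushforward N F q (coord_vec M (U, \<phi>) q i)" and Z = "\<lambda>q. pushforward N F q (coord_vec M (U, \<phi>) q j)"])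
      (rule T[OF _ i] T[OF _ j] pushforward_coord_smooth[OF M N F c i d] pushforward_coord_smooth[OF M N F c j d]; assumption)+
qed

lemma linear_form_pull:
  assumes M: "smooth_manifold M" and N: "smooth_manifold N" and F: "smooth_map M N F"
    and \<omega>: "linear_form (tangent_space N (F p)) \<omega>"
  shows "linear_form (tangent_space M p) (\<lambda>u. \<omega> (pushforward N F p u))"
  unfolding linear_form_def
proof (intro ballI allI)
  fix u v a b assume uv: "u \<in> tangent_space M p" "v \<in> tangent_space M p"
  show "\<omega> (pushforward N F p (\<lambda>f. a * u f + b * v f)) = a * \<omega> (pushforward N F p u) + b * \<omega> (pushforward N F p v)"
    unfolding pushforward_lincomb
    by (rule linear_form_lincomb[OF \<omega> pushforward_tangent[OF M N F uv(1)] pushforward_tangent[OF M N F uv(2)]])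
qed

lemma pull_one_form:
  assumes M: "smooth_manifold M" and N: "smooth_manifold N" and F: "smooth_map M N F" and \<theta>: "smooth_one_form N \<theta>"
  shows "smooth_one_form M (\<lambda>p u. \<theta> (F p) (pushforward N F p u))"
  unfolding smooth_one_form_iff[OF M]
proof (intro conjI ballI allI impI)
  show "linear_form (tangent_space M p) (\<lambda>u. \<theta> (F p) (pushforward N F p u))" if "p \<in> points M" for p
    by (rule linear_form_pull[OF M N F one_form_linear[OF \<theta> smooth_map_in[OF F that]]])
qed (rule pull_one_form_coeff[OF M N F \<theta>])

lemma pull_sym_form:
  assumes M: "smooth_manifold M" and N: "smooth_manifold N" and F: "smooth_map M N F" and g: "smooth_symmetric_form N g"
  shows "smooth_symmetric_form M (\<lambda>p u v. g (F p) (pushforward N F p u) (pushforward N F p v))"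
  unfolding smooth_symmetric_form_iff[OF M]
proof (intro conjI ballI allI impI)
  fix p u assume p: "p \<in> points M" and u: "u \<in> tangent_space M p"
  note pu = pushforward_tangent[OF M N F u]
  show "linear_form (tangent_space M p) (\<lambda>v. g (F p) (pushforward N F p u) (pushforward N F p v))"
    by (rule linear_form_pull[OF M N F sym_form_linear[OF g smooth_map_in[OF F p] pu]])
  fix v assume v: "v \<in> tangent_space M p"
  show "g (F p) (pushforward N F p u) (pushforward N F p v) = g (F p) (pushforward N F p v) (pushforward N F p u)"
    by (rule sym_form_sym[OF g smooth_map_in[OF F p] pu pushforward_tangent[OF M N F v]])
qed (rule pull_sym_form_coeff[OF M N F g])

subsection \<open>Linear equations and the dual vector of a form\<close>

text \<open>Gaussian elimination: a zero row imposes no condition, and any other row is solved for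
  one unknown, which leaves fewer equations and fewer unknowns by one each.\<close>

lemma homogeneous_system_nontrivial:
  fixes A :: "nat \<Rightarrow> 'b \<Rightarrow> real"
  assumes "finite J" "m < card J"
  shows "\<exists>x. (\<exists>j\<in>J. x j \<noteq> 0) \<and> (\<forall>i<m. (\<Sum>j\<in>J. A i j * x j) = 0)"
  using assms
proof (induction m arbitrary: J A)
  case 0
  then have "J \<noteq> {}" by auto
  then show ?case by (intro exI[of _ "\<lambda>_. 1"]) auto
next
  case (Suc m)
  show ?case
  proof (cases "\<forall>j\<in>J. A m j = 0")
    case True
    obtain x where x: "\<exists>j\<in>J. x j \<noteq> 0" "\<forall>i<m. (\<Sum>j\<in>J. A i j * x j) = 0"
      using Suc.IH[of J A] Suc.prems by auto
    have "(\<Sum>j\<in>J. A i j * x j) = 0" if "i < Suc m" for i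
    proof (cases "i = m")
      case True
      then show ?thesis using \<open>\<forall>j\<in>J. A m j = 0\<close> by (auto intro: sum.neutral)
    next
      case False then show ?thesis using that x(2) by simp
    qed
    then show ?thesis using x(1) by blast
  next
    case False
    then obtain k where k: "k \<in> J" "A m k \<noteq> 0" by blast
    \<comment> \<open>From row i the multiple of row m is subtracted that clears column k.\<close>
    define B where "B i j = A i j - A i k * A m j / A m k" for i j
    have "m < card (J - {k})" using Suc.prems k(1) by simp
    then obtain x where x: "\<exists>j\<in>J - {k}. x j \<noteq> 0" "\<forall>i<m. (\<Sum>j\<in>J - {k}. B i j * x j) = 0"
      using Suc.IH[of "J - {k}" B] Suc.prems(1) by auto
    \<comment> \<open>The value at k is the one that solves equation m.\<close>
    define y where "y = x(k := - (\<Sum>j\<in>J - {k}. A m j * x j) / A m k)"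
    have split: "(\<Sum>j\<in>J. A i j * y j) = (\<Sum>j\<in>J - {k}. A i j * x j) + A i k * y k" for i
    proof -
      have "(\<Sum>j\<in>J. A i j * y j) = A i k * y k + (\<Sum>j\<in>J - {k}. A i j * y j)"
        by (rule sum.remove[OF Suc.prems(1) k(1)])
      moreover have "(\<Sum>j\<in>J - {k}. A i j * y j) = (\<Sum>j\<in>J - {k}. A i j * x j)"
        by (rule sum.cong) (auto simp: y_def)
      ultimately show ?thesis by simp
    qed
    have "(\<Sum>j\<in>J. A i j * y j) = 0" if i: "i < Suc m" for i
    proof (cases "i = m")
      case True then show ?thesis unfolding split using k(2) by (simp add: y_def)
    next
      case False
      then have "(\<Sum>j\<in>J - {k}. B i j * x j) = 0" using x(2) i by simp
      moreover have "(\<Sum>j\<in>J - {k}. B i j * x j) = (\<Sum>j\<in>J - {k}. A i j * x j) - A i k / A m k * (\<Sum>j\<in>J - {k}. A m j * x j)"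
        by (simp add: B_def algebra_simps sum_subtractf sum_distrib_left)
      ultimately show ?thesis unfolding split by (simp add: y_def)
    qed
    moreover have "\<exists>j\<in>J. y j \<noteq> 0" using x(1) by (auto simp: y_def)
    ultimately show ?thesis by blast
  qed
qed

text \<open>The right-hand side becomes an additional column -b, giving n equations in n + 1
  unknowns. In a non-trivial solution the last unknown cannot vanish, by injectivity of A, and
  dividing by it solves the system.\<close>

lemma linear_system_solvable:
  fixes A :: "nat \<Rightarrow> nat \<Rightarrow> real"
  assumes inj: "\<And>a. (\<forall>i<n. (\<Sum>j<n. A i j * a j) = 0) \<Longrightarrow> (\<forall>j<n. a j = 0)"
  shows "\<exists>a. \<forall>i<n. (\<Sum>j<n. A i j * a j) = b i"
proof -
  obtain x where x: "\<exists>j\<in>{..n}. x j \<noteq> 0" "\<forall>i<n. (\<Sum>j\<in>{..n}. (if j < n then A i j else - b i) * x j) = 0"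
    using homogeneous_system_nontrivial[of "{..n}" n "\<lambda>i j. if j < n then A i j else - b i"] by auto
  have eq: "(\<Sum>j<n. A i j * x j) = b i * x n" if "i < n" for i
  proof -
    have "(\<Sum>j\<in>{..n}. (if j < n then A i j else - b i) * x j) = (\<Sum>j<n. A i j * x j) - b i * x n"
      by (simp add: lessThan_Suc_atMost[symmetric])
    then show ?thesis using x(2) that by simp
  qed
  have xn: "x n \<noteq> 0"
  proof
    assume "x n = 0"
    then have "\<forall>i<n. (\<Sum>j<n. A i j * x j) = 0" using eq by simp
    then have "\<forall>j<n. x j = 0" by (rule inj)
    then show False using x(1) \<open>x n = 0\<close> by (auto simp: le_less)
  qed
  have "(\<Sum>j<n. A i j * (x j / x n)) = b i" if "i < n" for i
    using eq[OF that] xn by (simp add: sum_divide_distrib[symmetric])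
  then show ?thesis by (intro exI[of _ "\<lambda>j. x j / x n"] allI impI)
qed

lemma linear_form_zero:
  assumes "linear_form T \<omega>" "u \<in> T"
  shows "\<omega> (\<lambda>f. 0) = 0"
  using linear_form_lincomb[OF assms(1,2,2), of 0 0] by simp

text \<open>Non-degeneracy makes the matrix of the metric in a chart injective, hence the equations
  for the components of u solvable. This justifies the description operator in
  \<open>dual_vector\<close>.\<close>

lemma nondegenerate_dual:
  assumes M: "smooth_manifold M" and g: "smooth_symmetric_form M g" and nd: "nondegenerate M g"
    and p: "p \<in> points M" and \<omega>: "linear_form (tangent_space M p) \<omega>"
  shows "\<exists>!u. u \<in> tangent_space M p \<and> (\<forall>v\<in>tangent_space M p. g p u v = \<omega> v)"
proof -
  obtain U \<phi> where c: "(U, \<phi>) \<in> atlas M" "p \<in> U" using chart_ex[OF M p] .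
  let ?e = "coord_vec M (U, \<phi>) p" and ?n = "mdim M"
  let ?u = "\<lambda>a f. \<Sum>j<?n. a j * ?e j f"
  note eT = coord_vec_tangent[OF c]
  have u: "?u a \<in> tangent_space M p" for a by (rule tangentI[OF c])
  have gu: "g p (?u a) (?e i) = (\<Sum>j<?n. g p (?e j) (?e i) * a j)" if "i < ?n" for a i
    using linear_form_sum[OF M p sym_form_linear1[OF M g p eT[OF that]], of "{..<?n}" ?e a] eT
    by (simp add: mult.commute)
  have nd0: "w = (\<lambda>f. 0)" if w: "w \<in> tangent_space M p" "\<And>i. i < ?n \<Longrightarrow> g p w (?e i) = 0" for w
  proof -
    have "g p w v = 0" if "v \<in> tangent_space M p" for v
      using linear_form_coords[OF M sym_form_linear[OF g p w(1)] c that] w(2) by simp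
    then show ?thesis using nd p w(1) unfolding nondegenerate_def by blast
  qed
  have "\<exists>a. \<forall>i<?n. (\<Sum>j<?n. g p (?e j) (?e i) * a j) = \<omega> (?e i)"
  proof (rule linear_system_solvable)
    fix a :: "nat \<Rightarrow> real" assume a: "\<forall>i<?n. (\<Sum>j<?n. g p (?e j) (?e i) * a j) = 0"
    have z: "?u a = (\<lambda>f. 0)" by (rule nd0[OF u]) (use gu a in simp)
    show "\<forall>j<?n. a j = 0"
    proof (intro allI impI)
      fix j assume j: "j < ?n"
      have "?u a (\<lambda>q. \<phi> q j) = (\<Sum>i<?n. if i = j then a i else 0)"
        by (rule sum.cong) (use coord_vec_coord[OF M c] in auto)
      also have "\<dots> = a j" using j by simp
      finally show "a j = 0" using fun_cong[OF z, of "\<lambda>q. \<phi> q j"] by simp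
    qed
  qed
  then obtain a where a: "\<And>i. i < ?n \<Longrightarrow> (\<Sum>j<?n. g p (?e j) (?e i) * a j) = \<omega> (?e i)" by blast
  show ?thesis
  proof (rule ex1I[of _ "?u a"], intro conjI ballI u)
    fix v assume v: "v \<in> tangent_space M p"
    show "g p (?u a) v = \<omega> v"
      unfolding linear_form_coords[OF M sym_form_linear[OF g p u] c v] linear_form_coords[OF M \<omega> c v]
      by (rule sum.cong) (use gu a in simp_all)
  next
    fix w assume w: "w \<in> tangent_space M p \<and> (\<forall>v\<in>tangent_space M p. g p w v = \<omega> v)"
    have "(\<lambda>f. 1 * w f + (-1) * ?u a f) = (\<lambda>f. 0)"
    proof (rule nd0)
      show "(\<lambda>f. 1 * w f + (-1) * ?u a f) \<in> tangent_space M p" using tangent_lincomb[OF M _ u] w by blast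
      fix i assume i: "i < ?n"
      have "g p (\<lambda>f. 1 * w f + (-1) * ?u a f) (?e i) = 1 * g p w (?e i) + (-1) * g p (?u a) (?e i)"
        by (rule linear_form_lincomb[OF sym_form_linear1[OF M g p eT[OF i]] _ u]) (use w in blast)
      then show "g p (\<lambda>f. 1 * w f + (-1) * ?u a f) (?e i) = 0" using w eT[OF i] gu[OF i] a[OF i] by simp
    qed
    then show "w = ?u a" by (auto simp: fun_eq_iff)
  qed
qed

lemma dual_vector_works:
  assumes M: "smooth_manifold M" and g: "smooth_symmetric_form M g" and nd: "nondegenerate M g"
    and p: "p \<in> points M" and \<theta>: "smooth_one_form M \<theta>"
  shows "dual_vector M g \<theta> p \<in> tangent_space M p"
    "v \<in> tangent_space M p \<Longrightarrow> g p (dual_vector M g \<theta> p) v = \<theta> p v"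
proof -
  have "dual_vector M g \<theta> p \<in> tangent_space M p \<and>
      (\<forall>v\<in>tangent_space M p. g p (dual_vector M g \<theta> p) v = \<theta> p v)"
    unfolding dual_vector_def by (rule theI'[OF nondegenerate_dual[OF M g nd p one_form_linear[OF \<theta> p]]])
  then show "dual_vector M g \<theta> p \<in> tangent_space M p"
    "v \<in> tangent_space M p \<Longrightarrow> g p (dual_vector M g \<theta> p) v = \<theta> p v" by simp_all
qed

subsection \<open>Tangent vectors of \<open>\<real> \<times> N\<close>\<close>

abbreviation rline :: "real mfd" where
  "rline \<equiv> real_mfd UNIV"

lemma smooth_manifold_rline: "smooth_manifold rline"
  by (rule smooth_manifold_real) simp

lemma smooth_manifold_MQ: "smooth_manifold N \<Longrightarrow> smooth_manifold (MQ N)"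
  by (rule smooth_manifold_prod[OF smooth_manifold_rline])

lemma smooth_map_slice:
  assumes N: "smooth_manifold N"
  shows "smooth_map N (MQ N) (\<lambda>q. (x, q))"
  by (rule smooth_map_pair[OF N smooth_manifold_rline N smooth_map_const[OF N smooth_manifold_rline] smooth_map_id[OF N]]) simp

lemma smooth_map_line:
  assumes N: "smooth_manifold N" and p: "p \<in> points N"
  shows "smooth_map rline (MQ N) (\<lambda>s. (s, p))"
  by (rule smooth_map_pair[OF smooth_manifold_rline smooth_manifold_rline N smooth_map_id[OF smooth_manifold_rline]
        smooth_map_const[OF smooth_manifold_rline N p]])

text \<open>The coordinate field \<partial>/\<partial>x, as the velocity of the line through (x,
  p).\<close>

definition dX :: "'a mfd \<Rightarrow> real \<Rightarrow> 'a \<Rightarrow> (real \<times> 'a) tvec" where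
  "dX N x p = pushforward (MQ N) (\<lambda>s. (s, p)) x (coord_vec rline (UNIV, rchart) x 0)"

lemma dX_tangent:
  assumes N: "smooth_manifold N" and p: "p \<in> points N"
  shows "dX N x p \<in> tangent_space (MQ N) (x, p)"
  unfolding dX_def
  by (rule pushforward_tangent[OF smooth_manifold_rline smooth_manifold_MQ[OF N] smooth_map_line[OF N p] coord_vec_real_tangent]) simp

lemma dX_DERIV:
  assumes N: "smooth_manifold N" and p: "p \<in> points N" and f: "smooth_near (MQ N) (x, p) f"
  shows "((\<lambda>s. f (s, p)) has_real_derivative dX N x p f) (at x)"
proof -
  have "smooth_near rline x (\<lambda>s. f (s, p))"
    by (rule smooth_near_pull[OF smooth_manifold_rline smooth_manifold_MQ[OF N] smooth_map_line[OF N p], where f = f])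
      (use f in simp_all)
  then have "((\<lambda>s. f (s, p)) has_real_derivative coord_vec rline (UNIV, rchart) x 0 (\<lambda>s. f (s, p))) (at x)"
    by (intro real_smooth_near_pd) simp_all
  then show ?thesis using f by (simp add: dX_def pushforward_def)
qed

lemma smooth_near_fst:
  assumes N: "smooth_manifold N" and p: "p \<in> points N"
  shows "smooth_near (MQ N) (x, p) fst"
  by (rule smooth_near_of_real_map[OF smooth_manifold_MQ[OF N] _ smooth_map_fst[OF smooth_manifold_rline N]]) (use p in simp_all)

lemma dX_fst:
  assumes N: "smooth_manifold N" and p: "p \<in> points N"
  shows "dX N x p fst = 1"
  using DERIV_unique[OF dX_DERIV[OF N p smooth_near_fst[OF N p]], of 1 x] by simp

text \<open>Checked on the coordinates of one product chart: the first is \<open>fst\<close>, which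
  the slice inclusion keeps constant, and the others factor through \<open>snd\<close>, which is
  constant along the line.\<close>

lemma MQ_tangent_decomp:
  assumes N: "smooth_manifold N" and u: "u \<in> tangent_space (MQ N) (x, p)"
  shows "u = (\<lambda>f. u fst * dX N x p f + 1 * pushforward (MQ N) (\<lambda>q. (x, q)) p (pushforward N snd (x, p) u) f)"
proof -
  note MQ = smooth_manifold_MQ[OF N]
  have xp: "(x, p) \<in> points (MQ N)" by (rule tangent_point[OF MQ u])
  then have p: "p \<in> points N" by simp
  obtain V \<psi> where d: "(V, \<psi>) \<in> atlas N" "p \<in> V" using chart_ex[OF N p] .
  have c: "(UNIV \<times> V, pchart 1 rchart \<psi>) \<in> atlas (MQ N)" "(x, p) \<in> UNIV \<times> V"
    using prod_chart[OF _ d(1), of UNIV rchart rline] d(2) by simp_all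
  let ?w = "pushforward N snd (x, p) u"
  have "?w \<in> tangent_space N (snd (x, p))"
    by (rule pushforward_tangent[OF MQ N smooth_map_snd[OF smooth_manifold_rline N] u])
  then have w: "?w \<in> tangent_space N p" by simp
  have iw: "pushforward (MQ N) (\<lambda>q. (x, q)) p ?w \<in> tangent_space (MQ N) (x, p)"
    by (rule pushforward_tangent[OF N MQ smooth_map_slice[OF N] w])
  show ?thesis
  proof (rule tangent_eqI[OF MQ u tangent_lincomb[OF MQ dX_tangent[OF N p] iw] c])
    fix i assume i: "i < mdim (MQ N)"
    have sm: "smooth_near (MQ N) (x, p) (\<lambda>q. pchart 1 rchart \<psi> q i)" by (rule smooth_near_coord[OF MQ c])
    show "u (\<lambda>q. pchart 1 rchart \<psi> q i) = u fst * dX N x p (\<lambda>q. pchart 1 rchart \<psi> q i) +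
        1 * pushforward (MQ N) (\<lambda>q. (x, q)) p ?w (\<lambda>q. pchart 1 rchart \<psi> q i)"
    proof (cases "i = 0")
      case True
      then have eq: "(\<lambda>q. pchart 1 rchart \<psi> q i) = fst" by (auto simp: pchart_def fun_eq_iff)
      have "pushforward (MQ N) (\<lambda>q. (x, q)) p ?w fst = ?w (\<lambda>q. x)"
        using smooth_near_fst[OF N p] by (simp add: pushforward_def)
      then show ?thesis unfolding eq dX_fst[OF N p] using tangent_const[OF N w] by simp
    next
      case False
      then have eq: "(\<lambda>q. pchart 1 rchart \<psi> q i) = (\<lambda>q. \<psi> (snd q) (i - 1))" by (auto simp: pchart_def fun_eq_iff)
      have "((\<lambda>s. \<psi> p (i - 1)) has_real_derivative dX N x p (\<lambda>q. \<psi> (snd q) (i - 1))) (at x)"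
        using dX_DERIV[OF N p sm[unfolded eq]] by simp
      from DERIV_unique[OF this DERIV_const]
      have "dX N x p (\<lambda>q. \<psi> (snd q) (i - 1)) = 0" .
      moreover have "pushforward (MQ N) (\<lambda>q. (x, q)) p ?w (\<lambda>q. \<psi> (snd q) (i - 1)) = ?w (\<lambda>q. \<psi> q (i - 1))"
        using sm unfolding eq by (simp add: pushforward_def)
      moreover have "?w (\<lambda>q. \<psi> q (i - 1)) = u (\<lambda>q. \<psi> (snd q) (i - 1))"
        using smooth_near_coord[OF N d] by (simp add: pushforward_def)
      ultimately show ?thesis unfolding eq by simp
    qed
  qed
qed

text \<open>The two components of a tangent vector of the product can be prescribed independently;
  this provides the test vectors for non-degeneracy.\<close>

lemma MQ_tangent_exists:
  assumes N: "smooth_manifold N" and w: "w \<in> tangent_space N p"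
  obtains u where "u \<in> tangent_space (MQ N) (x, p)" "u fst = a" "pushforward N snd (x, p) u = w"
proof
  note MQ = smooth_manifold_MQ[OF N]
  have p: "p \<in> points N" by (rule tangent_point[OF N w])
  let ?iw = "pushforward (MQ N) (\<lambda>q. (x, q)) p w"
  let ?u = "\<lambda>f. a * dX N x p f + 1 * ?iw f"
  have iw: "?iw \<in> tangent_space (MQ N) (x, p)"
    by (rule pushforward_tangent[OF N MQ smooth_map_slice[OF N] w])
  show "?u \<in> tangent_space (MQ N) (x, p)" by (rule tangent_lincomb[OF MQ dX_tangent[OF N p] iw])
  have "?iw fst = 0"
    using smooth_near_fst[OF N p] tangent_const[OF N w] by (simp add: pushforward_def)
  then show "?u fst = a" using dX_fst[OF N p] by simp
  have s: "smooth_map (MQ N) N snd" by (rule smooth_map_snd[OF smooth_manifold_rline N])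
  have 1: "pushforward N snd (x, p) ?iw = w"
    using pushforward_compose[OF MQ N s, of "\<lambda>q. (x, q)" p w] p pushforward_id[OF w] by simp
  have 2: "pushforward N snd (x, p) (dX N x p) = (\<lambda>f. 0)"
  proof
    fix f
    show "pushforward N snd (x, p) (dX N x p) f = 0"
    proof (cases "smooth_near N p f")
      case True
      then have "smooth_near (MQ N) (x, p) (\<lambda>q. f (snd q))"
        using smooth_near_pull[OF MQ N s, of "(x, p)" f] p by simp
      from DERIV_unique[OF dX_DERIV[OF N p this], of 0] show ?thesis by (simp add: pushforward_def)
    qed (simp add: pushforward_def)
  qed
  show "pushforward N snd (x, p) ?u = w"
    unfolding pushforward_lincomb 1 2 by simp
qed

lemma gQ_eq:
  "gQ t N gN \<theta> z u v = exp (t * fst z) * (u fst * v fst +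
     (u fst * \<theta> (snd z) (pushforward N snd z v) + v fst * \<theta> (snd z) (pushforward N snd z u)) +
     gN (snd z) (pushforward N snd z u) (pushforward N snd z v))"
  by (simp add: gQ_def Let_def case_prod_beta)

lemma smooth_symmetric_gQ:
  assumes N: "smooth_manifold N" and g: "smooth_symmetric_form N gN" and \<theta>: "smooth_one_form N \<theta>"
  shows "smooth_symmetric_form (MQ N) (gQ t N gN \<theta>)"
proof -
  note MQ = smooth_manifold_MQ[OF N] and S = smooth_map_snd[OF smooth_manifold_rline N]
  note G = pull_sym_form[OF MQ N S g] and T = pull_one_form[OF MQ N S \<theta>]
  show ?thesis
    unfolding smooth_symmetric_form_iff[OF MQ]
  proof (intro conjI ballI allI impI)
    fix z u assume z: "z \<in> points (MQ N)" and u: "u \<in> tangent_space (MQ N) z"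
    show "linear_form (tangent_space (MQ N) z) (gQ t N gN \<theta> z u)"
      unfolding linear_form_def
    proof (intro ballI allI)
      fix v w a b assume vw: "v \<in> tangent_space (MQ N) z" "w \<in> tangent_space (MQ N) z"
      show "gQ t N gN \<theta> z u (\<lambda>f. a * v f + b * w f) = a * gQ t N gN \<theta> z u v + b * gQ t N gN \<theta> z u w"
        unfolding gQ_eq linear_form_lincomb[OF one_form_linear[OF T z] vw] linear_form_lincomb[OF sym_form_linear[OF G z u] vw]
        by (simp add: algebra_simps)
    qed
    fix v assume v: "v \<in> tangent_space (MQ N) z"
    show "gQ t N gN \<theta> z u v = gQ t N gN \<theta> z v u"
      unfolding gQ_eq sym_form_sym[OF G z u v] by (simp add: algebra_simps)
  next
    fix U \<phi> i j z assume c: "(U, \<phi>) \<in> atlas (MQ N)" and ij: "i < mdim (MQ N)" "j < mdim (MQ N)" and z: "z \<in> U"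
    have zp: "z \<in> points (MQ N)" using chart_subset[OF MQ c] z by blast
    have f: "smooth_near (MQ N) z fst" using smooth_near_fst[OF N, of "snd z" "fst z"] zp by auto
    have fi: "smooth_near (MQ N) z (\<lambda>q. coord_vec (MQ N) (U, \<phi>) q k fst)" if "k < mdim (MQ N)" for k
      by (rule coord_vec_smooth[OF MQ c z that f])
    note th = pull_one_form_coeff[OF MQ N S \<theta> c z]
    note gg = pull_sym_form_coeff[OF MQ N S g c z ij]
    have tx: "smooth_near (MQ N) z (\<lambda>q. exp (t * fst q))"
      by (rule smooth_near_exp[OF MQ smooth_near_mult[OF MQ smooth_near_const[OF MQ zp] f]])
    show "smooth_near (MQ N) z (\<lambda>q. gQ t N gN \<theta> q (coord_vec (MQ N) (U, \<phi>) q i) (coord_vec (MQ N) (U, \<phi>) q j))"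
      unfolding gQ_eq
      by (rule smooth_near_mult[OF MQ tx] smooth_near_add[OF MQ] smooth_near_mult[OF MQ fi] gg th fi ij)+
  qed
qed

lemma nondegenerate_gQ_iff:
  assumes N: "smooth_manifold N" and g: "smooth_symmetric_form N gN" and nd: "nondegenerate N gN" and \<theta>: "smooth_one_form N \<theta>"
  shows "nondegenerate (MQ N) (gQ t N gN \<theta>) \<longleftrightarrow> (\<forall>p\<in>points N. form_norm2 N gN \<theta> p \<noteq> 1)"
proof -
  note MQ = smooth_manifold_MQ[OF N] and S = smooth_map_snd[OF smooth_manifold_rline N]
  let ?d = "dual_vector N gN \<theta>"
  have d: "?d p \<in> tangent_space N p" "\<And>v. v \<in> tangent_space N p \<Longrightarrow> gN p (?d p) v = \<theta> p v" if "p \<in> points N" for p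
    using dual_vector_works[OF N g nd that \<theta>] by blast+
  have n2: "form_norm2 N gN \<theta> p = \<theta> p (?d p)" if "p \<in> points N" for p
    unfolding form_norm2_def using d[OF that] by blast
  show ?thesis
  proof
    assume L: "nondegenerate (MQ N) (gQ t N gN \<theta>)"
    show "\<forall>p\<in>points N. form_norm2 N gN \<theta> p \<noteq> 1"
    proof (rule ballI, rule notI)
      fix p assume p: "p \<in> points N" and "form_norm2 N gN \<theta> p = 1"
      then have 1: "\<theta> p (?d p) = 1" using n2 by simp
      have z: "(\<lambda>f. 0) \<in> tangent_space N p" by (rule tangent_zero[OF N p])
      have w: "(\<lambda>f. (-1) * ?d p f + 0 * ?d p f) \<in> tangent_space N p" (is "?w \<in> _")
        by (rule tangent_lincomb[OF N d(1) d(1)]) (rule p)+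
      \<comment> \<open>The candidate for the radical, \<partial>/\<partial>x minus the dual vector
        of \<theta>. The point x = 0 is an arbitrary choice on the line.\<close>
      obtain u where u: "u \<in> tangent_space (MQ N) (0, p)" "u fst = 1" "pushforward N snd (0, p) u = ?w"
        using MQ_tangent_exists[OF N w] by blast
      have tw: "\<theta> p ?w = -1"
        using linear_form_lincomb[OF one_form_linear[OF \<theta> p] d(1) d(1), OF p p, of "-1" 0] 1 by simp
      have gw: "gN p ?w v = - \<theta> p v" if v: "v \<in> tangent_space N p" for v
        using linear_form_lincomb[OF sym_form_linear1[OF N g p v] d(1) d(1), OF p p, of "-1" 0] d(2)[OF p v] by simp
      have "gQ t N gN \<theta> (0, p) u v = 0" if v: "v \<in> tangent_space (MQ N) (0, p)" for v
      proof -
        have pv: "pushforward N snd (0, p) v \<in> tangent_space N p"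
          using pushforward_tangent[OF MQ N S v] by simp
        show ?thesis using tw gw[OF pv] unfolding gQ_eq u(2,3) by simp
      qed
      then have "u = (\<lambda>f. 0)" using L u(1) p unfolding nondegenerate_def by force
      then show False using u(2) by simp
    qed
  next
    assume R: "\<forall>p\<in>points N. form_norm2 N gN \<theta> p \<noteq> 1"
    show "nondegenerate (MQ N) (gQ t N gN \<theta>)"
      unfolding nondegenerate_def
    proof (intro ballI impI)
      fix z u assume zM: "z \<in> points (MQ N)" and u: "u \<in> tangent_space (MQ N) z"
        and u0: "\<forall>v\<in>tangent_space (MQ N) z. gQ t N gN \<theta> z u v = 0"
      obtain x p where z: "z = (x, p)" by (cases z)
      have p: "p \<in> points N" using zM z by simp
      define a where "a = u fst"
      define w where "w = pushforward N snd (x, p) u"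
      have w: "w \<in> tangent_space N p" unfolding w_def using pushforward_tangent[OF MQ N S u] z by simp
      \<comment> \<open>The condition on u tested on the vector with components b and v. Below, b =
        1 with v = 0 gives the scalar equation, and b = 0 gives the equation on N.\<close>
      have eqn: "a * b + (a * \<theta> p v + b * \<theta> p w) + gN p w v = 0" if v: "v \<in> tangent_space N p" for b v
      proof -
        obtain v' where v': "v' \<in> tangent_space (MQ N) (x, p)" "v' fst = b" "pushforward N snd (x, p) v' = v"
          using MQ_tangent_exists[OF N v] by blast
        then have "gQ t N gN \<theta> (x, p) u v' = 0" using u0 z by blast
        then show ?thesis unfolding gQ_eq v'(2,3) by (simp add: a_def w_def)
      qed
      have zero: "\<theta> p (\<lambda>f. 0) = 0" "gN p w (\<lambda>f. 0) = 0"
        using linear_form_zero[OF one_form_linear[OF \<theta> p] w] linear_form_zero[OF sym_form_linear[OF g p w] w] by auto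
      have 1: "a + \<theta> p w = 0" using eqn[OF tangent_zero[OF N p], of 1] zero by simp
      have 2: "a * \<theta> p v + gN p w v = 0" if "v \<in> tangent_space N p" for v using eqn[OF that, of 0] by simp
      \<comment> \<open>The second equation says that this vector, w plus a times the dual vector of
        \<theta>, is orthogonal to N, hence zero.\<close>
      let ?c = "\<lambda>f. 1 * w f + a * ?d p f"
      have cT: "?c \<in> tangent_space N p" by (rule tangent_lincomb[OF N w d(1)[OF p]])
      have "gN p ?c v = 0" if v: "v \<in> tangent_space N p" for v
        using linear_form_lincomb[OF sym_form_linear1[OF N g p v] w d(1)[OF p], of 1 a] d(2)[OF p v] 2[OF v] by simp
      then have c0: "?c = (\<lambda>f. 0)" using nd cT p unfolding nondegenerate_def by blast
      have "\<theta> p ?c = 1 * \<theta> p w + a * \<theta> p (?d p)"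
        by (rule linear_form_lincomb[OF one_form_linear[OF \<theta> p] w d(1)[OF p]])
      then have "\<theta> p w + a * \<theta> p (?d p) = 0" using c0 zero by simp
      with 1 have "a * \<theta> p (?d p) = a" by linarith
      then have "a * (\<theta> p (?d p) - 1) = 0" by (simp add: right_diff_distrib)
      moreover have "\<theta> p (?d p) \<noteq> 1" using R p n2 by metis
      ultimately have a: "a = 0" by simp
      have w0: "w = (\<lambda>f. 0)" using c0 a by (simp add: fun_eq_iff)
      have "pushforward (MQ N) (\<lambda>q. (x, q)) p (\<lambda>f. 0) = (\<lambda>f. 0)" by (auto simp: pushforward_def)
      then show "u = (\<lambda>f. 0)"
        using MQ_tangent_decomp[OF N u[unfolded z]] a w0 unfolding a_def w_def by simp
    qed
  qed
qed

subsection \<open>Diffeomorphisms and group actions\<close>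

lemma diffeomorphismI:
  assumes M: "smooth_manifold M" and N: "smooth_manifold N" and F: "smooth_map M N F" and G: "smooth_map N M G"
    and GF: "\<And>p. p \<in> points M \<Longrightarrow> G (F p) = p" and FG: "\<And>q. q \<in> points N \<Longrightarrow> F (G q) = q"
  shows "diffeomorphism M N F"
  unfolding diffeomorphism_def
proof (intro conjI F)
  show b: "bij_betw F (points M) (points N)"
    by (rule bij_betw_byWitness[where f' = G]) (use GF FG smooth_map_in[OF F] smooth_map_in[OF G] in auto)
  show "smooth_map N M (inv_into (points M) F)"
  proof (rule smooth_map_cong[OF N M G])
    fix q assume q: "q \<in> points N"
    have "inv_into (points M) F (F (G q)) = G q"
      using inv_into_f_f[OF bij_betw_imp_inj_on[OF b] smooth_map_in[OF G q]] .
    then show "G q = inv_into (points M) F q" using FG[OF q] by simp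
  qed
qed

text \<open>Bijectivity comes from the action of the inverse element. The functions have to be
  extensional because \<open>BijGroup\<close> consists of extensional maps; for this reason the
  actions constructed below are restricted to the points of their manifold.\<close>

lemma group_actionI:
  assumes G: "group G"
    and im: "\<And>g x. g \<in> carrier G \<Longrightarrow> x \<in> E \<Longrightarrow> \<phi> g x \<in> E"
    and ext: "\<And>g. g \<in> carrier G \<Longrightarrow> \<phi> g \<in> extensional E"
    and one: "\<And>x. x \<in> E \<Longrightarrow> \<phi> \<one>\<^bsub>G\<^esub> x = x"
    and mult: "\<And>g h x. g \<in> carrier G \<Longrightarrow> h \<in> carrier G \<Longrightarrow> x \<in> E \<Longrightarrow> \<phi> (g \<otimes>\<^bsub>G\<^esub> h) x = \<phi> g (\<phi> h x)"
  shows "group_action G E \<phi>"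
proof -
  have Bij: "\<phi> g \<in> Bij E" if g: "g \<in> carrier G" for g
  proof -
    have gi: "inv\<^bsub>G\<^esub> g \<in> carrier G" using group.inv_closed[OF G g] .
    have "bij_betw (\<phi> g) E E"
    proof (rule bij_betw_byWitness[where f' = "\<phi> (inv\<^bsub>G\<^esub> g)"])
      show "\<forall>a\<in>E. \<phi> (inv\<^bsub>G\<^esub> g) (\<phi> g a) = a"
        using mult[OF gi g] one group.l_inv[OF G g] by simp
      show "\<forall>a\<in>E. \<phi> g (\<phi> (inv\<^bsub>G\<^esub> g) a) = a"
        using mult[OF g gi] one group.r_inv[OF G g] by simp
    qed (use im[OF g] im[OF gi] in auto)
    then show ?thesis using ext[OF g] by (simp add: Bij_def)
  qed
  have "\<phi> \<in> hom G (BijGroup E)"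
  proof (rule homI)
    fix g h assume gh: "g \<in> carrier G" "h \<in> carrier G"
    have ghG: "g \<otimes>\<^bsub>G\<^esub> h \<in> carrier G" using monoid.m_closed[OF group.is_monoid[OF G] gh] .
    have "\<phi> (g \<otimes>\<^bsub>G\<^esub> h) = compose E (\<phi> g) (\<phi> h)"
      by (rule extensionalityI[OF ext[OF ghG] compose_extensional]) (simp add: compose_def mult[OF gh])
    then show "\<phi> (g \<otimes>\<^bsub>G\<^esub> h) = \<phi> g \<otimes>\<^bsub>BijGroup E\<^esub> \<phi> h"
      using Bij[OF gh(1)] Bij[OF gh(2)] by (simp add: BijGroup_def)
  qed (simp add: BijGroup_def Bij)
  then show ?thesis
    unfolding group_action_def group_hom_def group_hom_axioms_def using G group_BijGroup by blast
qed

lemma action_facts: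
  assumes "transitive_effective_action G L M \<phi>"
  shows "group_action G (points M) \<phi>" "faithful_action G (points M) \<phi>"
    "\<And>p q. p \<in> points M \<Longrightarrow> q \<in> points M \<Longrightarrow> \<exists>g\<in>carrier G. \<phi> g p = q"
    "smooth_map (prod_mfd L M) M (\<lambda>(h, p). \<phi> h p)"
    "inj_on \<phi> (carrier G)"
  using assms unfolding transitive_effective_action_def transitive_action_def faithful_action_def
    transitive_action_axioms_def faithful_action_axioms_def by blast+

lemma action_extensional:
  assumes "group_action G E \<phi>" "g \<in> carrier G"
  shows "\<phi> g \<in> extensional E"
  using group_action.bij_prop0[OF assms] by (simp add: Bij_def)

lemma action_one:
  assumes "group_action G E \<phi>" "x \<in> E"
  shows "\<phi> \<one>\<^bsub>G\<^esub> x = x"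
  using group_action.id_eq_one[OF assms(1)] assms(2) by (metis restrict_apply')

lemma lie_group_facts:
  assumes "lie_group G L"
  shows "group G" "smooth_manifold L" "points L = carrier G"
    "smooth_map (prod_mfd L L) L (\<lambda>(a, b). a \<otimes>\<^bsub>G\<^esub> b)" "smooth_map L L (\<lambda>a. inv\<^bsub>G\<^esub> a)"
  using assms unfolding lie_group_def by blast+

lemma action_smooth:
  assumes L: "smooth_manifold L" and M: "smooth_manifold M" and S: "smooth_map (prod_mfd L M) M (\<lambda>(h, p). \<phi> h p)"
    and h: "h \<in> points L"
  shows "smooth_map M M (\<phi> h)"
  using smooth_map_compose[OF M smooth_manifold_prod[OF L M] M
      smooth_map_pair[OF M L M smooth_map_const[OF M L h] smooth_map_id[OF M]] S] by simp

lemma smooth_map_apply2: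
  assumes P: "smooth_manifold P" and A: "smooth_manifold A" and B: "smooth_manifold B" and C: "smooth_manifold C"
    and m: "smooth_map (prod_mfd A B) C (\<lambda>(a, b). m a b)" and F: "smooth_map P A F" and G: "smooth_map P B G"
  shows "smooth_map P C (\<lambda>z. m (F z) (G z))"
  using smooth_map_compose[OF P smooth_manifold_prod[OF A B] C smooth_map_pair[OF P A B F G] m] by simp

lemma smooth_map_fst':
  assumes "smooth_manifold P" "smooth_manifold A" "smooth_manifold B" "smooth_map P (prod_mfd A B) F"
  shows "smooth_map P A (\<lambda>z. fst (F z))"
  by (rule smooth_map_compose[OF assms(1) smooth_manifold_prod[OF assms(2,3)] assms(2) assms(4) smooth_map_fst[OF assms(2,3)]])

lemma smooth_map_snd':
  assumes "smooth_manifold P" "smooth_manifold A" "smooth_manifold B" "smooth_map P (prod_mfd A B) F"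
  shows "smooth_map P B (\<lambda>z. snd (F z))"
  by (rule smooth_map_compose[OF assms(1) smooth_manifold_prod[OF assms(2,3)] assms(3) assms(4) smooth_map_snd[OF assms(2,3)]])

subsection \<open>Transport of a manifold structure\<close>

text \<open>The charts of L are pulled back along b, while the topology T is given beforehand: an
  embedded submanifold must carry the subspace topology itself, not merely a homeomorphic
  one.\<close>

definition transport_mfd :: "'b topology \<Rightarrow> ('b \<Rightarrow> 'a) \<Rightarrow> 'a mfd \<Rightarrow> 'b mfd" where
  "transport_mfd T b L = \<lparr>mtop = T, mdim = mdim L,
     atlas = {({x \<in> topspace T. b x \<in> U}, \<lambda>x. \<phi> (b x)) | U \<phi>. (U, \<phi>) \<in> atlas L}\<rparr>"

lemma transport_simps [simp]: "mtop (transport_mfd T b L) = T" "mdim (transport_mfd T b L) = mdim L"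
  by (simp_all add: transport_mfd_def)

lemma atlas_transport: "atlas (transport_mfd T b L) = {({x \<in> topspace T. b x \<in> U}, \<lambda>x. \<phi> (b x)) | U \<phi>. (U, \<phi>) \<in> atlas L}"
  by (simp add: transport_mfd_def)

lemma smooth_manifold_transport:
  assumes L: "smooth_manifold L" and T: "Hausdorff_space T" "second_countable T" and bc: "homeomorphic_maps T (mtop L) b c"
  shows "smooth_manifold (transport_mfd T b L)"
proof (rule smooth_manifoldI)
  have cb: "continuous_map T (mtop L) b" and cc: "continuous_map (mtop L) T c"
    and inv: "\<And>x. x \<in> topspace T \<Longrightarrow> c (b x) = x" "\<And>y. y \<in> points L \<Longrightarrow> b (c y) = y"
    using bc unfolding homeomorphic_maps_def by blast+
  have bL: "b x \<in> points L" if "x \<in> topspace T" for x using continuous_map_image_subset_topspace[OF cb] that by blast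
  have cT: "c y \<in> topspace T" if "y \<in> points L" for y using continuous_map_image_subset_topspace[OF cc] that by blast
  show "Hausdorff_space (mtop (transport_mfd T b L))" "second_countable (mtop (transport_mfd T b L))" using T by simp_all
  show "\<exists>U \<phi>. (U, \<phi>) \<in> atlas (transport_mfd T b L) \<and> p \<in> U" if p: "p \<in> points (transport_mfd T b L)" for p
  proof -
    have pT: "p \<in> topspace T" using p by simp
    obtain U \<phi> where "(U, \<phi>) \<in> atlas L" "b p \<in> U" using chart_ex[OF L bL[OF pT]] .
    then show ?thesis unfolding atlas_transport using pT by blast
  qed
  fix Q \<omega> assume "(Q, \<omega>) \<in> atlas (transport_mfd T b L)"
  then obtain U \<phi> where Q: "Q = {x \<in> topspace T. b x \<in> U}" "\<omega> = (\<lambda>x. \<phi> (b x))" and c: "(U, \<phi>) \<in> atlas L"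
    unfolding atlas_transport by blast
  note UL = chart_subset[OF L c]
  show opQ: "openin (mtop (transport_mfd T b L)) Q"
    unfolding Q using openin_continuous_map_preimage[OF cb chart_open[OF L c]] by simp
  have img: "\<omega> ` Q = \<phi> ` U"
  proof
    show "\<phi> ` U \<subseteq> \<omega> ` Q"
    proof
      fix x assume "x \<in> \<phi> ` U"
      then obtain q where q: "q \<in> U" "x = \<phi> q" by blast
      then have "c q \<in> Q" "x = \<omega> (c q)" using inv(2) cT UL by (auto simp: Q)
      then show "x \<in> \<omega> ` Q" by blast
    qed
  qed (auto simp: Q)
  show op: "openin (Euclidean_space (mdim (transport_mfd T b L))) (\<omega> ` Q)"
    unfolding img using chart_image_open[OF L c] by simp
  show inj: "inj_on \<omega> Q"
  proof (rule inj_onI)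
    fix x y assume xy: "x \<in> Q" "y \<in> Q" "\<omega> x = \<omega> y"
    then have "b x = b y" using chart_inj[OF L c] unfolding Q inj_on_def by blast
    then show "x = y" using inv(1) xy unfolding Q by (metis (no_types, lifting) mem_Collect_eq)
  qed
  have sub: "topspace (subtopology T Q) = Q" by (auto simp: Q)
  have "continuous_map (subtopology T Q) (subtopology (mtop L) U) b"
    unfolding continuous_map_in_subtopology sub using continuous_map_from_subtopology[OF cb] by (auto simp: Q)
  then have "continuous_map (subtopology T Q) (Euclidean_space (mdim L)) \<omega>"
  proof (intro continuous_map_into_Euclidean)
    assume cbU: "continuous_map (subtopology T Q) (subtopology (mtop L) U) b"
    show "\<omega> x \<in> topspace (Euclidean_space (mdim L))" if "x \<in> topspace (subtopology T Q)" for x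
      using that unfolding sub by (auto simp: Q intro: chart_topspace[OF L c])
    show "continuous_map (subtopology T Q) euclideanreal (\<lambda>p. \<omega> p k)" for k
      using continuous_map_compose[OF cbU chart_coord_continuous[OF L c, of k]] by (simp add: o_def Q)
  qed
  then show "continuous_map (subtopology (mtop (transport_mfd T b L)) Q) (Euclidean_space (mdim (transport_mfd T b L))) \<omega>"
    by simp
  have invQ: "inv_into Q \<omega> x = c (inv_into U \<phi> x)" if xU: "x \<in> \<phi> ` U" for x
  proof -
    obtain q where q: "q \<in> U" "x = \<phi> q" using xU by blast
    then have cq: "c q \<in> Q" "x = \<omega> (c q)" using inv(2) cT UL by (auto simp: Q)
    then show ?thesis using inv_into_f_f[OF inj cq(1)] chart_inv[OF L c q(1)] q(2) by simp
  qed
  have "continuous_map (subtopology (Euclidean_space (mdim L)) (\<phi> ` U)) T (inv_into Q \<omega>)"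
  proof (rule continuous_map_eq)
    show "continuous_map (subtopology (Euclidean_space (mdim L)) (\<phi> ` U)) T (\<lambda>x. c (inv_into U \<phi> x))"
      using continuous_map_compose[OF chart_inv_continuous[OF L c] cc] by (simp add: o_def)
  qed (simp add: invQ)
  then show "continuous_map (subtopology (Euclidean_space (mdim (transport_mfd T b L))) (\<omega> ` Q)) (mtop (transport_mfd T b L)) (inv_into Q \<omega>)"
    unfolding img by simp
  fix Q' \<omega>' k q assume "(Q', \<omega>') \<in> atlas (transport_mfd T b L)" and q: "q \<in> Q" "q \<in> Q'"
  then obtain V \<psi> where Q': "Q' = {x \<in> topspace T. b x \<in> V}" "\<omega>' = (\<lambda>x. \<psi> (b x))" and d: "(V, \<psi>) \<in> atlas L"
    unfolding atlas_transport by blast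
  have bq: "b q \<in> U" "b q \<in> V" using q Q Q' by auto
  have "smooth_near L (b q) (\<lambda>r. \<psi> r k)" by (rule smooth_near_coord[OF L d bq(2)])
  then have "smooth_at (mdim L) (\<phi> (b q)) (\<lambda>x. \<psi> (inv_into U \<phi> x) k)" unfolding smooth_near_iff[OF L c bq(1)] .
  then have "smooth_at (mdim L) (\<omega> q) (\<lambda>x. \<omega>' (inv_into Q \<omega> x) k)"
    unfolding Q(2)
  proof (rule smooth_at_cong[OF _ chart_image_open[OF L c]])
    show "\<phi> (b q) \<in> \<phi> ` U" using bq by blast
    fix y assume y: "y \<in> \<phi> ` U"
    then have "inv_into U \<phi> y \<in> points L" using inv_into_into[OF y] UL by blast
    then show "\<psi> (inv_into U \<phi> y) k = \<omega>' (inv_into Q (\<lambda>x. \<phi> (b x)) y) k"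
      using invQ[OF y] inv(2) unfolding Q'(2) Q(2) by simp
  qed
  then show "smooth_at (mdim (transport_mfd T b L)) (\<omega> q) (\<lambda>x. \<omega>' (inv_into Q \<omega> x) k)" by simp
qed

lemma smooth_map_from_transport:
  assumes L: "smooth_manifold L" and T: "smooth_manifold (transport_mfd T b L)" and bc: "homeomorphic_maps T (mtop L) b c"
  shows "smooth_map (transport_mfd T b L) L b"
proof (rule smooth_mapI[OF T L])
  have cb: "continuous_map T (mtop L) b" using bc unfolding homeomorphic_maps_def by blast
  then show "continuous_map (mtop (transport_mfd T b L)) (mtop L) b" by simp
  fix p assume p: "p \<in> points (transport_mfd T b L)"
  then have bp: "b p \<in> points L" using continuous_map_image_subset_topspace[OF cb] by auto
  obtain U \<phi> where c: "(U, \<phi>) \<in> atlas L" "b p \<in> U" using chart_ex[OF L bp] .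
  have "({x \<in> topspace T. b x \<in> U}, \<lambda>x. \<phi> (b x)) \<in> atlas (transport_mfd T b L)"
    unfolding atlas_transport using c(1) by blast
  then have "smooth_near (transport_mfd T b L) p (\<lambda>q. \<phi> (b q) k)" for k
    using smooth_near_coord[OF T, of "{x \<in> topspace T. b x \<in> U}" "\<lambda>x. \<phi> (b x)" p k] p c(2) by simp
  then show "\<exists>V \<psi>. (V, \<psi>) \<in> atlas L \<and> b p \<in> V \<and> (\<forall>k<mdim L. smooth_near (transport_mfd T b L) p (\<lambda>q. \<psi> (b q) k))"
    using c by blast
qed

lemma smooth_map_to_transport:
  assumes L: "smooth_manifold L" and T: "smooth_manifold (transport_mfd T b L)" and bc: "homeomorphic_maps T (mtop L) b c"
  shows "smooth_map L (transport_mfd T b L) c"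
proof (rule smooth_mapI[OF L T])
  have cc: "continuous_map (mtop L) T c" and bcp: "\<And>p. p \<in> points L \<Longrightarrow> b (c p) = p"
    using bc unfolding homeomorphic_maps_def by blast+
  then show "continuous_map (mtop L) (mtop (transport_mfd T b L)) c" by simp
  fix p assume p: "p \<in> points L"
  have cp: "c p \<in> topspace T" using continuous_map_image_subset_topspace[OF cc] p by auto
  obtain U \<phi> where c: "(U, \<phi>) \<in> atlas L" "p \<in> U" using chart_ex[OF L p] .
  have "({x \<in> topspace T. b x \<in> U}, \<lambda>x. \<phi> (b x)) \<in> atlas (transport_mfd T b L)"
    unfolding atlas_transport using c(1) by blast
  moreover have "smooth_near L p (\<lambda>q. \<phi> (b (c q)) k)" for k
    by (rule smooth_near_cong[OF L smooth_near_coord[OF L c, of k] openin_topspace p]) (simp add: bcp)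
  ultimately show "\<exists>V \<psi>. (V, \<psi>) \<in> atlas (transport_mfd T b L) \<and> c p \<in> V \<and>
      (\<forall>k<mdim (transport_mfd T b L). smooth_near L p (\<lambda>q. \<psi> (c q) k))"
    using cp c(2) bcp[OF p] by (intro exI[of _ "{x \<in> topspace T. b x \<in> U}"] exI[of _ "\<lambda>x. \<phi> (b x)"]) simp
qed

subsection \<open>The homothety group of \<open>\<M>\<^bsub>t,\<Q>\<^esub>\<close>\<close>

text \<open>Tangent vectors are not assumed linear in f; this is the chain rule for the map that
  adds a. It gives the invariance of dx under translations.\<close>

lemma tangent_add_const:
  assumes M: "smooth_manifold M" and v: "v \<in> tangent_space M p" and f: "smooth_near M p f"
  shows "v (\<lambda>q. f q + a) = v f"
proof -
  have E: "rchart r \<in> topspace (Euclidean_space 1)" for r by (simp add: topspace_Euclidean_space)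
  have pd: "pd 0 (\<lambda>y. y 0 + a) y = 1" for y :: "nat \<Rightarrow> real"
    by (rule pd_eqI) (auto intro!: derivative_eq_intros)
  have "v (\<lambda>q. (\<lambda>y. y 0 + a) (rchart (f q))) = (\<Sum>k<1. pd k (\<lambda>y. y 0 + a) (rchart (f p)) * v (\<lambda>q. rchart (f q) k))"
    by (rule tangent_compose[OF M v, where Y = "\<lambda>q. rchart (f q)" and m = 1 and G = "\<lambda>y. y 0 + a" and W = "points M"])
      (use E f tangent_point[OF M v] in \<open>auto intro!: smooth_at_add smooth_at_coord\<close>)
  then show ?thesis using pd by simp
qed

text \<open>Written additively, so that it acts on the coordinate x by translations, for every t
  including 0.\<close>

abbreviation real_group :: "real monoid" where
  "real_group \<equiv> \<lparr>carrier = UNIV, mult = (+), one = 0\<rparr>"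

lemma group_real_group: "group real_group"
  by (rule groupI) (auto intro: exI[of _ "- _"])

lemma inv_real_group: "inv\<^bsub>real_group\<^esub> x = - x"
  by (rule group.inv_equality[OF group_real_group]) auto

lemma group_positive_reals: "group positive_reals"
proof (rule groupI)
  fix x assume "x \<in> carrier positive_reals"
  then show "\<exists>y\<in>carrier positive_reals. y \<otimes>\<^bsub>positive_reals\<^esub> x = \<one>\<^bsub>positive_reals\<^esub>"
    by (intro bexI[of _ "inverse x"]) (auto simp: positive_reals_def)
qed (auto simp: positive_reals_def)

lemma smooth_map_add_real:
  assumes P: "smooth_manifold P" and F: "smooth_map P rline F" and G: "smooth_map P rline G"
  shows "smooth_map P rline (\<lambda>z. F z + G z)"
  by (rule smooth_map_into_real[OF P open_UNIV], rule conjI,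
      rule smooth_near_add[OF P smooth_near_of_real_map[OF P open_UNIV F] smooth_near_of_real_map[OF P open_UNIV G]]) auto

lemma smooth_map_mult_real:
  assumes P: "smooth_manifold P" and F: "smooth_map P rline F"
  shows "smooth_map P rline (\<lambda>z. a * F z)"
  by (rule smooth_map_into_real[OF P open_UNIV], rule conjI,
      rule smooth_near_mult[OF P smooth_near_const[OF P] smooth_near_of_real_map[OF P open_UNIV F]]) auto

lemma lie_group_real_prod:
  assumes L: "lie_group G L"
  shows "lie_group (real_group \<times>\<times> G) (prod_mfd rline L)"
  unfolding lie_group_def
proof (intro conjI)
  note GL = lie_group_facts[OF L]
  note R = smooth_manifold_rline
  note RL = smooth_manifold_prod[OF R GL(2)]
  note RL2 = smooth_manifold_prod[OF RL RL]
  show "group (real_group \<times>\<times> G)" by (rule DirProd_group[OF group_real_group GL(1)])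
  show "smooth_manifold (prod_mfd rline L)" by (rule RL)
  show "points (prod_mfd rline L) = carrier (real_group \<times>\<times> G)" using GL(3) by simp
  note f = smooth_map_fst[OF RL RL] and s = smooth_map_snd[OF RL RL]
  show "smooth_map (prod_mfd (prod_mfd rline L) (prod_mfd rline L)) (prod_mfd rline L) (\<lambda>(a, b). a \<otimes>\<^bsub>real_group \<times>\<times> G\<^esub> b)"
    by (rule smooth_map_cong[OF RL2 RL smooth_map_pair[OF RL2 R GL(2)
            smooth_map_add_real[OF RL2 smooth_map_fst'[OF RL2 R GL(2) f] smooth_map_fst'[OF RL2 R GL(2) s]]
            smooth_map_apply2[OF RL2 GL(2) GL(2) GL(2) GL(4) smooth_map_snd'[OF RL2 R GL(2) f] smooth_map_snd'[OF RL2 R GL(2) s]]]])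
      (auto simp: mult_DirProd')
  show "smooth_map (prod_mfd rline L) (prod_mfd rline L) (\<lambda>a. inv\<^bsub>real_group \<times>\<times> G\<^esub> a)"
    by (rule smooth_map_cong[OF RL RL smooth_map_pair[OF RL R GL(2)
            smooth_map_mult_real[OF RL smooth_map_fst[OF R GL(2)], of "-1"]
            smooth_map_compose[OF RL GL(2) GL(2) smooth_map_snd[OF R GL(2)] GL(5)]]])
      (use GL(3) in \<open>auto simp: inv_DirProd[OF group_real_group GL(1)] inv_real_group\<close>)
qed

lemma connected_rline: "connected_space euclideanreal"
  using connectedin_topspace[of euclideanreal] by simp

text \<open>Translation preserves dx, and \<alpha> preserves \<theta> and the metric of N, so only
  the conformal factor changes, by e^{ts}. \<open>scales_metric\<close> squares its argument, whence
  the half.\<close>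

lemma scales_gQ:
  assumes N: "smooth_manifold N" and \<alpha>: "smooth_map N N \<alpha>" and iso: "scales_metric N gN N gN \<alpha> 1"
    and \<theta>: "\<forall>p\<in>points N. \<forall>u\<in>tangent_space N p. \<theta> (\<alpha> p) (pushforward N \<alpha> p u) = \<theta> p u"
    and F: "\<And>x p. p \<in> points N \<Longrightarrow> F (x, p) = (x + s, \<alpha> p)"
  shows "scales_metric (MQ N) (gQ t N gN \<theta>) (MQ N) (gQ t N gN \<theta>) F (exp (t * s / 2))"
  unfolding scales_metric_def
proof (intro ballI)
  note MQ = smooth_manifold_MQ[OF N] and S = smooth_map_snd[OF smooth_manifold_rline N]
  let ?F = "\<lambda>z. (fst z + s, \<alpha> (snd z))"
  have Fz: "F z = ?F z" if "z \<in> points (MQ N)" for z using F[of "snd z" "fst z"] that by auto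
  have "smooth_map (MQ N) (MQ N) ?F"
    by (rule smooth_map_pair[OF MQ smooth_manifold_rline N
          smooth_map_add_real[OF MQ smooth_map_fst[OF smooth_manifold_rline N] smooth_map_const[OF MQ smooth_manifold_rline]]
          smooth_map_compose[OF MQ N N S \<alpha>]]) simp
  then have sF: "smooth_map (MQ N) (MQ N) F" by (rule smooth_map_cong[OF MQ MQ]) (simp only: Fz)
  fix z u v assume z: "z \<in> points (MQ N)" and u: "u \<in> tangent_space (MQ N) z" and v: "v \<in> tangent_space (MQ N) z"
  have p: "snd z \<in> points N" using z by auto
  have fst: "pushforward (MQ N) F z w fst = w fst" if w: "w \<in> tangent_space (MQ N) z" for w
  proof -
    have Fp: "F z \<in> points (MQ N)" by (rule smooth_map_in[OF sF z])
    then have "smooth_near (MQ N) (F z) fst" using smooth_near_fst[OF N, of "snd (F z)" "fst (F z)"] by auto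
    then have "pushforward (MQ N) F z w fst = w (\<lambda>q. fst (F q))" by (simp add: pushforward_def)
    also have "\<dots> = w (\<lambda>q. fst q + s)" by (rule tangent_cong[OF MQ w openin_topspace z]) (simp only: Fz fst_conv)
    also have "\<dots> = w fst"
      by (rule tangent_add_const[OF MQ w]) (use smooth_near_fst[OF N p, of "fst z"] in simp)
    finally show ?thesis .
  qed
  have snd: "pushforward N snd (F z) (pushforward (MQ N) F z w) = pushforward N \<alpha> (snd z) (pushforward N snd z w)"
    if w: "w \<in> tangent_space (MQ N) z" for w
  proof -
    have "pushforward N snd (F z) (pushforward (MQ N) F z w) = pushforward N (\<lambda>q. snd (F q)) z w"
      by (rule pushforward_compose[where F = F and p = z, OF MQ N S smooth_map_in[OF sF z]])
    also have "\<dots> = pushforward N (\<lambda>q. \<alpha> (snd q)) z w"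
      by (rule pushforward_cong[OF MQ w openin_topspace z]) (simp only: Fz snd_conv)
    also have "\<dots> = pushforward N \<alpha> (snd z) (pushforward N snd z w)"
      by (rule pushforward_compose[where F = snd and p = z, OF N N \<alpha> p, symmetric])
    finally show ?thesis .
  qed
  have T: "pushforward N snd z w \<in> tangent_space N (snd z)" if w: "w \<in> tangent_space (MQ N) z" for w
    by (rule pushforward_tangent[OF MQ N S w])
  have th: "\<theta> (\<alpha> (snd z)) (pushforward N \<alpha> (snd z) (pushforward N snd z w)) = \<theta> (snd z) (pushforward N snd z w)"
    if w: "w \<in> tangent_space (MQ N) z" for w using \<theta> p T[OF w] by blast
  have gg: "gN (\<alpha> (snd z)) (pushforward N \<alpha> (snd z) (pushforward N snd z u)) (pushforward N \<alpha> (snd z) (pushforward N snd z v)) =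
      gN (snd z) (pushforward N snd z u) (pushforward N snd z v)"
    using iso p T[OF u] T[OF v] unfolding scales_metric_def by simp
  have Fz': "fst (F z) = fst z + s" "snd (F z) = \<alpha> (snd z)" using Fz[OF z] by simp_all
  have ex: "exp (t * (fst z + s)) = (exp (t * s / 2))\<^sup>2 * exp (t * fst z)"
    by (simp add: exp_add[symmetric] power2_eq_square algebra_simps)
  show "gQ t N gN \<theta> (F z) (pushforward (MQ N) F z u) (pushforward (MQ N) F z v) = (exp (t * s / 2))\<^sup>2 * gQ t N gN \<theta> z u v"
    unfolding gQ_eq fst[OF u] fst[OF v] snd[OF u] snd[OF v] Fz' th[OF u] th[OF v] gg ex by (simp only: mult.assoc)
qed

lemma homothety_homogeneous_MQ:
  fixes N :: "'n mfd" and G :: "'i monoid"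
  assumes Q: "Q_structure N gN G L \<alpha> \<theta>" and n1: "\<forall>p\<in>points N. form_norm2 N gN \<theta> p \<noteq> 1"
  shows "homothety_homogeneous (MQ N) (gQ t N gN \<theta>) (real_group \<times>\<times> G) (prod_mfd rline L)
    (\<lambda>(s, h). \<lambda>z\<in>points (MQ N). (fst z + s, \<alpha> h (snd z))) (\<lambda>(s, h). exp (t * s / 2))"
  unfolding homothety_homogeneous_def
proof (intro conjI)
  have prN: "pseudo_riemannian N gN" and cL: "connected_lie_group G L" and act: "transitive_effective_action G L N \<alpha>"
    and iso: "\<forall>h\<in>carrier G. scales_metric N gN N gN (\<alpha> h) 1" and \<theta>: "smooth_one_form N \<theta>"
    and inv: "\<forall>h\<in>carrier G. \<forall>p\<in>points N. \<forall>u\<in>tangent_space N p. \<theta> (\<alpha> h p) (pushforward N (\<alpha> h) p u) = \<theta> p u"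
    using Q unfolding Q_structure_def by blast+
  have N: "smooth_manifold N" and ne: "points N \<noteq> {}" and con: "connected_space (mtop N)"
    and g: "smooth_symmetric_form N gN" and nd: "nondegenerate N gN"
    using prN unfolding pseudo_riemannian_def connected_manifold_def by blast+
  have L: "lie_group G L" and conL: "connected_space (mtop L)" using cL unfolding connected_lie_group_def by blast+
  note GL = lie_group_facts[OF L] and A = action_facts[OF act]
  note R = smooth_manifold_rline and MQ = smooth_manifold_MQ[OF N]
  note RL = smooth_manifold_prod[OF R GL(2)]
  let ?\<Psi> = "\<lambda>(s, h). \<lambda>z\<in>points (MQ N). (fst z + s, \<alpha> h (snd z))"
  show "pseudo_riemannian (MQ N) (gQ t N gN \<theta>)"
    unfolding pseudo_riemannian_def connected_manifold_def
    using MQ ne con smooth_symmetric_gQ[OF N g \<theta>] nondegenerate_gQ_iff[OF N g nd \<theta>] n1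
    by (simp add: connected_space_prod_topology connected_rline)
  show "connected_lie_group (real_group \<times>\<times> G) (prod_mfd rline L)"
    unfolding connected_lie_group_def using lie_group_real_prod[OF L] conL
    by (simp add: connected_space_prod_topology connected_rline)
  have im: "\<alpha> h p \<in> points N" if "h \<in> carrier G" "p \<in> points N" for h p
    using group_action.element_image[OF A(1) that] by blast
  have ga: "group_action (real_group \<times>\<times> G) (points (MQ N)) ?\<Psi>"
  proof (rule group_actionI)
    show "group (real_group \<times>\<times> G)" by (rule DirProd_group[OF group_real_group GL(1)])
    show "?\<Psi> k z \<in> points (MQ N)" if "k \<in> carrier (real_group \<times>\<times> G)" "z \<in> points (MQ N)" for k z
      using that im by auto
    show "?\<Psi> \<one>\<^bsub>real_group \<times>\<times> G\<^esub> z = z" if "z \<in> points (MQ N)" for z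
      using that action_one[OF A(1)] by auto
    show "?\<Psi> (k \<otimes>\<^bsub>real_group \<times>\<times> G\<^esub> l) z = ?\<Psi> k (?\<Psi> l z)"
      if "k \<in> carrier (real_group \<times>\<times> G)" "l \<in> carrier (real_group \<times>\<times> G)" "z \<in> points (MQ N)" for k l z
      using that im group_action.composition_rule[OF A(1)] by (auto simp: algebra_simps)
  qed auto
  show "transitive_effective_action (real_group \<times>\<times> G) (prod_mfd rline L) (MQ N) ?\<Psi>"
    unfolding transitive_effective_action_def
  proof (intro conjI)
    show "transitive_action (real_group \<times>\<times> G) (points (MQ N)) ?\<Psi>"
      unfolding transitive_action_def transitive_action_axioms_def
    proof (intro conjI ga allI impI)
      fix z w assume z: "z \<in> points (MQ N)" and w: "w \<in> points (MQ N)"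
      obtain h where h: "h \<in> carrier G" "\<alpha> h (snd z) = snd w" using A(3)[of "snd z" "snd w"] z w by auto
      show "\<exists>k\<in>carrier (real_group \<times>\<times> G). ?\<Psi> k z = w"
        using h z by (intro bexI[of _ "(fst w - fst z, h)"]) (auto simp: prod_eq_iff)
    qed
    show "faithful_action (real_group \<times>\<times> G) (points (MQ N)) ?\<Psi>"
      unfolding faithful_action_def faithful_action_axioms_def
    proof (intro conjI ga inj_onI)
      fix k l assume k: "k \<in> carrier (real_group \<times>\<times> G)" and l: "l \<in> carrier (real_group \<times>\<times> G)" and eq: "?\<Psi> k = ?\<Psi> l"
      obtain s h where kk: "k = (s, h)" by (cases k)
      obtain s' h' where ll: "l = (s', h')" by (cases l)
      have e: "s = s' \<and> \<alpha> h p = \<alpha> h' p" if p: "p \<in> points N" for p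
        using fun_cong[OF eq, of "(0, p)"] p unfolding kk ll by simp
      have "\<alpha> h = \<alpha> h'"
        by (rule extensionalityI[OF action_extensional[OF A(1)] action_extensional[OF A(1)]])
          (use k l kk ll e in auto)
      then have "h = h'" using A(5) k l unfolding kk ll inj_on_def by auto
      \<comment> \<open>The real component can be read off only at a point of N, so effectiveness
        relies on N being non-empty.\<close>
      moreover obtain p0 where "p0 \<in> points N" using ne by blast
      ultimately show "k = l" using e unfolding kk ll by blast
    qed
    note P = smooth_manifold_prod[OF RL MQ]
    note f = smooth_map_fst[OF RL MQ] and s = smooth_map_snd[OF RL MQ]
    show "smooth_map (prod_mfd (prod_mfd rline L) (MQ N)) (MQ N) (\<lambda>(h, p). ?\<Psi> h p)"
      by (rule smooth_map_cong[OF P MQ smooth_map_pair[OF P R N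
              smooth_map_add_real[OF P smooth_map_fst'[OF P R N s] smooth_map_fst'[OF P R GL(2) f]]
              smooth_map_apply2[OF P GL(2) N N A(4) smooth_map_snd'[OF P R GL(2) f] smooth_map_snd'[OF P R N s]]]])
        auto
  qed
  show "\<forall>k\<in>carrier (real_group \<times>\<times> G). 0 < (\<lambda>(s, h). exp (t * s / 2)) k \<and>
      scales_metric (MQ N) (gQ t N gN \<theta>) (MQ N) (gQ t N gN \<theta>) (?\<Psi> k) ((\<lambda>(s, h). exp (t * s / 2)) k)"
  proof
    fix k assume "k \<in> carrier (real_group \<times>\<times> G)"
    then obtain s h where k: "k = (s, h)" and h: "h \<in> carrier G" by auto
    have "scales_metric (MQ N) (gQ t N gN \<theta>) (MQ N) (gQ t N gN \<theta>) (?\<Psi> (s, h)) (exp (t * s / 2))"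
    proof (rule scales_gQ[OF N])
      show "smooth_map N N (\<alpha> h)" by (rule action_smooth[OF GL(2) N A(4)]) (use h GL(3) in simp)
    qed (use iso inv h in auto)
    then show "0 < (\<lambda>(s, h). exp (t * s / 2)) k \<and>
      scales_metric (MQ N) (gQ t N gN \<theta>) (MQ N) (gQ t N gN \<theta>) (?\<Psi> k) ((\<lambda>(s, h). exp (t * s / 2)) k)"
      unfolding k by simp
  qed
qed

text \<open>For t \<noteq> 0 the kernel is the factor G at parameter 0, and on the real factor the
  character is an isomorphism onto the positive reals, which is inverted explicitly.\<close>

lemma character_splits_real_prod:
  fixes G :: "'i monoid"
  assumes L: "lie_group G L" and t: "t \<noteq> 0"
  shows "character_splits (real_group \<times>\<times> G) (prod_mfd rline L) (\<lambda>(s, h). exp (t * s / 2))"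
proof -
  note GL = lie_group_facts[OF L]
  note R = smooth_manifold_rline
  note RL = smooth_manifold_prod[OF R GL(2)]
  let ?H = "real_group \<times>\<times> G" and ?LH = "prod_mfd rline L" and ?\<mu> = "\<lambda>(s, h). exp (t * s / 2)"
  have H: "group ?H" by (rule DirProd_group[OF group_real_group GL(1)])
  define C where "C = kernel ?H positive_reals ?\<mu>"
  have C: "C = {0} \<times> carrier G" using t by (auto simp: C_def kernel_def positive_reals_def)
  have "?\<mu> \<in> hom ?H positive_reals"
    by (rule homI) (auto simp: positive_reals_def exp_add[symmetric] field_simps)
  then have "group_hom ?H positive_reals ?\<mu>"
    using H group_positive_reals unfolding group_hom_def group_hom_axioms_def by blast
  then have sub: "subgroup C ?H" unfolding C_def by (rule group_hom.subgroup_kernel)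
  let ?K = "?H\<lparr>carrier := C\<rparr>"
  have K: "group ?K" by (rule subgroup.subgroup_is_group[OF sub H])
  \<comment> \<open>The kernel consists of pairs (0, h), so the manifold structure of G is carried
    over to these pairs.\<close>
  define T where "T = subtopology (mtop ?LH) C"
  have topT: "topspace T = C" unfolding T_def C using GL(3) by auto
  have bc: "homeomorphic_maps T (mtop L) snd (\<lambda>h. (0, h))"
    unfolding homeomorphic_maps_def
  proof (intro conjI ballI)
    show "continuous_map T (mtop L) snd" unfolding T_def
      by (rule continuous_map_from_subtopology) (simp add: continuous_map_snd)
    have "continuous_map (mtop L) (mtop ?LH) (\<lambda>h. (0, h))"
      using smooth_map_continuous[OF smooth_map_slice[OF GL(2)]] by simp
    then show "continuous_map (mtop L) T (\<lambda>h. (0, h))"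
      unfolding T_def continuous_map_in_subtopology C using GL(3) by auto
  qed (use topT C in auto)
  define LK where "LK = transport_mfd T snd L"
  have LK: "smooth_manifold LK" unfolding LK_def
  proof (rule smooth_manifold_transport[OF GL(2) _ _ bc])
    show "Hausdorff_space T" "second_countable T"
      using RL unfolding T_def smooth_manifold_def by (simp_all add: Hausdorff_space_subtopology second_countable_subtopology)
  qed
  have b: "smooth_map LK L snd" unfolding LK_def
    by (rule smooth_map_from_transport[OF GL(2) LK[unfolded LK_def] bc])
  have c: "smooth_map L LK (\<lambda>h. (0, h))" unfolding LK_def
    by (rule smooth_map_to_transport[OF GL(2) LK[unfolded LK_def] bc])
  have ptLK: "points LK = C" unfolding LK_def using topT by simp
  have incl: "smooth_map LK ?LH (\<lambda>p. p)"
    by (rule smooth_map_cong[OF LK RL smooth_map_compose[OF LK GL(2) RL b smooth_map_slice[OF GL(2), of 0]]])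
      (auto simp: ptLK C)
  note LK2 = smooth_manifold_prod[OF LK LK]
  have lieK: "lie_group ?K LK"
    unfolding lie_group_def
  proof (intro conjI K LK)
    show "points LK = carrier ?K" using ptLK by simp
    show "smooth_map (prod_mfd LK LK) LK (\<lambda>(a, b). a \<otimes>\<^bsub>?K\<^esub> b)"
      by (rule smooth_map_cong[OF LK2 LK smooth_map_compose[OF LK2 GL(2) LK
              smooth_map_apply2[OF LK2 GL(2) GL(2) GL(2) GL(4)
                smooth_map_compose[OF LK2 LK GL(2) smooth_map_fst[OF LK LK] b]
                smooth_map_compose[OF LK2 LK GL(2) smooth_map_snd[OF LK LK] b]] c]])
        (auto simp: ptLK C)
    have "(0, inv\<^bsub>G\<^esub> (snd a)) = inv\<^bsub>?K\<^esub> a" if a: "a \<in> points LK" for a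
    proof -
      have "inv\<^bsub>?K\<^esub> a = inv\<^bsub>?H\<^esub> a" using group.m_inv_consistent[OF H sub] a ptLK by simp
      then show ?thesis using a inv_DirProd[OF group_real_group GL(1)] inv_real_group[of 0] by (auto simp: ptLK C)
    qed
    then show "smooth_map LK LK (\<lambda>a. inv\<^bsub>?K\<^esub> a)"
      by (rule smooth_map_cong[OF LK LK smooth_map_compose[OF LK GL(2) LK smooth_map_compose[OF LK GL(2) GL(2) b GL(5)] c]])
  qed
  have emb: "embedded_submanifold LK ?LH"
    unfolding embedded_submanifold_def
  proof (intro conjI LK incl ballI)
    show "points LK \<subseteq> points ?LH" using ptLK C GL(3) by auto
    show "mtop LK = subtopology (mtop ?LH) (points LK)" unfolding ptLK by (simp add: LK_def T_def)
    fix p assume p: "p \<in> points LK"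
    \<comment> \<open>A smooth retraction onto the kernel; its differential is a left inverse of
      that of the inclusion, which is therefore injective.\<close>
    have r: "smooth_map ?LH LK (\<lambda>z. (0, snd z))"
      by (rule smooth_map_compose[OF RL GL(2) LK smooth_map_snd[OF R GL(2)] c])
    show "inj_on (pushforward ?LH (\<lambda>p. p) p) (tangent_space LK p)"
    proof (rule inj_on_inverseI)
      fix u assume u: "u \<in> tangent_space LK p"
      have "pushforward LK (\<lambda>z. (0, snd z)) p (pushforward ?LH (\<lambda>p. p) p u) = pushforward LK (\<lambda>z. (0, snd z)) p u"
        by (rule pushforward_compose[where F = "\<lambda>p. p", OF RL LK r]) (rule smooth_map_in[OF incl p])
      also have "\<dots> = pushforward LK (\<lambda>z. z) p u"
        by (rule pushforward_cong[OF LK u openin_topspace p]) (auto simp: ptLK C)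
      also have "\<dots> = u" by (rule pushforward_id[OF u])
      finally show "pushforward LK (\<lambda>z. (0, snd z)) p (pushforward ?LH (\<lambda>p. p) p u) = u" .
    qed
  qed
  have P: "smooth_manifold (real_mfd {0<..})" by (rule smooth_manifold_real) simp
  note PK = smooth_manifold_prod[OF P LK]
  \<comment> \<open>The parameter \<open>2 / t * ln s\<close> is the one at which e^{ts/2} takes the
    prescribed value s of the character.\<close>
  let ?\<Psi> = "\<lambda>z. (2 / t * ln (fst z), snd (snd z))"
  have "diffeomorphism (prod_mfd (real_mfd {0<..}) LK) ?LH ?\<Psi>"
  proof (rule diffeomorphismI[OF PK RL])
    have "smooth_map (prod_mfd (real_mfd {0<..}) LK) rline (\<lambda>z. ln (fst z))"
    proof (rule smooth_map_into_real[OF PK open_UNIV], rule conjI)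
      fix z assume z: "z \<in> points (prod_mfd (real_mfd {0<..}) LK)"
      show "smooth_near (prod_mfd (real_mfd {0<..}) LK) z (\<lambda>z. ln (fst z))"
        by (rule smooth_near_ln[OF PK smooth_near_of_real_map[OF PK _ smooth_map_fst[OF P LK] z]]) (use z in auto)
    qed simp
    then show "smooth_map (prod_mfd (real_mfd {0<..}) LK) ?LH ?\<Psi>"
      by (intro smooth_map_pair[OF PK R GL(2)] smooth_map_mult_real[OF PK]
          smooth_map_compose[OF PK LK GL(2) smooth_map_snd[OF P LK] b])
    have "smooth_map ?LH (real_mfd {0<..}) (\<lambda>z. exp (t / 2 * fst z))"
    proof (rule smooth_map_into_real[OF RL], simp, rule conjI)
      fix z assume z: "z \<in> points ?LH"
      show "smooth_near ?LH z (\<lambda>z. exp (t / 2 * fst z))"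
        by (rule smooth_near_exp[OF RL smooth_near_mult[OF RL smooth_near_const[OF RL z]
                smooth_near_of_real_map[OF RL open_UNIV smooth_map_fst[OF R GL(2)] z]]])
    qed simp
    then show "smooth_map ?LH (prod_mfd (real_mfd {0<..}) LK) (\<lambda>z. (exp (t / 2 * fst z), (0, snd z)))"
      by (rule smooth_map_pair[OF RL P LK _ smooth_map_compose[OF RL GL(2) LK smooth_map_snd[OF R GL(2)] c]])
  qed (use t in \<open>auto simp: ptLK C\<close>)
  moreover have "?\<Psi> \<in> iso (positive_reals \<times>\<times> ?K) ?H"
  proof -
    have "?\<Psi> \<in> hom (positive_reals \<times>\<times> ?K) ?H"
      by (rule homI) (auto simp: C positive_reals_def ln_mult add_divide_distrib distrib_left
          intro: monoid.m_closed[OF group.is_monoid[OF GL(1)]])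
    moreover have "bij_betw ?\<Psi> (carrier (positive_reals \<times>\<times> ?K)) (carrier ?H)"
      by (rule bij_betw_byWitness[where f' = "\<lambda>z. (exp (t / 2 * fst z), (0, snd z))"])
        (use t in \<open>auto simp: C positive_reals_def\<close>)
    ultimately show ?thesis unfolding iso_def by blast
  qed
  ultimately have "lie_isomorphism (positive_reals \<times>\<times> ?K) (prod_mfd (real_mfd {0<..}) LK) ?H ?LH ?\<Psi>"
    unfolding lie_isomorphism_def by blast
  moreover have "\<forall>s>0. \<forall>k\<in>carrier ?K. ?\<mu> (?\<Psi> (s, k)) = s" using t by simp
  ultimately show ?thesis
    unfolding character_splits_def Let_def C_def[symmetric] using lieK emb by blast
qed

subsection \<open>Regular level sets\<close>

text \<open>A slice exhibits the level set, inside the chart \<open>\<phi>\<close>, as the graph of \<open>\<zeta>\<close> over the coordinates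
  other than the i-th one.\<close>

definition slice :: "'a mfd \<Rightarrow> ('a \<Rightarrow> real) \<Rightarrow> real \<Rightarrow> 'a set \<Rightarrow> ('a \<Rightarrow> nat \<Rightarrow> real) \<Rightarrow> nat \<Rightarrow>
    (nat \<Rightarrow> real) set \<Rightarrow> ((nat \<Rightarrow> real) \<Rightarrow> real) \<Rightarrow> bool" where
  "slice M F c U \<phi> i W \<zeta> \<longleftrightarrow>
     (U, \<phi>) \<in> atlas M \<and> i < mdim M \<and> openin (Euclidean_space (mdim M)) W \<and> W \<subseteq> \<phi> ` U \<and>
     openin (Euclidean_space (mdim M - 1)) (del i ` W) \<and> smooth_fn (mdim M - 1) (del i ` W) \<zeta> \<and>
     (\<forall>y\<in>del i ` W. ins i y (\<zeta> y) \<in> W \<and> F (inv_into U \<phi> (ins i y (\<zeta> y))) = c) \<and>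
     (\<forall>x\<in>W. F (inv_into U \<phi> x) = c \<longrightarrow> x i = \<zeta> (del i x))"

definition slice_dom :: "('a \<Rightarrow> real) \<Rightarrow> real \<Rightarrow> 'a set \<Rightarrow> ('a \<Rightarrow> nat \<Rightarrow> real) \<Rightarrow> (nat \<Rightarrow> real) set \<Rightarrow> 'a set" where
  "slice_dom F c U \<phi> W = {q \<in> U. \<phi> q \<in> W \<and> F q = c}"

definition slice_map :: "('a \<Rightarrow> nat \<Rightarrow> real) \<Rightarrow> nat \<Rightarrow> 'a \<Rightarrow> nat \<Rightarrow> real" where
  "slice_map \<phi> i = (\<lambda>q. del i (\<phi> q))"

text \<open>A chart omits the coordinate that the equation F = c determines. All slices are taken as
  charts, for whichever chart of M and index i they arise.\<close>

definition level_mfd :: "'a mfd \<Rightarrow> ('a \<Rightarrow> real) \<Rightarrow> real \<Rightarrow> 'a mfd" where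
  "level_mfd M F c = \<lparr>mtop = subtopology (mtop M) {p. F p = c}, mdim = mdim M - 1,
     atlas = {(slice_dom F c U \<phi> W, slice_map \<phi> i) | U \<phi> i W \<zeta>. slice M F c U \<phi> i W \<zeta>}\<rparr>"

lemma level_simps [simp]:
  "mtop (level_mfd M F c) = subtopology (mtop M) {p. F p = c}" "mdim (level_mfd M F c) = mdim M - 1"
  by (simp_all add: level_mfd_def)

lemma points_level: "points (level_mfd M F c) = {p \<in> points M. F p = c}"
  by auto

lemma atlas_level: "atlas (level_mfd M F c) = {(slice_dom F c U \<phi> W, slice_map \<phi> i) | U \<phi> i W \<zeta>. slice M F c U \<phi> i W \<zeta>}"
  by (simp add: level_mfd_def)

lemma sliceD:
  assumes "slice M F c U \<phi> i W \<zeta>"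
  shows "(U, \<phi>) \<in> atlas M" "i < mdim M" "openin (Euclidean_space (mdim M)) W" "W \<subseteq> \<phi> ` U"
    "openin (Euclidean_space (mdim M - 1)) (del i ` W)" "smooth_fn (mdim M - 1) (del i ` W) \<zeta>"
    "\<And>y. y \<in> del i ` W \<Longrightarrow> ins i y (\<zeta> y) \<in> W" "\<And>y. y \<in> del i ` W \<Longrightarrow> F (inv_into U \<phi> (ins i y (\<zeta> y))) = c"
    "\<And>x. x \<in> W \<Longrightarrow> F (inv_into U \<phi> x) = c \<Longrightarrow> x i = \<zeta> (del i x)"
  using assms unfolding slice_def by blast+

lemma slice_ins:
  assumes M: "smooth_manifold M" and s: "slice M F c U \<phi> i W \<zeta>" and q: "q \<in> slice_dom F c U \<phi> W"
  shows "ins i (slice_map \<phi> i q) (\<zeta> (slice_map \<phi> i q)) = \<phi> q"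
proof -
  have qU: "q \<in> U" "\<phi> q \<in> W" "F q = c" using q by (auto simp: slice_dom_def)
  have "\<phi> q i = \<zeta> (del i (\<phi> q))"
    by (rule sliceD(9)[OF s qU(2)]) (simp add: chart_inv[OF M sliceD(1)[OF s] qU(1)] qU(3))
  then show ?thesis unfolding slice_map_def using ins_del[of i "\<phi> q"] by simp
qed

lemma slice_point:
  assumes M: "smooth_manifold M" and s: "slice M F c U \<phi> i W \<zeta>" and y: "y \<in> del i ` W"
  shows "inv_into U \<phi> (ins i y (\<zeta> y)) \<in> slice_dom F c U \<phi> W" "slice_map \<phi> i (inv_into U \<phi> (ins i y (\<zeta> y))) = y"
proof -
  have x: "ins i y (\<zeta> y) \<in> W" "ins i y (\<zeta> y) \<in> \<phi> ` U" using sliceD(7)[OF s y] sliceD(4)[OF s] by auto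
  have "\<phi> (inv_into U \<phi> (ins i y (\<zeta> y))) = ins i y (\<zeta> y)" by (rule f_inv_into_f[OF x(2)])
  then show "inv_into U \<phi> (ins i y (\<zeta> y)) \<in> slice_dom F c U \<phi> W" "slice_map \<phi> i (inv_into U \<phi> (ins i y (\<zeta> y))) = y"
    using x inv_into_into[OF x(2)] sliceD(8)[OF s y] by (simp_all add: slice_dom_def slice_map_def)
qed

lemma slice_image:
  assumes M: "smooth_manifold M" and s: "slice M F c U \<phi> i W \<zeta>"
  shows "slice_map \<phi> i ` slice_dom F c U \<phi> W = del i ` W"
proof
  show "del i ` W \<subseteq> slice_map \<phi> i ` slice_dom F c U \<phi> W"
  proof
    fix y assume y: "y \<in> del i ` W"
    show "y \<in> slice_map \<phi> i ` slice_dom F c U \<phi> W"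
      using slice_point[OF M s y] by (metis imageI)
  qed
qed (auto simp: slice_map_def slice_dom_def)

lemma slice_inj:
  assumes M: "smooth_manifold M" and s: "slice M F c U \<phi> i W \<zeta>"
  shows "inj_on (slice_map \<phi> i) (slice_dom F c U \<phi> W)"
proof (rule inj_onI)
  fix p q assume pq: "p \<in> slice_dom F c U \<phi> W" "q \<in> slice_dom F c U \<phi> W" "slice_map \<phi> i p = slice_map \<phi> i q"
  have "\<phi> p = \<phi> q" using slice_ins[OF M s pq(1)] slice_ins[OF M s pq(2)] pq(3) by simp
  then show "p = q" using chart_inj[OF M sliceD(1)[OF s]] pq unfolding inj_on_def slice_dom_def by blast
qed

lemma slice_inv:
  assumes M: "smooth_manifold M" and s: "slice M F c U \<phi> i W \<zeta>" and y: "y \<in> del i ` W"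
  shows "inv_into (slice_dom F c U \<phi> W) (slice_map \<phi> i) y = inv_into U \<phi> (ins i y (\<zeta> y))"
  using inv_into_f_f[OF slice_inj[OF M s] slice_point(1)[OF M s y]] slice_point(2)[OF M s y] by simp

text \<open>The inverse chart of a slice is the graph map
  \<open>\<lambda>y. ins i y (\<zeta> y)\<close> followed by an inverse chart of M, and the graph
  map is smooth because \<zeta> is.\<close>

lemma slice_smooth:
  assumes M: "smooth_manifold M" and s: "slice M F c U \<phi> i W \<zeta>" and q: "q \<in> slice_dom F c U \<phi> W"
    and f: "smooth_near M q f"
  shows "smooth_at (mdim M - 1) (slice_map \<phi> i q) (\<lambda>y. f (inv_into (slice_dom F c U \<phi> W) (slice_map \<phi> i) y))"
proof -
  let ?Y = "\<lambda>y. ins i y (\<zeta> y)"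
  note c = sliceD(1)[OF s] and D = sliceD(5)[OF s]
  have qU: "q \<in> U" using q by (simp add: slice_dom_def)
  have yD: "slice_map \<phi> i q \<in> del i ` W" using slice_image[OF M s] q by blast
  then have yE: "slice_map \<phi> i q \<in> topspace (Euclidean_space (mdim M - 1))" using openin_subset[OF D] by blast
  have "smooth_at (mdim M - 1) (slice_map \<phi> i q) (\<lambda>y. f (inv_into U \<phi> (?Y y)))"
  proof (rule smooth_at_compose[where Y = ?Y and m = "mdim M" and f = "\<lambda>x. f (inv_into U \<phi> x)", OF _ D yD])
    show "smooth_at (mdim M) (?Y (slice_map \<phi> i q)) (\<lambda>x. f (inv_into U \<phi> x))"
      unfolding slice_ins[OF M s q] using f unfolding smooth_near_iff[OF M c qU] .
    show "?Y y \<in> topspace (Euclidean_space (mdim M))" if "y \<in> del i ` W" for y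
      using sliceD(7)[OF s that] openin_subset[OF sliceD(3)[OF s]] by blast
    show "smooth_at (mdim M - 1) (slice_map \<phi> i q) (\<lambda>y. ?Y y k)" for k
    proof -
      consider "k < i" | "k = i" | "k > i" by linarith
      then show ?thesis
        by cases (use smooth_at_coord[OF yE] smooth_fn_imp_at[OF D sliceD(6)[OF s] yD] in \<open>simp_all add: ins_def\<close>)
    qed
  qed
  then show ?thesis
    by (rule smooth_at_cong[OF _ D yD]) (simp add: slice_inv[OF M s])
qed

text \<open>\<open>regular\<close> says that the differential of F does not vanish on the level, in
  the coordinate form that the implicit function theorem takes.\<close>

locale regular_level =
  fixes M :: "'a mfd" and F :: "'a \<Rightarrow> real" and c :: real
  assumes M: "smooth_manifold M"
    and F: "\<And>p. p \<in> points M \<Longrightarrow> smooth_near M p F"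
    and regular: "\<And>p. p \<in> points M \<Longrightarrow> F p = c \<Longrightarrow>
      \<exists>U \<phi> i. (U, \<phi>) \<in> atlas M \<and> p \<in> U \<and> i < mdim M \<and> coord_vec M (U, \<phi>) p i F \<noteq> 0"
begin

lemma slice_ex:
  assumes p: "p \<in> points M" "F p = c"
  shows "\<exists>U \<phi> i W \<zeta>. slice M F c U \<phi> i W \<zeta> \<and> p \<in> slice_dom F c U \<phi> W"
proof -
  obtain U \<phi> i where d: "(U, \<phi>) \<in> atlas M" "p \<in> U" "i < mdim M" "coord_vec M (U, \<phi>) p i F \<noteq> 0"
    using regular[OF p] by blast
  let ?h = "\<lambda>x. F (inv_into U \<phi> x)"
  \<comment> \<open>The index i shows that the dimension is positive, so \<open>mdim M - 1\<close>
    is a true predecessor.\<close>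
  obtain m where m: "mdim M = Suc m" using d(3) by (cases "mdim M") auto
  have sm: "smooth_fn (Suc m) (\<phi> ` U) ?h"
    using smooth_fn_chart_iff[OF M d(1), of F] F chart_subset[OF M d(1)] m by auto
  have op: "openin (Euclidean_space (Suc m)) (\<phi> ` U)" using chart_image_open[OF M d(1)] m by simp
  have "\<exists>W \<zeta>. openin (Euclidean_space (Suc m)) W \<and> \<phi> p \<in> W \<and> W \<subseteq> \<phi> ` U \<and>
    openin (Euclidean_space m) (del i ` W) \<and> smooth_fn m (del i ` W) \<zeta> \<and>
    (\<forall>y\<in>del i ` W. ins i y (\<zeta> y) \<in> W \<and> ?h (ins i y (\<zeta> y)) = c) \<and>
    (\<forall>x\<in>W. ?h x = c \<longrightarrow> x i = \<zeta> (del i x))"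
  proof (rule implicit_function[OF op sm])
    show "i \<le> m" using d(3) m by simp
    show "\<phi> p \<in> \<phi> ` U" using d(2) by blast
    show "?h (\<phi> p) = c" using chart_inv[OF M d(1,2)] p(2) by simp
    show "pd i ?h (\<phi> p) \<noteq> 0" using d(4) F[OF p(1)] by (simp add: coord_vec_def)
  qed
  then obtain W \<zeta> where W: "openin (Euclidean_space (Suc m)) W" "\<phi> p \<in> W" "W \<subseteq> \<phi> ` U"
    "openin (Euclidean_space m) (del i ` W)" "smooth_fn m (del i ` W) \<zeta>"
    "\<forall>y\<in>del i ` W. ins i y (\<zeta> y) \<in> W \<and> ?h (ins i y (\<zeta> y)) = c"
    "\<forall>x\<in>W. ?h x = c \<longrightarrow> x i = \<zeta> (del i x)" by blast
  have "slice M F c U \<phi> i W \<zeta>" unfolding slice_def using d W m by simp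
  moreover have "p \<in> slice_dom F c U \<phi> W" using d p W by (simp add: slice_dom_def)
  ultimately show ?thesis by blast
qed

lemma level_manifold: "smooth_manifold (level_mfd M F c)"
proof (rule smooth_manifoldI)
  let ?S = "{p. F p = c}" and ?m = "mdim M - 1"
  show "Hausdorff_space (mtop (level_mfd M F c))" "second_countable (mtop (level_mfd M F c))"
    using M unfolding smooth_manifold_def by (simp_all add: Hausdorff_space_subtopology second_countable_subtopology)
  show "\<exists>U \<phi>. (U, \<phi>) \<in> atlas (level_mfd M F c) \<and> p \<in> U" if "p \<in> points (level_mfd M F c)" for p
    using slice_ex[of p] that unfolding atlas_level points_level by blast
  fix Q \<omega> assume "(Q, \<omega>) \<in> atlas (level_mfd M F c)"
  then obtain U \<phi> i W \<zeta> where Q: "Q = slice_dom F c U \<phi> W" "\<omega> = slice_map \<phi> i" and s: "slice M F c U \<phi> i W \<zeta>"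
    unfolding atlas_level by blast
  note d = sliceD(1)[OF s]
  have QU: "Q \<subseteq> U" "Q \<subseteq> ?S" by (auto simp: Q slice_dom_def)
  have "openin (mtop M) {q \<in> U. \<phi> q \<in> W}" by (rule chart_open_preimage[OF M d sliceD(3)[OF s]])
  then have "openin (subtopology (mtop M) ?S) (?S \<inter> {q \<in> U. \<phi> q \<in> W})" by (rule openin_subtopology_Int2)
  moreover have "?S \<inter> {q \<in> U. \<phi> q \<in> W} = Q" by (auto simp: Q slice_dom_def)
  ultimately show "openin (mtop (level_mfd M F c)) Q" by simp
  have img: "\<omega> ` Q = del i ` W" unfolding Q by (rule slice_image[OF M s])
  show op: "openin (Euclidean_space (mdim (level_mfd M F c))) (\<omega> ` Q)" unfolding img using sliceD(5)[OF s] by simp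
  show "inj_on \<omega> Q" unfolding Q by (rule slice_inj[OF M s])
  have sub: "subtopology (subtopology (mtop M) ?S) Q = subtopology (mtop M) Q"
    using QU(2) by (simp add: subtopology_subtopology Int_absorb1)
  have "continuous_map (subtopology (mtop M) Q) (Euclidean_space ?m) \<omega>"
  proof (rule continuous_map_into_Euclidean)
    show "\<omega> x \<in> topspace (Euclidean_space ?m)" if "x \<in> topspace (subtopology (mtop M) Q)" for x
      using that openin_subset[OF op] by auto
    show "continuous_map (subtopology (mtop M) Q) euclideanreal (\<lambda>p. \<omega> p k)" for k
      using continuous_map_from_subtopology_mono[OF chart_coord_continuous[OF M d] QU(1)]
      by (cases "k < i") (simp_all add: Q slice_map_def del_def)
  qed
  then show "continuous_map (subtopology (mtop (level_mfd M F c)) Q) (Euclidean_space (mdim (level_mfd M F c))) \<omega>"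
    using sub by simp
  let ?T = "subtopology (Euclidean_space ?m) (del i ` W)"
  have topT: "topspace ?T = del i ` W" using openin_subset[OF sliceD(5)[OF s]] by auto
  have "continuous_map ?T (subtopology (mtop M) ?S) (inv_into Q \<omega>)"
  proof (rule continuous_map_eq)
    have "continuous_on (del i ` W) \<zeta>" using sliceD(6)[OF s] unfolding smooth_fn_iff_Ck by (meson Ck.simps(1))
    then have "continuous_map (top_of_set (del i ` W)) euclideanreal \<zeta>" by simp
    then have \<zeta>: "continuous_map ?T euclideanreal \<zeta>"
      using top_of_set_Euclidean_space[OF openin_subset[OF sliceD(5)[OF s]]] by simp
    have "continuous_map ?T (Euclidean_space (mdim M)) (\<lambda>y. ins i y (\<zeta> y))"
    proof (rule continuous_map_into_Euclidean)
      show "ins i y (\<zeta> y) \<in> topspace (Euclidean_space (mdim M))" if "y \<in> topspace ?T" for y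
        using sliceD(7)[OF s, of y] that openin_subset[OF sliceD(3)[OF s]] unfolding topT by blast
      show "continuous_map ?T euclideanreal (\<lambda>y. ins i y (\<zeta> y) k)" for k
      proof -
        have co: "continuous_map ?T euclideanreal (\<lambda>y. y j)" for j
          by (rule continuous_map_from_subtopology[OF continuous_map_Euclidean_coord])
        consider "k < i" | "k = i" | "k > i" by linarith
        then show ?thesis by cases (use co \<zeta> in \<open>simp_all add: ins_def\<close>)
      qed
    qed
    then have "continuous_map ?T (subtopology (Euclidean_space (mdim M)) (\<phi> ` U)) (\<lambda>y. ins i y (\<zeta> y))"
      unfolding continuous_map_in_subtopology topT using sliceD(7)[OF s] sliceD(4)[OF s] by blast
    from continuous_map_compose[OF this chart_inv_continuous[OF M d]]
    have "continuous_map ?T (mtop M) (\<lambda>y. inv_into U \<phi> (ins i y (\<zeta> y)))" by (simp add: o_def)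
    then show "continuous_map ?T (subtopology (mtop M) ?S) (\<lambda>y. inv_into U \<phi> (ins i y (\<zeta> y)))"
      unfolding continuous_map_in_subtopology topT using sliceD(8)[OF s] by blast
    show "inv_into U \<phi> (ins i y (\<zeta> y)) = inv_into Q \<omega> y" if "y \<in> topspace ?T" for y
      using that unfolding topT Q by (rule slice_inv[OF M s, symmetric])
  qed
  then show "continuous_map (subtopology (Euclidean_space (mdim (level_mfd M F c))) (\<omega> ` Q)) (mtop (level_mfd M F c)) (inv_into Q \<omega>)"
    unfolding img by simp
  fix Q' \<omega>' k q assume "(Q', \<omega>') \<in> atlas (level_mfd M F c)" and q: "q \<in> Q" "q \<in> Q'"
  then obtain U' \<phi>' i' W' \<zeta>' where Q': "Q' = slice_dom F c U' \<phi>' W'" "\<omega>' = slice_map \<phi>' i'" and s': "slice M F c U' \<phi>' i' W' \<zeta>'"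
    unfolding atlas_level by blast
  have "smooth_near M q (\<lambda>r. \<omega>' r k)"
    using smooth_near_coord[OF M sliceD(1)[OF s'], of q] q(2) unfolding Q' slice_map_def slice_dom_def
    by (cases "k < i'") (simp_all add: del_def)
  from slice_smooth[OF M s q(1)[unfolded Q] this]
  show "smooth_at (mdim (level_mfd M F c)) (\<omega> q) (\<lambda>x. \<omega>' (inv_into Q \<omega> x) k)" by (simp add: Q)
qed

lemma level_smooth_near:
  assumes q: "q \<in> points M" "F q = c" and f: "smooth_near M q f"
  shows "smooth_near (level_mfd M F c) q f"
proof -
  obtain U \<phi> i W \<zeta> where s: "slice M F c U \<phi> i W \<zeta>" "q \<in> slice_dom F c U \<phi> W" using slice_ex[OF q] by blast
  have "(slice_dom F c U \<phi> W, slice_map \<phi> i) \<in> atlas (level_mfd M F c)" unfolding atlas_level using s(1) by blast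
  from smooth_near_iff[OF level_manifold this s(2)] slice_smooth[OF M s f] show ?thesis by simp
qed

lemma level_inclusion: "smooth_map (level_mfd M F c) M (\<lambda>q. q)"
proof (rule smooth_mapI[OF level_manifold M])
  show "continuous_map (mtop (level_mfd M F c)) (mtop M) (\<lambda>q. q)"
    using continuous_map_from_subtopology[OF continuous_map_id, of "mtop M"] by (simp add: id_def)
  fix p assume "p \<in> points (level_mfd M F c)"
  then have p: "p \<in> points M" "F p = c" unfolding points_level by auto
  obtain U \<phi> where d: "(U, \<phi>) \<in> atlas M" "p \<in> U" using chart_ex[OF M p(1)] .
  then show "\<exists>V \<psi>. (V, \<psi>) \<in> atlas M \<and> p \<in> V \<and> (\<forall>k<mdim M. smooth_near (level_mfd M F c) p (\<lambda>q. \<psi> q k))"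
    using level_smooth_near[OF p smooth_near_coord[OF M d]] by blast
qed

text \<open>The coordinates of a slice are among those of the ambient chart, so they inherit
  smoothness from f as a map into M.\<close>

lemma level_smooth_into:
  assumes P: "smooth_manifold P" and f: "smooth_map P M f" and "\<And>z. z \<in> points P \<Longrightarrow> F (f z) = c"
  shows "smooth_map P (level_mfd M F c) f"
proof (rule smooth_mapI[OF P level_manifold])
  show "continuous_map (mtop P) (mtop (level_mfd M F c)) f"
    using smooth_map_continuous[OF f] assms(3) by (auto simp: continuous_map_in_subtopology)
  fix z assume z: "z \<in> points P"
  obtain U \<phi> i W \<zeta> where s: "slice M F c U \<phi> i W \<zeta>" "f z \<in> slice_dom F c U \<phi> W"
    using slice_ex[OF smooth_map_in[OF f z] assms(3)[OF z]] by blast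
  have fz: "f z \<in> U" using s(2) by (simp add: slice_dom_def)
  have "smooth_near P z (\<lambda>q. slice_map \<phi> i (f q) k)" for k
    using smooth_near_pull[OF P M f z smooth_near_coord[OF M sliceD(1)[OF s(1)] fz]]
    by (cases "k < i") (simp_all add: slice_map_def del_def)
  moreover have "(slice_dom F c U \<phi> W, slice_map \<phi> i) \<in> atlas (level_mfd M F c)" unfolding atlas_level using s(1) by blast
  ultimately show "\<exists>V \<psi>. (V, \<psi>) \<in> atlas (level_mfd M F c) \<and> f z \<in> V \<and>
      (\<forall>k<mdim (level_mfd M F c). smooth_near P z (\<lambda>q. \<psi> (f q) k))"
    using s(2) by blast
qed

text \<open>The inclusion is an immersion: a vector that annihilates all ambient coordinates
  annihilates the slice coordinates, which are some of them.\<close>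

lemma level_pushforward_zero:
  assumes u: "u \<in> tangent_space (level_mfd M F c) p" and z: "pushforward M (\<lambda>q. q) p u = (\<lambda>f. 0)"
  shows "u = (\<lambda>f. 0)"
proof -
  have pL: "p \<in> points (level_mfd M F c)" by (rule tangent_point[OF level_manifold u])
  then have p: "p \<in> points M" "F p = c" unfolding points_level by auto
  obtain U \<phi> i W \<zeta> where s: "slice M F c U \<phi> i W \<zeta>" "p \<in> slice_dom F c U \<phi> W" using slice_ex[OF p] by blast
  have pU: "p \<in> U" using s(2) by (simp add: slice_dom_def)
  have c: "(slice_dom F c U \<phi> W, slice_map \<phi> i) \<in> atlas (level_mfd M F c)" unfolding atlas_level using s(1) by blast
  have "u (\<lambda>q. \<phi> q k) = 0" for k
    using fun_cong[OF z, of "\<lambda>q. \<phi> q k"] smooth_near_coord[OF M sliceD(1)[OF s(1)] pU] by (simp add: pushforward_def)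
  then have "u (\<lambda>q. slice_map \<phi> i q k) = 0" for k
    by (cases "k < i") (simp_all add: slice_map_def del_def)
  then show ?thesis
    by (intro tangent_eqI[OF level_manifold u tangent_zero[OF level_manifold pL] c s(2)])
qed

end

subsection \<open>The quotient by a central flow\<close>

abbreviation rpos :: "real mfd" where
  "rpos \<equiv> real_mfd {0<..}"

lemma smooth_manifold_rpos: "smooth_manifold rpos"
  by (rule smooth_manifold_real) simp

locale central_flow =
  fixes M :: "'a mfd" and g :: "'a metric_tensor" and H :: "'h monoid" and L :: "'h mfd"
    and \<Phi> :: "'h \<Rightarrow> 'a \<Rightarrow> 'a" and \<mu> :: "'h \<Rightarrow> real" and \<sigma> :: "real \<Rightarrow> 'h" and \<xi> :: "'a \<Rightarrow> 'a tvec"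
  assumes hom: "homothety_homogeneous M g H L \<Phi> \<mu>"
    and pos: "\<And>p u. p \<in> points M \<Longrightarrow> u \<in> tangent_space M p \<Longrightarrow> u \<noteq> (\<lambda>f. 0) \<Longrightarrow> g p u u > 0"
    and \<sigma>_hom: "\<sigma> \<in> hom positive_reals H"
    and \<sigma>_smooth: "smooth_map rpos L \<sigma>"
    and \<sigma>_\<mu>: "\<And>s. s > 0 \<Longrightarrow> \<mu> (\<sigma> s) = s"
    and \<sigma>_central: "\<And>s h. s > 0 \<Longrightarrow> h \<in> carrier H \<Longrightarrow> \<sigma> s \<otimes>\<^bsub>H\<^esub> h = h \<otimes>\<^bsub>H\<^esub> \<sigma> s"
    and \<xi>: "\<And>p. p \<in> points M \<Longrightarrow> \<xi> p = (\<lambda>f. if smooth_near M p f then deriv (\<lambda>s. f (\<Phi> (\<sigma> s) p)) 1 else 0)"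
    and spacelike: "\<And>p. p \<in> points M \<Longrightarrow> g p (\<xi> p) (\<xi> p) > 0"
begin

lemma M: "smooth_manifold M" and nonempty: "points M \<noteq> {}" and connected: "connected_space (mtop M)"
  and sym: "smooth_symmetric_form M g"
  and lie: "lie_group H L" and act: "transitive_effective_action H L M \<Phi>"
  and mu_pos: "\<And>h. h \<in> carrier H \<Longrightarrow> \<mu> h > 0"
  and scales: "\<And>h. h \<in> carrier H \<Longrightarrow> scales_metric M g M g (\<Phi> h) (\<mu> h)"
  and connected_L: "connected_space (mtop L)"
  using hom unfolding homothety_homogeneous_def pseudo_riemannian_def connected_manifold_def connected_lie_group_def
  by blast+

lemmas lie_facts = lie_group_facts[OF lie]
lemmas act_facts = action_facts[OF act]

lemma act_in: "h \<in> carrier H \<Longrightarrow> p \<in> points M \<Longrightarrow> \<Phi> h p \<in> points M"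
  using group_action.element_image[OF act_facts(1)] by blast

lemma act_mult: "h \<in> carrier H \<Longrightarrow> k \<in> carrier H \<Longrightarrow> p \<in> points M \<Longrightarrow> \<Phi> (h \<otimes>\<^bsub>H\<^esub> k) p = \<Phi> h (\<Phi> k p)"
  using group_action.composition_rule[OF act_facts(1)] by blast

lemma act_map: "h \<in> carrier H \<Longrightarrow> smooth_map M M (\<Phi> h)"
  by (rule action_smooth[OF lie_facts(2) M act_facts(4)]) (simp add: lie_facts(3))

lemma \<sigma>_in: "s > 0 \<Longrightarrow> \<sigma> s \<in> carrier H"
  using \<sigma>_hom unfolding hom_def positive_reals_def by auto

definition flow :: "real \<Rightarrow> 'a \<Rightarrow> 'a" where
  "flow s p = \<Phi> (\<sigma> s) p"

lemma flow_in: "s > 0 \<Longrightarrow> p \<in> points M \<Longrightarrow> flow s p \<in> points M"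
  unfolding flow_def by (rule act_in[OF \<sigma>_in])

lemma flow_mult: "s > 0 \<Longrightarrow> r > 0 \<Longrightarrow> p \<in> points M \<Longrightarrow> flow (s * r) p = flow s (flow r p)"
proof -
  assume sr: "s > 0" "r > 0" and p: "p \<in> points M"
  have "\<sigma> (s * r) = \<sigma> s \<otimes>\<^bsub>H\<^esub> \<sigma> r" using \<sigma>_hom sr unfolding hom_def positive_reals_def by auto
  then show ?thesis unfolding flow_def using act_mult[OF \<sigma>_in \<sigma>_in p] sr by simp
qed

lemma flow_one: "p \<in> points M \<Longrightarrow> flow 1 p = p"
proof -
  assume p: "p \<in> points M"
  have "group_hom positive_reals H \<sigma>"
    unfolding group_hom_def group_hom_axioms_def using group_positive_reals lie_facts(1) \<sigma>_hom by blast
  then have "\<sigma> 1 = \<one>\<^bsub>H\<^esub>" using group_hom.hom_one[of positive_reals H \<sigma>] by (simp add: positive_reals_def)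
  then show ?thesis unfolding flow_def using action_one[OF act_facts(1) p] by simp
qed

text \<open>Centrality of \<sigma> enters here: the flow commutes with the whole group
  action.\<close>

lemma flow_act: "s > 0 \<Longrightarrow> h \<in> carrier H \<Longrightarrow> p \<in> points M \<Longrightarrow> flow s (\<Phi> h p) = \<Phi> h (flow s p)"
  unfolding flow_def using \<sigma>_central act_mult[OF \<sigma>_in] act_mult[OF _ \<sigma>_in] by metis

lemma flow_map: "s > 0 \<Longrightarrow> smooth_map M M (flow s)"
  unfolding flow_def[abs_def] by (rule act_map[OF \<sigma>_in])

lemma smooth_map_flow:
  assumes P: "smooth_manifold P" and s: "smooth_map P rpos s" and f: "smooth_map P M f"
  shows "smooth_map P M (\<lambda>z. flow (s z) (f z))"
  unfolding flow_def
  by (rule smooth_map_apply2[OF P lie_facts(2) M M act_facts(4) smooth_map_compose[OF P smooth_manifold_rpos lie_facts(2) s \<sigma>_smooth] f])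

lemma smooth_map_orbit:
  assumes p: "p \<in> points M"
  shows "smooth_map rpos M (\<lambda>s. flow s p)"
  by (rule smooth_map_flow[OF smooth_manifold_rpos smooth_map_id[OF smooth_manifold_rpos] smooth_map_const[OF smooth_manifold_rpos M p]])

lemma \<xi>_apply:
  assumes "smooth_near M p f"
  shows "\<xi> p f = deriv (\<lambda>s. f (flow s p)) 1"
  using assms \<xi>[OF smooth_near_point[OF assms]] by (simp add: flow_def)

text \<open>\<open>deriv\<close> returns a value whether or not a derivative exists; smoothness of
  the orbit guarantees that here it does.\<close>

lemma \<xi>_DERIV:
  assumes p: "p \<in> points M" and f: "smooth_near M p f"
  shows "((\<lambda>s. f (flow s p)) has_real_derivative \<xi> p f) (at 1)"
proof -
  have "smooth_near rpos 1 (\<lambda>s. f (flow s p))"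
    by (rule smooth_near_pull[OF smooth_manifold_rpos M smooth_map_orbit[OF p], where f = f])
      (use f flow_one[OF p] in simp_all)
  from real_smooth_near_pd[OF _ _ this] have d: "\<exists>D. ((\<lambda>s. f (flow s p)) has_real_derivative D) (at 1)" by auto
  then obtain D where D: "((\<lambda>s. f (flow s p)) has_real_derivative D) (at 1)" by blast
  then show ?thesis using \<xi>_apply[OF f] DERIV_imp_deriv[OF D] by simp
qed

text \<open>Exhibits \<open>\<xi> p\<close> as the velocity of a smooth curve, hence as an element
  of the tangent space.\<close>

lemma \<xi>_push:
  assumes p: "p \<in> points M"
  shows "\<xi> p = pushforward M (\<lambda>s. flow s p) 1 (coord_vec rpos ({0<..}, rchart) 1 0)"
proof
  fix f
  show "\<xi> p f = pushforward M (\<lambda>s. flow s p) 1 (coord_vec rpos ({0<..}, rchart) 1 0) f"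
  proof (cases "smooth_near M p f")
    case True
    have "smooth_near rpos 1 (\<lambda>s. f (flow s p))"
      by (rule smooth_near_pull[OF smooth_manifold_rpos M smooth_map_orbit[OF p], where f = f])
        (use True flow_one[OF p] in simp_all)
    from coord_vec_real[OF _ _ this] show ?thesis
      using True by (simp add: pushforward_def flow_one[OF p] \<xi>_apply)
  next
    case False
    then show ?thesis using \<xi>[OF p] by (simp add: pushforward_def flow_one[OF p])
  qed
qed

lemma \<xi>_tangent: "p \<in> points M \<Longrightarrow> \<xi> p \<in> tangent_space M p"
  using pushforward_tangent[OF smooth_manifold_rpos M smooth_map_orbit coord_vec_real_tangent, of p 1]
  by (simp add: \<xi>_push flow_one)

text \<open>The flow commutes with \<open>\<Phi> h\<close>, which therefore maps orbits to orbits
  with their parametrization, and so velocities to velocities.\<close>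

lemma \<xi>_act:
  assumes h: "h \<in> carrier H" and p: "p \<in> points M"
  shows "pushforward M (\<Phi> h) p (\<xi> p) = \<xi> (\<Phi> h p)"
proof
  fix f
  show "pushforward M (\<Phi> h) p (\<xi> p) f = \<xi> (\<Phi> h p) f"
  proof (cases "smooth_near M (\<Phi> h p) f")
    case True
    have sm: "smooth_near M p (\<lambda>q. f (\<Phi> h q))" by (rule smooth_near_pull[OF M M act_map[OF h] p True])
    have ev: "\<forall>\<^sub>F s in nhds 1. f (flow s (\<Phi> h p)) = f (\<Phi> h (flow s p))"
    proof -
      have "\<forall>\<^sub>F s :: real in nhds 1. s \<in> {0<..}" by (rule eventually_nhds_in_open) auto
      then show ?thesis by eventually_elim (use flow_act[OF _ h p] in simp)
    qed
    have "((\<lambda>s. f (flow s (\<Phi> h p))) has_real_derivative \<xi> p (\<lambda>q. f (\<Phi> h q))) (at 1)"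
      using \<xi>_DERIV[OF p sm] DERIV_cong_ev[OF refl ev refl] by blast
    then show ?thesis
      using DERIV_unique \<xi>_DERIV[OF act_in[OF h p] True] True by (simp add: pushforward_def)
  next
    case False
    then show ?thesis using \<xi>[OF act_in[OF h p]] by (simp add: pushforward_def)
  qed
qed

text \<open>\<open>\<xi> q f\<close> is the derivative in the first coordinate of the function
  f(flow s q) on the product of the positive reals with M, taken at s = 1. A coordinate derivative
  of a smooth function is smooth, and so is its restriction to the slice s = 1.\<close>

lemma \<xi>_smooth:
  assumes p: "p \<in> points M" and f: "smooth_near M p f"
  shows "smooth_near M p (\<lambda>q. \<xi> q f)"
proof -
  note R = smooth_manifold_rpos
  note PM = smooth_manifold_prod[OF R M]
  obtain U \<phi> where c: "(U, \<phi>) \<in> atlas M" "p \<in> U" using chart_ex[OF M p] .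
  let ?Q = "{0<..} \<times> U" and ?\<omega> = "pchart 1 rchart \<phi>" and ?h = "\<lambda>z. f (flow (fst z) (snd z))"
  have pc: "(?Q, ?\<omega>) \<in> atlas (prod_mfd rpos M)" using prod_chart[OF _ c(1), of "{0<..}" rchart rpos] by simp
  have fl: "smooth_map (prod_mfd rpos M) M (\<lambda>z. flow (fst z) (snd z))"
    by (rule smooth_map_flow[OF PM smooth_map_fst[OF R M] smooth_map_snd[OF R M]])
  have sh: "smooth_near (prod_mfd rpos M) (1, q) ?h" if "q \<in> points M" "smooth_near M q f" for q
    by (rule smooth_near_pull[OF PM M fl, where f = f]) (use that flow_one[OF that(1)] in simp_all)
  have "smooth_near (prod_mfd rpos M) (1, p) (\<lambda>z. coord_vec (prod_mfd rpos M) (?Q, ?\<omega>) z 0 ?h)"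
    by (rule coord_vec_smooth[OF PM pc _ _ sh[OF p f]]) (use c(2) in simp_all)
  then have "smooth_near M p (\<lambda>q. coord_vec (prod_mfd rpos M) (?Q, ?\<omega>) (1, q) 0 ?h)"
    by (intro smooth_near_pull[OF M PM _ p, where F = "\<lambda>q. (1, q)" and f = "\<lambda>z. coord_vec (prod_mfd rpos M) (?Q, ?\<omega>) z 0 ?h"]
        smooth_map_pair[OF M R M smooth_map_const[OF M R] smooth_map_id[OF M]]) simp_all
  moreover obtain W where W: "openin (mtop M) W" "p \<in> W" "\<forall>q\<in>W. smooth_near M q f" using smooth_near_nbhd[OF f] by blast
  ultimately show ?thesis
  proof (rule_tac smooth_near_cong[OF M])
    show "openin (mtop M) (U \<inter> W)" using chart_open[OF M c(1)] W(1) by blast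
    show "p \<in> U \<inter> W" using c(2) W(2) by blast
    fix q assume q: "q \<in> U \<inter> W"
    have qM: "q \<in> points M" using q chart_subset[OF M c(1)] by blast
    have fq: "smooth_near M q f" using q W(3) by blast
    have d: "((\<lambda>s. f (flow s q)) has_real_derivative \<xi> q f) (at 1)" by (rule \<xi>_DERIV[OF qM fq])
    \<comment> \<open>Coordinate 0 of the product chart is the flow parameter s, so varying it alone
      follows the orbit of q.\<close>
    have ev: "\<forall>\<^sub>F s in nhds 1. ?h (inv_into ?Q ?\<omega> ((?\<omega> (1, q))(0 := s))) = f (flow s q)"
    proof -
      have "\<forall>\<^sub>F s :: real in nhds 1. s \<in> {0<..}" by (rule eventually_nhds_in_open) auto
      then show ?thesis
      proof eventually_elim
        case (elim s)
        have "(?\<omega> (1, q))(0 := s) = ?\<omega> (s, q)" by (auto simp: pchart_def fun_eq_iff)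
        moreover have "inv_into ?Q ?\<omega> (?\<omega> (s, q)) = (s, q)"
          by (rule chart_inv[OF PM pc]) (use elim q in auto)
        ultimately show ?case by simp
      qed
    qed
    have "((\<lambda>s. ?h (inv_into ?Q ?\<omega> ((?\<omega> (1, q))(0 := s)))) has_real_derivative \<xi> q f) (at 1)"
      by (rule DERIV_cong_ev[OF refl ev refl, THEN iffD2, OF d])
    moreover have "?\<omega> (1, q) 0 = 1" by (simp add: pchart_def)
    ultimately have "pd 0 (\<lambda>x. ?h (inv_into ?Q ?\<omega> x)) (?\<omega> (1, q)) = \<xi> q f"
      by (intro pd_eqI) (simp only:)
    then show "coord_vec (prod_mfd rpos M) (?Q, ?\<omega>) (1, q) 0 ?h = \<xi> q f"
      using sh[OF qM fq] by (simp add: coord_vec_def)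
  qed
qed

definition F :: "'a \<Rightarrow> real" where
  "F q = g q (\<xi> q) (\<xi> q)"

lemma F_pos: "p \<in> points M \<Longrightarrow> F p > 0"
  unfolding F_def by (rule spacelike)

lemma F_smooth:
  assumes p: "p \<in> points M"
  shows "smooth_near M p F"
proof -
  obtain U \<phi> where c: "(U, \<phi>) \<in> atlas M" "p \<in> U" using chart_ex[OF M p] .
  show ?thesis unfolding F_def[abs_def]
    by (rule sym_form_along[where F = "\<lambda>q. q" and Y = \<xi> and Z = \<xi>, OF M M smooth_map_id[OF M] sym openin_topspace p c])
      (use \<xi>_tangent \<xi>_smooth[OF p smooth_near_coord[OF M c]] in simp_all)
qed

lemma scales_apply:
  assumes "h \<in> carrier H" "p \<in> points M" "u \<in> tangent_space M p" "v \<in> tangent_space M p"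
  shows "g (\<Phi> h p) (pushforward M (\<Phi> h) p u) (pushforward M (\<Phi> h) p v) = (\<mu> h)\<^sup>2 * g p u v"
  using scales[OF assms(1)] assms(2-) unfolding scales_metric_def by blast

text \<open>Since \<open>\<xi>\<close> is invariant under H, its squared length F transforms by the character, so that
  the level sets of F are global sections of the flow of \<open>\<xi>\<close>.\<close>

lemma F_act:
  assumes "h \<in> carrier H" "p \<in> points M"
  shows "F (\<Phi> h p) = (\<mu> h)\<^sup>2 * F p"
  unfolding F_def \<xi>_act[OF assms, symmetric]
  by (rule scales_apply[OF assms \<xi>_tangent[OF assms(2)] \<xi>_tangent[OF assms(2)]])

lemma F_flow: "s > 0 \<Longrightarrow> p \<in> points M \<Longrightarrow> F (flow s p) = s\<^sup>2 * F p"
  unfolding flow_def using F_act[OF \<sigma>_in] \<sigma>_\<mu> by simp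

lemma \<xi>_F:
  assumes p: "p \<in> points M"
  shows "\<xi> p F = 2 * F p"
proof -
  have "\<forall>\<^sub>F s :: real in nhds 1. s \<in> {0<..}" by (rule eventually_nhds_in_open) auto
  then have ev: "\<forall>\<^sub>F s in nhds 1. F (flow s p) = s\<^sup>2 * F p"
    by eventually_elim (use F_flow[OF _ p] in simp)
  have "((\<lambda>s. s\<^sup>2 * F p) has_real_derivative 2 * F p) (at 1)" by (auto intro!: derivative_eq_intros)
  then have "((\<lambda>s. F (flow s p)) has_real_derivative 2 * F p) (at 1)"
    using DERIV_cong_ev[OF refl ev refl] by blast
  then show ?thesis using DERIV_unique \<xi>_DERIV[OF p F_smooth[OF p]] by blast
qed

sublocale regular_level M F 1
proof
  show "smooth_manifold M" by (rule M)
  show "smooth_near M p F" if "p \<in> points M" for p by (rule F_smooth[OF that])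
  fix p assume p: "p \<in> points M" and F1: "F p = 1"
  obtain U \<phi> where c: "(U, \<phi>) \<in> atlas M" "p \<in> U" using chart_ex[OF M p] .
  have "\<xi> p F = (\<Sum>i<mdim M. \<xi> p (\<lambda>q. \<phi> q i) * coord_vec M (U, \<phi>) p i F)"
    by (rule fun_cong[OF tangent_coords[OF M \<xi>_tangent[OF p] c]])
  moreover have "\<xi> p F \<noteq> 0" using \<xi>_F[OF p] F1 by simp
  \<comment> \<open>Since \<xi> differentiates F to 2, not all coordinate derivatives of F can
    vanish.\<close>
  ultimately have "\<exists>i\<in>{..<mdim M}. \<xi> p (\<lambda>q. \<phi> q i) * coord_vec M (U, \<phi>) p i F \<noteq> 0"
    by (metis (no_types, lifting) sum.neutral)
  then show "\<exists>U \<phi> i. (U, \<phi>) \<in> atlas M \<and> p \<in> U \<and> i < mdim M \<and> coord_vec M (U, \<phi>) p i F \<noteq> 0"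
    using c by auto
qed

abbreviation N :: "'a mfd" where
  "N \<equiv> level_mfd M F 1"

lemma N: "smooth_manifold N"
  by (rule level_manifold)

lemma points_N: "p \<in> points N \<longleftrightarrow> p \<in> points M \<and> F p = 1"
  unfolding points_level by simp

text \<open>The flow at parameter s multiplies F by the square of s, so the parameter F^(-1/2) leads
  to the level 1. It is written with \<open>exp\<close> and \<open>ln\<close>, whose smoothness is
  established above.\<close>

definition proj :: "'a \<Rightarrow> 'a" where
  "proj q = flow (exp (- (ln (F q) / 2))) q"

lemma exp_F:
  assumes "q \<in> points M"
  shows "(exp (- (ln (F q) / 2)))\<^sup>2 * F q = 1"
proof -
  have "(exp (- (ln (F q) / 2)))\<^sup>2 = exp (- ln (F q))"
    unfolding power2_eq_square exp_add[symmetric] by simp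
  then show ?thesis using F_pos[OF assms] by (simp add: exp_minus)
qed

lemma proj_in: "q \<in> points M \<Longrightarrow> proj q \<in> points N"
  unfolding points_N proj_def using flow_in F_flow exp_F by simp

lemma lnF_smooth: "q \<in> points M \<Longrightarrow> smooth_near M q (\<lambda>q. a * ln (F q))"
  by (rule smooth_near_mult[OF M smooth_near_const[OF M] smooth_near_ln[OF M F_smooth F_pos]])

lemma proj_smooth: "smooth_map M N proj"
proof (rule level_smooth_into[OF M])
  have "smooth_map M rpos (\<lambda>q. exp (- 1 / 2 * ln (F q)))"
    by (rule smooth_map_into_real[OF M], simp, rule conjI[OF smooth_near_exp[OF M lnF_smooth]]) simp_all
  from smooth_map_flow[OF M this smooth_map_id[OF M]]
  show "smooth_map M M proj" unfolding proj_def[abs_def] by simp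
qed (use proj_in points_N in blast)

lemma proj_id: "q \<in> points N \<Longrightarrow> proj q = q"
  unfolding points_N proj_def using flow_one by simp

text \<open>N is the image of the connected space M under the continuous map \<open>proj\<close>,
  which fixes the points of N.\<close>

lemma connected_N: "connected_manifold N"
  unfolding connected_manifold_def
proof (intro conjI N)
  show "points N \<noteq> {}" using nonempty proj_in by blast
  have "connectedin (mtop N) (proj ` points M)"
    by (rule connectedin_continuous_map_image[OF smooth_map_continuous[OF proj_smooth]])
      (use connected connectedin_topspace in blast)
  moreover have "proj ` points M = points N"
  proof
    show "proj ` points M \<subseteq> points N" using proj_in by blast
    show "points N \<subseteq> proj ` points M"
    proof
      fix q assume q: "q \<in> points N"
      then have "q \<in> points M" unfolding points_N by simp
      then show "q \<in> proj ` points M" by (rule image_eqI[where f = proj, OF proj_id[OF q, symmetric]])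
    qed
  qed
  ultimately show "connected_space (mtop N)" by (simp only: connectedin_topspace)
qed

text \<open>N and M share points but not tangent vectors: as operators they differ on functions that
  are smooth along N without being smooth on M.\<close>

abbreviation \<iota> :: "'a \<Rightarrow> 'a tvec \<Rightarrow> 'a tvec" where
  "\<iota> \<equiv> pushforward M (\<lambda>q. q)"

definition gN :: "'a metric_tensor" where
  "gN p u v = g p (\<iota> p u) (\<iota> p v)"

definition \<theta> :: "'a one_form" where
  "\<theta> p u = g p (\<xi> p) (\<iota> p u)"

lemma \<iota>_tangent: "u \<in> tangent_space N p \<Longrightarrow> \<iota> p u \<in> tangent_space M p"
  by (rule pushforward_tangent[OF N M level_inclusion])

lemma gN_sym: "smooth_symmetric_form N gN"
  unfolding gN_def[abs_def] by (rule pull_sym_form[OF N M level_inclusion sym])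

text \<open>Definiteness passes to N because the inclusion is an immersion. The restriction of an
  indefinite metric could degenerate.\<close>

lemma gN_pos:
  assumes u: "u \<in> tangent_space N p" "u \<noteq> (\<lambda>f. 0)"
  shows "gN p u u > 0"
proof -
  have "p \<in> points M" using tangent_point[OF N u(1)] points_N by blast
  then show ?thesis unfolding gN_def using pos[OF _ \<iota>_tangent[OF u(1)]] level_pushforward_zero[OF u(1)] u(2) by blast
qed

lemma gN_nondegenerate: "nondegenerate N gN"
  unfolding nondegenerate_def using gN_pos by (metis less_irrefl)

text \<open>The form g(\<xi>, .) is smooth on all of M, where the components of \<xi> are at hand;
  \<theta> is its pullback.\<close>

lemma \<theta>_smooth: "smooth_one_form N \<theta>"
proof -
  have "smooth_one_form M (\<lambda>p u. g p (\<xi> p) u)"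
    unfolding smooth_one_form_iff[OF M]
  proof (intro conjI ballI allI impI)
    show "linear_form (tangent_space M p) (\<lambda>u. g p (\<xi> p) u)" if "p \<in> points M" for p
      by (rule sym_form_linear[OF sym that \<xi>_tangent[OF that]])
    fix U \<phi> i p assume c: "(U, \<phi>) \<in> atlas M" and i: "i < mdim M" and p: "p \<in> U"
    have pM: "p \<in> points M" using p chart_subset[OF M c] by blast
    show "smooth_near M p (\<lambda>q. g q (\<xi> q) (coord_vec M (U, \<phi>) q i))"
    proof (rule sym_form_along[OF M M smooth_map_id[OF M] sym chart_open[OF M c] p c p])
      show "\<xi> q \<in> tangent_space M q" if "q \<in> U" for q using \<xi>_tangent that chart_subset[OF M c] by blast
      show "coord_vec M (U, \<phi>) q i \<in> tangent_space M q" if "q \<in> U" for q by (rule coord_vec_tangent[OF c that i])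
      show "smooth_near M p (\<lambda>q. \<xi> q (\<lambda>r. \<phi> r k))" for k by (rule \<xi>_smooth[OF pM smooth_near_coord[OF M c p]])
      show "smooth_near M p (\<lambda>q. coord_vec M (U, \<phi>) q i (\<lambda>r. \<phi> r k))" for k
        by (rule coord_vec_smooth[OF M c p i smooth_near_coord[OF M c p]])
    qed
  qed
  from pull_one_form[OF N M level_inclusion this] show ?thesis unfolding \<theta>_def[abs_def] .
qed

text \<open>The map \<open>(x, p) \<mapsto> flow (e\<^sup>x) p\<close> is the inverse of the isometry onto \<open>\<M>\<^bsub>2,\<Q>\<^esub>\<close>.\<close>

definition emb :: "real \<times> 'a \<Rightarrow> 'a" where
  "emb z = flow (exp (fst z)) (snd z)"

text \<open>The coordinate x is half of ln F because F equals e^{2x} at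
  \<open>emb (x, p)\<close>.\<close>

definition coord :: "'a \<Rightarrow> real \<times> 'a" where
  "coord q = (ln (F q) / 2, proj q)"

lemma emb_smooth: "smooth_map (MQ N) M emb"
proof -
  note MQ = smooth_manifold_MQ[OF N]
  have "smooth_map (MQ N) rpos (\<lambda>z. exp (fst z))"
  proof (rule smooth_map_into_real[OF MQ], simp, rule conjI)
    fix z assume z: "z \<in> points (MQ N)"
    show "smooth_near (MQ N) z (\<lambda>z. exp (fst z))"
      by (rule smooth_near_exp[OF MQ smooth_near_of_real_map[OF MQ open_UNIV smooth_map_fst[OF smooth_manifold_rline N] z]])
  qed simp
  from smooth_map_flow[OF MQ this smooth_map_compose[OF MQ N M smooth_map_snd[OF smooth_manifold_rline N] level_inclusion]]
  show ?thesis unfolding emb_def[abs_def] .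
qed

lemma coord_smooth: "smooth_map M (MQ N) coord"
  unfolding coord_def[abs_def]
proof (rule smooth_map_pair[OF M smooth_manifold_rline N _ proj_smooth])
  show "smooth_map M rline (\<lambda>q. ln (F q) / 2)"
    by (rule smooth_map_into_real[OF M open_UNIV]) (use lnF_smooth[where a = "1 / 2"] in simp)
qed

lemma emb_coord: "q \<in> points M \<Longrightarrow> emb (coord q) = q"
  unfolding emb_def coord_def proj_def
  using flow_mult[of "exp (ln (F q) / 2)" "exp (- (ln (F q) / 2))" q] flow_one
  by (simp add: exp_add[symmetric])

lemma F_emb: "p \<in> points N \<Longrightarrow> F (emb (x, p)) = exp (2 * x)"
  unfolding emb_def points_N using F_flow[of "exp x" p] by (simp add: power2_eq_square exp_add[symmetric])

lemma coord_emb: "z \<in> points (MQ N) \<Longrightarrow> coord (emb z) = z"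
proof -
  assume z: "z \<in> points (MQ N)"
  obtain x p where xp: "z = (x, p)" by (cases z)
  have p: "p \<in> points N" using z xp by simp
  have "proj (emb z) = flow (exp (- x)) (flow (exp x) p)"
    unfolding proj_def xp F_emb[OF p] by (simp add: emb_def)
  also have "\<dots> = p"
    using flow_mult[of "exp (- x)" "exp x" p] flow_one[of p] p points_N by (simp add: exp_add[symmetric])
  finally show ?thesis unfolding coord_def using F_emb[OF p] by (simp add: xp)
qed

lemma coord_diffeo: "diffeomorphism M (MQ N) coord"
  by (rule diffeomorphismI[OF M smooth_manifold_MQ[OF N] coord_smooth emb_smooth emb_coord coord_emb])

text \<open>The flow is parametrized multiplicatively and x additively: the substitution r =
  e^{s-x}, of derivative 1 at s = x, makes the line through (x, p) the orbit of
  \<open>emb (x, p)\<close> started at r = 1.\<close>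

lemma push_emb_dX:
  assumes p: "p \<in> points N"
  shows "pushforward M emb (x, p) (dX N x p) = \<xi> (emb (x, p))"
proof
  fix f
  have pM: "p \<in> points M" using p points_N by blast
  have ep: "emb (x, p) \<in> points M" unfolding emb_def using flow_in pM by simp
  show "pushforward M emb (x, p) (dX N x p) f = \<xi> (emb (x, p)) f"
  proof (cases "smooth_near M (emb (x, p)) f")
    case True
    have sm: "smooth_near (MQ N) (x, p) (\<lambda>z. f (emb z))"
      by (rule smooth_near_pull[OF smooth_manifold_MQ[OF N] M emb_smooth _ True]) (use p in simp)
    have "((\<lambda>s. f (emb (s, p))) has_real_derivative dX N x p (\<lambda>z. f (emb z))) (at x)"
      by (rule dX_DERIV[OF N p sm])
    moreover have "((\<lambda>s. f (emb (s, p))) has_real_derivative \<xi> (emb (x, p)) f) (at x)"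
    proof -
      have "((\<lambda>r. f (flow r (emb (x, p)))) has_real_derivative \<xi> (emb (x, p)) f) (at (exp (x - x)))"
        using \<xi>_DERIV[OF ep True] by simp
      moreover have "((\<lambda>s. exp (s - x)) has_real_derivative 1) (at x)" by (auto intro!: derivative_eq_intros)
      ultimately have "((\<lambda>s. f (flow (exp (s - x)) (emb (x, p)))) has_real_derivative \<xi> (emb (x, p)) f * 1) (at x)"
        by (rule DERIV_chain2)
      moreover have "flow (exp (s - x)) (emb (x, p)) = emb (s, p)" for s
        unfolding emb_def using flow_mult[of "exp (s - x)" "exp x" p] pM by (simp add: exp_add[symmetric])
      ultimately show ?thesis by simp
    qed
    ultimately show ?thesis using DERIV_unique True by (simp add: pushforward_def)
  next
    case False
    then show ?thesis using \<xi>[OF ep] by (simp add: pushforward_def)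
  qed
qed

text \<open>As \<xi> is invariant under the flow, both components of w are images under the one map
  \<open>flow (exp x)\<close>. A computation at \<open>emb (x, p)\<close> thus becomes one at p, up
  to the scaling of the metric.\<close>

lemma push_emb:
  assumes w: "w \<in> tangent_space (MQ N) (x, p)"
  shows "pushforward M emb (x, p) w =
    pushforward M (flow (exp x)) p (\<lambda>f. w fst * \<xi> p f + 1 * \<iota> p (pushforward N snd (x, p) w) f)"
proof -
  note MQ = smooth_manifold_MQ[OF N]
  have p: "p \<in> points N" using tangent_point[OF MQ w] by simp
  then have pM: "p \<in> points M" using points_N by blast
  let ?w = "pushforward N snd (x, p) w"
  have wT: "?w \<in> tangent_space N p" using pushforward_tangent[OF MQ N smooth_map_snd[OF smooth_manifold_rline N] w] by simp
  have "pushforward M emb (x, p) (pushforward (MQ N) (\<lambda>q. (x, q)) p ?w) = pushforward M (\<lambda>q. emb (x, q)) p ?w"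
    by (rule pushforward_compose[where F = "\<lambda>q. (x, q)" and p = p, OF MQ M emb_smooth]) (use p in simp)
  also have "\<dots> = pushforward M (\<lambda>q. flow (exp x) q) p ?w" by (simp add: emb_def)
  also have "\<dots> = pushforward M (flow (exp x)) p (\<iota> p ?w)"
    by (rule pushforward_compose[where F = "\<lambda>q. q" and p = p, OF M M flow_map pM, symmetric]) simp
  finally have 1: "pushforward M emb (x, p) (pushforward (MQ N) (\<lambda>q. (x, q)) p ?w) = pushforward M (flow (exp x)) p (\<iota> p ?w)" .
  have 2: "pushforward M emb (x, p) (dX N x p) = pushforward M (flow (exp x)) p (\<xi> p)"
    unfolding push_emb_dX[OF p] using \<xi>_act[OF \<sigma>_in pM, of "exp x"] by (simp add: flow_def[abs_def] emb_def)
  have "pushforward M emb (x, p) w = pushforward M emb (x, p)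
      (\<lambda>f. w fst * dX N x p f + 1 * pushforward (MQ N) (\<lambda>q. (x, q)) p ?w f)"
    by (rule arg_cong[OF MQ_tangent_decomp[OF N w]])
  then show ?thesis unfolding pushforward_lincomb 1 2 .
qed

text \<open>The flow at e^x scales the metric by e^{2x}, which is the conformal factor for t = 2. At
  p the product is expanded bilinearly: g(\<xi>,\<xi>) = F = 1 gives dx^2, the mixed terms give
  \<theta>, and the rest is the metric of N.\<close>

lemma gQ_emb:
  assumes u: "u \<in> tangent_space (MQ N) z" and v: "v \<in> tangent_space (MQ N) z"
  shows "g (emb z) (pushforward M emb z u) (pushforward M emb z v) = gQ 2 N gN \<theta> z u v"
proof -
  note MQ = smooth_manifold_MQ[OF N]
  obtain x p where z: "z = (x, p)" by (cases z)
  have p: "p \<in> points N" using tangent_point[OF MQ u] z by simp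
  then have pM: "p \<in> points M" and Fp: "F p = 1" using points_N by blast+
  have wT: "pushforward N snd (x, p) w \<in> tangent_space N p" if "w \<in> tangent_space (MQ N) z" for w
    using pushforward_tangent[OF MQ N smooth_map_snd[OF smooth_manifold_rline N] that] z by simp
  let ?u = "\<iota> p (pushforward N snd (x, p) u)" and ?v = "\<iota> p (pushforward N snd (x, p) v)"
  have uT: "?u \<in> tangent_space M p" and vT: "?v \<in> tangent_space M p" using \<iota>_tangent wT u v by blast+
  note xT = \<xi>_tangent[OF pM]
  let ?U = "\<lambda>f. u fst * \<xi> p f + 1 * ?u f" and ?V = "\<lambda>f. v fst * \<xi> p f + 1 * ?v f"
  have UT: "?U \<in> tangent_space M p" and VT: "?V \<in> tangent_space M p"
    by (rule tangent_lincomb[OF M xT uT], rule tangent_lincomb[OF M xT vT])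
  have "g (emb z) (pushforward M emb z u) (pushforward M emb z v) = (exp x)\<^sup>2 * g p ?U ?V"
    using scales_apply[OF \<sigma>_in pM UT VT, of "exp x"] \<sigma>_\<mu>[of "exp x"]
    unfolding z push_emb[OF u[unfolded z]] push_emb[OF v[unfolded z]] by (simp add: flow_def[abs_def] emb_def)
  also have "g p ?U ?V = u fst * g p (\<xi> p) ?V + 1 * g p ?u ?V"
    by (rule linear_form_lincomb[OF sym_form_linear1[OF M sym pM VT] xT uT])
  also have "g p (\<xi> p) ?V = v fst * g p (\<xi> p) (\<xi> p) + 1 * g p (\<xi> p) ?v"
    by (rule linear_form_lincomb[OF sym_form_linear[OF sym pM xT] xT vT])
  also have "g p ?u ?V = v fst * g p ?u (\<xi> p) + 1 * g p ?u ?v"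
    by (rule linear_form_lincomb[OF sym_form_linear[OF sym pM uT] xT vT])
  also have "g p ?u (\<xi> p) = g p (\<xi> p) ?u" by (rule sym_form_sym[OF sym pM uT xT])
  finally show ?thesis
    using Fp unfolding gQ_eq z gN_def \<theta>_def F_def
    by (simp add: power2_eq_square exp_add[symmetric] algebra_simps)
qed

text \<open>Follows from the computation for \<open>emb\<close>, because the differential of
  \<open>emb\<close> undoes that of \<open>coord\<close>.\<close>

lemma coord_isometry: "scales_metric M g (MQ N) (gQ 2 N gN \<theta>) coord 1"
  unfolding scales_metric_def
proof (intro ballI)
  fix p u v assume p: "p \<in> points M" and u: "u \<in> tangent_space M p" and v: "v \<in> tangent_space M p"
  note MQ = smooth_manifold_MQ[OF N]
  have retr: "pushforward M emb (coord p) (pushforward (MQ N) coord p w) = w" if w: "w \<in> tangent_space M p" for w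
  proof -
    have "pushforward M emb (coord p) (pushforward (MQ N) coord p w) = pushforward M (\<lambda>q. emb (coord q)) p w"
      by (rule pushforward_compose[where F = coord and p = p, OF MQ M emb_smooth smooth_map_in[OF coord_smooth p]])
    also have "\<dots> = pushforward M (\<lambda>q. q) p w"
      by (rule pushforward_cong[OF M w openin_topspace p]) (rule emb_coord)
    finally show ?thesis using pushforward_id[OF w] by simp
  qed
  have "gQ 2 N gN \<theta> (coord p) (pushforward (MQ N) coord p u) (pushforward (MQ N) coord p v) =
      g (emb (coord p)) (pushforward M emb (coord p) (pushforward (MQ N) coord p u))
        (pushforward M emb (coord p) (pushforward (MQ N) coord p v))"
    by (rule gQ_emb[OF pushforward_tangent[OF M MQ coord_smooth u] pushforward_tangent[OF M MQ coord_smooth v], symmetric])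
  then show "gQ 2 N gN \<theta> (coord p) (pushforward (MQ N) coord p u) (pushforward (MQ N) coord p v) = 1\<^sup>2 * g p u v"
    using retr[OF u] retr[OF v] emb_coord[OF p] by simp
qed

text \<open>If \<open>\<theta>\<close> had norm 1 at p, then \<open>\<xi>\<close> would equal its projection to the level set, although F has
  non-zero derivative along \<open>\<xi>\<close>.\<close>

lemma \<theta>_norm:
  assumes p: "p \<in> points N"
  shows "form_norm2 N gN \<theta> p \<noteq> 1"
proof
  assume n1: "form_norm2 N gN \<theta> p = 1"
  have pM: "p \<in> points M" and Fp: "F p = 1" using p points_N by blast+
  let ?d = "dual_vector N gN \<theta> p"
  note d = dual_vector_works[OF N gN_sym gN_nondegenerate p \<theta>_smooth]
  have dd: "g p (\<iota> p ?d) (\<iota> p ?d) = 1" using n1 unfolding form_norm2_def gN_def .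
  have \<xi>d: "g p (\<xi> p) (\<iota> p ?d) = 1" using d(2)[OF d(1)] n1 unfolding form_norm2_def \<theta>_def by simp
  note xT = \<xi>_tangent[OF pM] and dT = \<iota>_tangent[OF d(1)]
  let ?e = "\<lambda>f. 1 * \<xi> p f + (-1) * \<iota> p ?d f"
  have eT: "?e \<in> tangent_space M p" by (rule tangent_lincomb[OF M xT dT])
  have e1: "g p ?e ?e = 1 * g p (\<xi> p) ?e + (-1) * g p (\<iota> p ?d) ?e"
    by (rule linear_form_lincomb[OF sym_form_linear1[OF M sym pM eT] xT dT])
  have e2: "g p (\<xi> p) ?e = 1 * g p (\<xi> p) (\<xi> p) + (-1) * g p (\<xi> p) (\<iota> p ?d)"
    by (rule linear_form_lincomb[OF sym_form_linear[OF sym pM xT] xT dT])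
  have e3: "g p (\<iota> p ?d) ?e = 1 * g p (\<iota> p ?d) (\<xi> p) + (-1) * g p (\<iota> p ?d) (\<iota> p ?d)"
    by (rule linear_form_lincomb[OF sym_form_linear[OF sym pM dT] xT dT])
  have e4: "g p (\<iota> p ?d) (\<xi> p) = g p (\<xi> p) (\<iota> p ?d)" by (rule sym_form_sym[OF sym pM dT xT])
  have "g p ?e ?e = 0" using Fp dd \<xi>d unfolding F_def e1 e2 e3 e4 by simp
  then have "?e = (\<lambda>f. 0)" using pos[OF pM eT] by (metis less_irrefl)
  then have "\<xi> p F = \<iota> p ?d F" by (simp add: fun_eq_iff)
  also have "\<dots> = ?d F" using F_smooth[OF pM] by (simp add: pushforward_def)
  \<comment> \<open>F is constant on N, so every vector tangent to N annihilates it.\<close>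
  also have "\<dots> = ?d (\<lambda>q. 1)"
    by (rule tangent_cong[OF N d(1) openin_topspace p]) (use points_N in blast)
  also have "\<dots> = 0" by (rule tangent_const[OF N d(1)])
  finally show False using \<xi>_F[OF pM] Fp by simp
qed

definition K :: "'h set" where
  "K = kernel H positive_reals \<mu>"

lemma K_iff: "h \<in> K \<longleftrightarrow> h \<in> carrier H \<and> \<mu> h = 1"
  by (auto simp: K_def kernel_def positive_reals_def)

text \<open>Restricted, since an action on the points of N has to consist of maps that are
  extensional there.\<close>

definition actN :: "'h \<Rightarrow> 'a \<Rightarrow> 'a" where
  "actN h = restrict (\<Phi> h) (points N)"

lemma actN_eq: "p \<in> points N \<Longrightarrow> actN h p = \<Phi> h p"
  unfolding actN_def by (rule restrict_apply')

lemma K_in: "h \<in> K \<Longrightarrow> p \<in> points N \<Longrightarrow> \<Phi> h p \<in> points N"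
  unfolding points_N K_iff using act_in[of h p] F_act[of h p] by simp

lemma actN_push:
  assumes h: "h \<in> K" and p: "p \<in> points N" and u: "u \<in> tangent_space N p"
  shows "\<iota> (actN h p) (pushforward N (actN h) p u) = pushforward M (\<Phi> h) p (\<iota> p u)"
proof -
  have pM: "p \<in> points M" and hH: "h \<in> carrier H" using p h points_N K_iff by blast+
  have "\<iota> (actN h p) (pushforward N (actN h) p u) = pushforward M (\<lambda>q. actN h q) p u"
    by (rule pushforward_compose[where F = "actN h" and p = p, OF N M level_inclusion]) (use K_in[OF h p] actN_eq[OF p] in simp)
  also have "\<dots> = pushforward M (\<lambda>q. \<Phi> h q) p u"
    by (rule pushforward_cong[OF N u openin_topspace p]) (rule actN_eq)
  also have "\<dots> = pushforward M (\<Phi> h) p (\<iota> p u)"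
    by (rule pushforward_compose[where F = "\<lambda>q. q" and p = p, OF M M act_map[OF hH] pM, symmetric])
  finally show ?thesis .
qed

lemma Q_structure_N:
  assumes LK: "lie_group (H\<lparr>carrier := K\<rparr>) LK" "connected_space (mtop LK)" "smooth_map LK L (\<lambda>p. p)"
  shows "Q_structure N gN (H\<lparr>carrier := K\<rparr>) LK actN \<theta>"
proof -
  let ?K = "H\<lparr>carrier := K\<rparr>"
  note KL = lie_group_facts[OF LK(1)]
  have ga: "group_action ?K (points N) actN"
  proof (rule group_actionI[OF KL(1)])
    fix h p assume h: "h \<in> carrier ?K" and p: "p \<in> points N"
    show "actN h p \<in> points N" using K_in[of h p] h p actN_eq by simp
    fix k assume k: "k \<in> carrier ?K"
    show "actN (h \<otimes>\<^bsub>?K\<^esub> k) p = actN h (actN k p)"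
      using h k p K_in[of k p] act_mult[of h k p] by (simp add: actN_eq points_N K_iff)
  next
    show "actN h \<in> extensional (points N)" for h unfolding actN_def by simp
    show "actN \<one>\<^bsub>?K\<^esub> p = p" if "p \<in> points N" for p
      using action_one[OF act_facts(1)] that by (simp add: actN_eq points_N)
  qed
  have act: "transitive_effective_action ?K LK N actN"
    unfolding transitive_effective_action_def
  proof (intro conjI)
    show "transitive_action ?K (points N) actN"
      unfolding transitive_action_def transitive_action_axioms_def
    proof (intro conjI ga allI impI)
      fix p q assume p: "p \<in> points N" and q: "q \<in> points N"
      \<comment> \<open>An element of H joins p to q; since F is 1 at both, its character has square
        1 and, being positive, equals 1.\<close>
      obtain h where h: "h \<in> carrier H" "\<Phi> h p = q" using act_facts(3)[of p q] p q points_N by blast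
      have "(\<mu> h)\<^sup>2 = 1" using F_act[OF h(1), of p] h(2) p q by (simp add: points_N)
      then have "\<mu> h = 1" using mu_pos[OF h(1)] by (simp add: power2_eq_1_iff)
      then show "\<exists>h\<in>carrier ?K. actN h p = q" using h p by (intro bexI[of _ h]) (simp_all add: K_iff actN_eq)
    qed
    show "faithful_action ?K (points N) actN"
      unfolding faithful_action_def faithful_action_axioms_def
    proof (intro conjI ga inj_onI)
      fix h k assume h: "h \<in> carrier ?K" and k: "k \<in> carrier ?K" and eq: "actN h = actN k"
      have hH: "h \<in> carrier H" "k \<in> carrier H" using h k by (simp_all add: K_iff)
      have "\<Phi> h = \<Phi> k"
      proof (rule extensionalityI[OF action_extensional[OF act_facts(1) hH(1)] action_extensional[OF act_facts(1) hH(2)]])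
        fix q assume q: "q \<in> points M"
        have pq: "proj q \<in> points N" by (rule proj_in[OF q])
        then have pqM: "proj q \<in> points M" using points_N by blast
        have "\<Phi> h (proj q) = \<Phi> k (proj q)" using fun_cong[OF eq, of "proj q"] actN_eq[OF pq] by simp
        \<comment> \<open>The flow carries \<open>proj q\<close> back to q and commutes with h and
          k, so agreement on N spreads to all of M.\<close>
        then have "flow (exp (ln (F q) / 2)) (\<Phi> h (proj q)) = flow (exp (ln (F q) / 2)) (\<Phi> k (proj q))" by simp
        then have "\<Phi> h (flow (exp (ln (F q) / 2)) (proj q)) = \<Phi> k (flow (exp (ln (F q) / 2)) (proj q))"
          using flow_act[OF exp_gt_zero hH(1) pqM] flow_act[OF exp_gt_zero hH(2) pqM] by simp
        then show "\<Phi> h q = \<Phi> k q" using emb_coord[OF q] by (simp add: emb_def coord_def)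
      qed
      then show "h = k" using act_facts(5) hH unfolding inj_on_def by blast
    qed
    note P = smooth_manifold_prod[OF KL(2) N]
    have s: "smooth_map (prod_mfd LK N) M (\<lambda>z. \<Phi> (fst z) (snd z))"
      by (rule smooth_map_apply2[OF P lie_facts(2) M M act_facts(4) smooth_map_compose[OF P KL(2) lie_facts(2) smooth_map_fst[OF KL(2) N] LK(3)]
            smooth_map_compose[OF P N M smooth_map_snd[OF KL(2) N] level_inclusion]])
    have zKN: "fst z \<in> K" "snd z \<in> points N" if z: "z \<in> points (prod_mfd LK N)" for z
    proof -
      have "z \<in> points LK \<times> points N" using z by (simp only: prod_mfd_simps topspace_prod_topology)
      then show "fst z \<in> K" "snd z \<in> points N" unfolding KL(3) mem_Times_iff by simp_all
    qed
    have in_N: "F (\<Phi> (fst z) (snd z)) = 1" if z: "z \<in> points (prod_mfd LK N)" for z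
      using K_in[OF zKN[OF z]] unfolding points_N by (rule conjunct2)
    show "smooth_map (prod_mfd LK N) N (\<lambda>(h, p). actN h p)"
    proof (rule smooth_map_cong[OF P N level_smooth_into[OF P s in_N]])
      fix z assume z: "z \<in> points (prod_mfd LK N)"
      show "\<Phi> (fst z) (snd z) = (case z of (h, p) \<Rightarrow> actN h p)" unfolding case_prod_beta actN_eq[OF zKN(2)[OF z]] by (rule refl)
    qed
  qed
  show ?thesis unfolding Q_structure_def
  proof (intro conjI ballI act \<theta>_smooth)
    show "pseudo_riemannian N gN"
      unfolding pseudo_riemannian_def using connected_N gN_sym gN_nondegenerate by blast
    show "connected_lie_group ?K LK" unfolding connected_lie_group_def using LK by blast
    fix h assume "h \<in> carrier ?K"
    then have hK: "h \<in> K" and h: "h \<in> carrier H" "\<mu> h = 1" by (simp_all add: K_iff)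
    show "scales_metric N gN N gN (actN h) 1"
      unfolding scales_metric_def
    proof (intro ballI)
      fix p u v assume p: "p \<in> points N" and u: "u \<in> tangent_space N p" and v: "v \<in> tangent_space N p"
      have pM: "p \<in> points M" using p points_N by blast
      show "gN (actN h p) (pushforward N (actN h) p u) (pushforward N (actN h) p v) = 1\<^sup>2 * gN p u v"
        unfolding gN_def actN_push[OF hK p u] actN_push[OF hK p v]
        using scales_apply[OF h(1) pM \<iota>_tangent[OF u] \<iota>_tangent[OF v]] actN_eq[OF p] h(2) by simp
    qed
    fix p u assume p: "p \<in> points N" and u: "u \<in> tangent_space N p"
    have pM: "p \<in> points M" using p points_N by blast
    \<comment> \<open>An element of the kernel preserves g, and it preserves \<xi> by centrality,
      hence also their contraction \<theta>.\<close>
    show "\<theta> (actN h p) (pushforward N (actN h) p u) = \<theta> p u"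
      unfolding \<theta>_def actN_push[OF hK p u]
      using scales_apply[OF h(1) pM \<xi>_tangent[OF pM] \<iota>_tangent[OF u]] actN_eq[OF p] h(2) \<xi>_act[OF h(1) pM] by simp
  qed
qed

lemma isometric_MQ:
  assumes LK: "lie_group (H\<lparr>carrier := K\<rparr>) LK" "connected_space (mtop LK)" "smooth_map LK L (\<lambda>p. p)"
  shows "\<exists>(N' :: 'a mfd) gN' (I' :: 'h monoid) LI' \<alpha>' \<theta>' t'. Q_structure N' gN' I' LI' \<alpha>' \<theta>' \<and>
    (\<forall>p\<in>points N'. form_norm2 N' gN' \<theta>' p \<noteq> 1) \<and> isometric M g (MQ N') (gQ t' N' gN' \<theta>')"
proof (intro exI conjI ballI)
  show "Q_structure N gN (H\<lparr>carrier := K\<rparr>) LK actN \<theta>" by (rule Q_structure_N[OF LK])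
  show "form_norm2 N gN \<theta> p \<noteq> 1" if "p \<in> points N" for p by (rule \<theta>_norm[OF that])
  show "isometric M g (MQ N) (gQ 2 N gN \<theta>)" unfolding isometric_def using coord_diffeo coord_isometry by blast
qed

end

section \<open>Connectedness of the kernel, and the theorem\<close>

text \<open>The inverse of the splitting map, followed by the projection to the second factor, maps
  the connected group L onto the kernel. A \<open>Q_structure\<close> asks for a connected
  group.\<close>

lemma connected_kernel:
  assumes conL: "connected_space (mtop L)" and d: "diffeomorphism (prod_mfd rpos LK) L \<Psi>"
  shows "connected_space (mtop LK)"
proof -
  let ?P = "prod_mfd rpos LK" and ?G = "inv_into (points (prod_mfd rpos LK)) \<Psi>"
  have b: "bij_betw \<Psi> (points ?P) (points L)" and G: "smooth_map L ?P ?G" using d unfolding diffeomorphism_def by blast+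
  have "?G ` points L = points ?P" using bij_betw_inv_into[OF b] unfolding bij_betw_def by blast
  moreover have "connectedin (mtop ?P) (?G ` points L)"
    by (rule connectedin_continuous_map_image[OF smooth_map_continuous[OF G]]) (use conL connectedin_topspace in blast)
  ultimately have "connectedin (mtop ?P) (points ?P)" by simp
  then have "connectedin (mtop LK) (snd ` points ?P)"
    by (rule connectedin_continuous_map_image[rotated]) (simp add: continuous_map_snd)
  moreover have "snd ` points ?P = points LK" by force
  ultimately show ?thesis by (simp only: connectedin_topspace)
qed

theorem theorem1p11:
  fixes N :: "'n mfd" and gN :: "'n metric_tensor"
    and I :: "'i monoid" and LI :: "'i mfd" and \<alpha> :: "'i \<Rightarrow> 'n \<Rightarrow> 'n" and \<theta> :: "'n one_form"
    and t :: real
    and M :: "'a mfd" and g :: "'a metric_tensor"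
    and H :: "'h monoid" and LH :: "'h mfd" and \<Phi> :: "'h \<Rightarrow> 'a \<Rightarrow> 'a" and \<mu> :: "'h \<Rightarrow> real"
    and \<xi> :: "'a \<Rightarrow> 'a tvec"
  shows
    "(Q_structure N gN I LI \<alpha> \<theta> \<longrightarrow>
        (nondegenerate (MQ N) (gQ t N gN \<theta>) \<longleftrightarrow> (\<forall>p\<in>points N. form_norm2 N gN \<theta> p \<noteq> 1)) \<and>
        ((\<forall>p\<in>points N. form_norm2 N gN \<theta> p \<noteq> 1) \<longrightarrow>
           (\<exists>(G :: (real \<times> 'i) monoid) LG \<Psi> \<mu>'.
              homothety_homogeneous (MQ N) (gQ t N gN \<theta>) G LG \<Psi> \<mu>' \<and>
              (t \<noteq> 0 \<longrightarrow> nontrivial_character G \<mu>' \<and> character_splits G LG \<mu>'))))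
     \<and>
     (riemannian M g \<and> homothety_homogeneous M g H LH \<Phi> \<mu> \<and> nontrivial_character H \<mu> \<and>
      \<not> VSI M g \<and> character_splits H LH \<mu> \<and>
      splitting_field M H LH \<Phi> \<mu> \<xi> \<and> spacelike M g \<xi> \<longrightarrow>
        (\<exists>(N' :: 'a mfd) gN' (I' :: 'h monoid) LI' \<alpha>' \<theta>' t'.
           Q_structure N' gN' I' LI' \<alpha>' \<theta>' \<and>
           (\<forall>p\<in>points N'. form_norm2 N' gN' \<theta>' p \<noteq> 1) \<and>
           isometric M g (MQ N') (gQ t' N' gN' \<theta>')))"
proof (intro conjI impI)
  assume Q: "Q_structure N gN I LI \<alpha> \<theta>"
  then have N: "smooth_manifold N" and g: "smooth_symmetric_form N gN" and nd: "nondegenerate N gN"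
    and \<theta>: "smooth_one_form N \<theta>" and L: "lie_group I LI"
    unfolding Q_structure_def pseudo_riemannian_def connected_manifold_def connected_lie_group_def by blast+
  show "nondegenerate (MQ N) (gQ t N gN \<theta>) \<longleftrightarrow> (\<forall>p\<in>points N. form_norm2 N gN \<theta> p \<noteq> 1)"
    by (rule nondegenerate_gQ_iff[OF N g nd \<theta>])
  assume n1: "\<forall>p\<in>points N. form_norm2 N gN \<theta> p \<noteq> 1"
  let ?G = "real_group \<times>\<times> I" and ?\<mu> = "\<lambda>(s, h). exp (t * s / 2)"
  \<comment> \<open>For t = 0 the translations are isometries and this character is constantly 1;
    for t \<noteq> 0 its value at s = 1 already differs from 1.\<close>
  have "nontrivial_character ?G ?\<mu> \<and> character_splits ?G (prod_mfd rline LI) ?\<mu>" if t: "t \<noteq> 0"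
  proof
    have "\<one>\<^bsub>I\<^esub> \<in> carrier I" using monoid.one_closed[OF group.is_monoid[OF lie_group_facts(1)[OF L]]] .
    then show "nontrivial_character ?G ?\<mu>"
      unfolding nontrivial_character_def using t by (intro bexI[of _ "(1, \<one>\<^bsub>I\<^esub>)"]) simp_all
    show "character_splits ?G (prod_mfd rline LI) ?\<mu>" by (rule character_splits_real_prod[OF L t])
  qed
  with homothety_homogeneous_MQ[OF Q n1]
  show "\<exists>(G :: (real \<times> 'i) monoid) LG \<Psi> \<mu>'. homothety_homogeneous (MQ N) (gQ t N gN \<theta>) G LG \<Psi> \<mu>' \<and>
      (t \<noteq> 0 \<longrightarrow> nontrivial_character G \<mu>' \<and> character_splits G LG \<mu>')" by blast
next
  assume hyps: "riemannian M g \<and> homothety_homogeneous M g H LH \<Phi> \<mu> \<and> nontrivial_character H \<mu> \<and>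
      \<not> VSI M g \<and> character_splits H LH \<mu> \<and> splitting_field M H LH \<Phi> \<mu> \<xi> \<and> spacelike M g \<xi>"
  then obtain \<sigma> where \<sigma>: "\<sigma> \<in> hom positive_reals H" "smooth_map (real_mfd {0<..}) LH \<sigma>"
    "\<forall>s>0. \<mu> (\<sigma> s) = s \<and> (\<forall>h\<in>carrier H. \<sigma> s \<otimes>\<^bsub>H\<^esub> h = h \<otimes>\<^bsub>H\<^esub> \<sigma> s)"
    "\<forall>p\<in>points M. \<xi> p = (\<lambda>f. if smooth_near M p f then deriv (\<lambda>s. f (\<Phi> (\<sigma> s) p)) 1 else 0)"
    unfolding splitting_field_def by blast
  interpret central_flow M g H LH \<Phi> \<mu> \<sigma> \<xi>
  proof
    show "homothety_homogeneous M g H LH \<Phi> \<mu>" using hyps by blast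
    show "g p u u > 0" if "p \<in> points M" "u \<in> tangent_space M p" "u \<noteq> (\<lambda>f. 0)" for p u
      using hyps that unfolding riemannian_def by blast
    show "g p (\<xi> p) (\<xi> p) > 0" if "p \<in> points M" for p using hyps that unfolding spacelike_def by blast
  qed (use \<sigma> in auto)
  obtain LK \<Psi> where LK: "lie_group (H\<lparr>carrier := K\<rparr>) LK" "embedded_submanifold LK LH"
    "lie_isomorphism (positive_reals \<times>\<times> H\<lparr>carrier := K\<rparr>) (prod_mfd (real_mfd {0<..}) LK) H LH \<Psi>"
    using hyps unfolding character_splits_def Let_def K_def by blast
  have "diffeomorphism (prod_mfd (real_mfd {0<..}) LK) LH \<Psi>" using LK(3) unfolding lie_isomorphism_def by blast
  then have con: "connected_space (mtop LK)" by (rule connected_kernel[OF connected_L])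
  have incl: "smooth_map LK LH (\<lambda>p. p)" using LK(2) unfolding embedded_submanifold_def by blast
  show "\<exists>(N' :: 'a mfd) gN' (I' :: 'h monoid) LI' \<alpha>' \<theta>' t'.
           Q_structure N' gN' I' LI' \<alpha>' \<theta>' \<and>
           (\<forall>p\<in>points N'. form_norm2 N' gN' \<theta>' p \<noteq> 1) \<and>
           isometric M g (MQ N') (gQ t' N' gN' \<theta>')"
    by (rule isometric_MQ[OF LK(1) con incl])
qed

end
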